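(* Let $K$ be a virtual link with components labeled $1,\ldots,k$. For $i\ne j\in\{1,\ldots,k\}$ let $l_{\{i,j\}}$ be the minimum, over all diagrams of $K$, of the number of link crossings between components $i$ and $j$, and let $w_{\{i,j\}}^{e_{\max}}$ and $w_{\{i,j\}}^{e_{\min}}$ be, respectively, the highest and lowest powers of $w_{\{i,j\}}$ appearing in the Generalized Link Parity Alexander Polynomial of $K$. Then $\max(|e_{\max}|,|e_{\min}|)\le l_{\{i,j\}}$.
   Context: Virtual links. A virtual link diagram is a collection of oriented closed curves (components) immersed in the plane whose double points are transverse and each is either a classical (real) crossing, with over/under information, or a virtual crossing. A virtual link is an equivalence class of such diagrams (here with labeled components) under planar isotopy, the classical Reidemeister moves I, II, III, and the virtual moves (virtual Reidemeister I, II, III, and the mixed move passing a strand with two consecutive virtual crossings across a classical crossing). Each classical crossing has the usual sign. Crossing types. A classical crossing is a self-crossing if both its strands lie in the same component, and a link crossing (between components $i$ and $j$) if they lie in distinct components $i\neq j$. For component $i$, traverse it once and record only the passages through its self-crossings; in this cyclic word each self-crossing of $i$ occurs twice. A self-crossing of $i$ is even if the number of letters between its two occurrences is even, and odd otherwise. Generalized Link Parity Alexander Polynomial. The arcs of a diagram are the segments between consecutive passages through classical crossings (virtual crossings are ignored); a component without classical crossings contributes one arc $x$ with the trivial relation $x=x$. At each classical crossing let $o_{in},o_{out}$ be the incoming and outgoing arcs of the over-strand and $u_{in},u_{out}$ those of the under-strand. Over the Laurent polynomial ring over $\mathbb{Z}$ in $s,t$, $z_i$ ($1\le i\le k$), and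 $w_{\{i,j\}}$ ($i\ne j$), impose: - even positive self-crossing: $o_{out}=s\,o_{in}$, $u_{out}=t\,u_{in}+(1-st)\,o_{in}$; - even negative self-crossing: $o_{out}=s^{-1}o_{in}$, $u_{out}=t^{-1}u_{in}+(1-s^{-1}t^{-1})\,o_{in}$; - odd positive self-crossing of component $i$: $o_{out}=z_i\,o_{in}$, $u_{out}=z_i^{-1}u_{in}$; - odd negative self-crossing of component $i$: $o_{out}=z_i^{-1}o_{in}$, $u_{out}=z_i\,u_{in}$; - positive link crossing between $i$ and $j$: $o_{out}=w_{\{i,j\}}\,o_{in}$, $u_{out}=w_{\{i,j\}}^{-1}u_{in}$; - negative link crossing between $i$ and $j$: $o_{out}=w_{\{i,j\}}^{-1}o_{in}$, $u_{out}=w_{\{i,j\}}\,u_{in}$. Each arc is the outgoing arc of exactly one relation, so the relations can be written as $Mx=x$ with $x$ the vector of arcs and $M$ a square matrix. The polynomial is $\det(M-I)$, regarded up to multiplication by $\pm s^at^b$, $a,b\in\mathbb{Z}$; up to this ambiguity it is an invariant of $K$. If the polynomial is $0$, set $e_{\max}=e_{\min}=0$. *)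

theory Defs
  imports
    "HOL-Analysis.Analysis"
    "HOL-Library.Poly_Mapping"
    "Jordan_Normal_Form.Determinant"
begin

section \<open>Virtual link diagrams\<close>

text \<open>
  Component \<open>i\<close> of a diagram is a \<open>1\<close>-periodic immersion \<open>curve D i\<close> of the line into the plane
  of complex numbers, so a passage of a component through a point of the plane is a pair
  \<open>(i, t)\<close> with \<open>0 \<le> t < 1\<close>.  The set \<open>over D\<close> consists of the over-passages of the classical
  crossings; a double point with neither of its passages in \<open>over D\<close> is a virtual crossing.
  The components are labeled by \<open>{1..k}\<close>; values of \<open>curve D\<close> at other labels are irrelevant.
\<close>

record vdiagram =
  curve :: "nat \<Rightarrow> real \<Rightarrow> complex"
  over :: "(nat \<times> real) set"

definition passage_points :: "nat \<Rightarrow> (nat \<times> real) set" where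
  "passage_points k = {1..k} \<times> {0..<1}"

definition loc :: "vdiagram \<Rightarrow> nat \<times> real \<Rightarrow> complex" where
  "loc D p = curve D (fst p) (snd p)"

definition velocity :: "vdiagram \<Rightarrow> nat \<times> real \<Rightarrow> complex" where
  "velocity D p = vector_derivative (curve D (fst p)) (at (snd p))"

definition wedge :: "complex \<Rightarrow> complex \<Rightarrow> real" where
  "wedge u v = Re u * Im v - Im u * Re v"

definition closed_immersion :: "(real \<Rightarrow> complex) \<Rightarrow> bool" where
  "closed_immersion c \<longleftrightarrow>
     c C1_differentiable_on UNIV \<and>
     (\<forall>t. vector_derivative c (at t) \<noteq> 0) \<and>
     (\<forall>t. c (t + 1) = c t)"

definition double_pairs :: "nat \<Rightarrow> vdiagram \<Rightarrow> ((nat \<times> real) \<times> (nat \<times> real)) set" where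
  "double_pairs k D =
     {(p, q). p \<in> passage_points k \<and> q \<in> passage_points k \<and> p \<noteq> q \<and> loc D p = loc D q}"

definition is_diagram :: "nat \<Rightarrow> vdiagram \<Rightarrow> bool" where
  "is_diagram k D \<longleftrightarrow>
     (\<forall>i\<in>{1..k}. closed_immersion (curve D i)) \<and>
     finite (double_pairs k D) \<and>
     (\<forall>p q. (p, q) \<in> double_pairs k D \<longrightarrow> wedge (velocity D p) (velocity D q) \<noteq> 0) \<and>
     (\<forall>p q r. (p, q) \<in> double_pairs k D \<and> (p, r) \<in> double_pairs k D \<longrightarrow> q = r) \<and>
     over D \<subseteq> fst ` double_pairs k D \<and>
     (\<forall>p q. (p, q) \<in> double_pairs k D \<longrightarrow> \<not> (p \<in> over D \<and> q \<in> over D))"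

text \<open>A classical crossing is represented by the pair (over-passage, under-passage).\<close>

definition crossings :: "nat \<Rightarrow> vdiagram \<Rightarrow> ((nat \<times> real) \<times> (nat \<times> real)) set" where
  "crossings k D = {(p, q) \<in> double_pairs k D. p \<in> over D}"

text \<open>
  A crossing is positive if turning the over-strand counterclockwise by an angle less than \<open>\<pi>\<close>
  aligns it with the under-strand.
\<close>

definition crossing_sign :: "vdiagram \<Rightarrow> (nat \<times> real) \<times> (nat \<times> real) \<Rightarrow> int" where
  "crossing_sign D c = (if wedge (velocity D (fst c)) (velocity D (snd c)) > 0 then 1 else - 1)"


section \<open>Planar isotopy\<close>

text \<open>
  Final stages of \<open>C\<^sup>1\<close> ambient isotopies of the plane; \<open>H' u z\<close> is the derivative of \<open>H u\<close> at \<open>z\<close>.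
\<close>

definition ambient_isotopy_end :: "(complex \<Rightarrow> complex) \<Rightarrow> bool" where
  "ambient_isotopy_end \<phi> \<longleftrightarrow>
     (\<exists>(H :: real \<Rightarrow> complex \<Rightarrow> complex) (H' :: real \<Rightarrow> complex \<Rightarrow> complex \<Rightarrow>\<^sub>L complex).
        continuous_on ({0..1} \<times> UNIV) (\<lambda>(u, z). H u z) \<and>
        continuous_on ({0..1} \<times> UNIV) (\<lambda>(u, z). H' u z) \<and>
        (\<forall>u\<in>{0..1}. bij (H u) \<and>
           (\<forall>z. (H u has_derivative blinfun_apply (H' u z)) (at z) \<and>
                bij (blinfun_apply (H' u z)))) \<and>
        H 0 = id \<and> H 1 = \<phi>)"

definition circle_reparametrization :: "(real \<Rightarrow> real) \<Rightarrow> bool" where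
  "circle_reparametrization \<tau> \<longleftrightarrow>
     \<tau> C1_differentiable_on UNIV \<and>
     (\<forall>t. vector_derivative \<tau> (at t) > 0) \<and>
     (\<forall>t. \<tau> (t + 1) = \<tau> t + 1)"

definition planar_isotopic :: "nat \<Rightarrow> vdiagram \<Rightarrow> vdiagram \<Rightarrow> bool" where
  "planar_isotopic k D D' \<longleftrightarrow>
     (\<exists>\<phi> \<tau>. ambient_isotopy_end \<phi> \<and>
        (\<forall>i\<in>{1..k}. circle_reparametrization (\<tau> i) \<and>
           (\<forall>t. curve D' i t = \<phi> (curve D i (\<tau> i t))) \<and>
           (\<forall>t\<in>{0..<1}. (i, t) \<in> over D' \<longleftrightarrow> (i, frac (\<tau> i t)) \<in> over D)))"


section \<open>Classical and virtual Reidemeister moves\<close>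

text \<open>
  A tangle consists of finitely many arcs, parametrized by \<open>{-1..1}\<close>, in a fixed rectangle, and of
  its over-passages \<open>(j, x)\<close>, where \<open>j\<close> numbers an arc and \<open>x\<close> is a parameter.  Every disc of the
  plane can be carried to this rectangle by a planar isotopy, so it is enough to perform the
  moves there.  In \<open>tangle_in\<close>, component \<open>c j\<close> of the diagram runs through arc \<open>j\<close>, forwards if
  \<open>r j > 0\<close> and backwards if \<open>r j < 0\<close>, so that all orientations are covered by unoriented arcs;
  it does so without meeting its base point, which a reparametrization can always achieve.
\<close>

type_synonym tangle = "(real \<Rightarrow> complex) list \<times> (nat \<times> real) set"

definition window :: "complex set" where
  "window = cbox (Complex (- 1) (- 2)) (Complex 1 2)"

definition strand_points ::
  "(nat \<Rightarrow> nat) \<Rightarrow> (nat \<Rightarrow> real) \<Rightarrow> (nat \<Rightarrow> real) \<Rightarrow> nat \<Rightarrow> (nat \<times> real) set" where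
  "strand_points c m r j = (\<lambda>x. (c j, m j + r j * x)) ` {-1..1}"

definition tangle_in ::
  "nat \<Rightarrow> vdiagram \<Rightarrow> tangle \<Rightarrow> (nat \<Rightarrow> nat) \<Rightarrow> (nat \<Rightarrow> real) \<Rightarrow> (nat \<Rightarrow> real) \<Rightarrow> bool" where
  "tangle_in k D T c m r \<longleftrightarrow>
     (\<forall>j < length (fst T).
        c j \<in> {1..k} \<and> r j \<noteq> 0 \<and> 0 < m j - \<bar>r j\<bar> \<and> m j + \<bar>r j\<bar> < 1 \<and>
        (\<forall>x\<in>{-1..1}. loc D (c j, m j + r j * x) = (fst T ! j) x \<and>
                     ((c j, m j + r j * x) \<in> over D \<longleftrightarrow> (j, x) \<in> snd T))) \<and>
     (\<forall>j < length (fst T). \<forall>l < length (fst T).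
        j \<noteq> l \<longrightarrow> strand_points c m r j \<inter> strand_points c m r l = {}) \<and>
     (\<forall>p \<in> passage_points k - (\<Union>j < length (fst T). strand_points c m r j). loc D p \<notin> window)"

definition tangle_replacement :: "nat \<Rightarrow> tangle \<Rightarrow> tangle \<Rightarrow> vdiagram \<Rightarrow> vdiagram \<Rightarrow> bool" where
  "tangle_replacement k T T' D D' \<longleftrightarrow>
     length (fst T) = length (fst T') \<and>
     (\<exists>c m r. tangle_in k D T c m r \<and> tangle_in k D' T' c m r \<and>
        (\<forall>p \<in> passage_points k - (\<Union>j < length (fst T). strand_points c m r j).
           loc D p = loc D' p \<and> (p \<in> over D \<longleftrightarrow> p \<in> over D')))"

text \<open>
  The arcs of the moves are built from \<open>bump\<close>, which vanishes to first order at \<open>-1\<close> and \<open>1\<close>, so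
  that both sides of a move have the same endpoints and end velocities.  Note \<open>bump (\<plusminus> 1/2) = 9/16\<close>.
\<close>

definition bump :: "real \<Rightarrow> real" where
  "bump x = (1 - x\<^sup>2)\<^sup>2"

text \<open>
  For a list of arcs, \<open>ov j l\<close> says that arc \<open>j\<close> passes over arc \<open>l\<close>; where neither \<open>ov j l\<close>
  nor \<open>ov l j\<close> holds, arcs \<open>j\<close> and \<open>l\<close> cross virtually.
\<close>

definition tangle_of :: "(real \<Rightarrow> complex) list \<Rightarrow> (nat \<Rightarrow> nat \<Rightarrow> bool) \<Rightarrow> tangle" where
  "tangle_of as ov =
     (as, {(j, x). j < length as \<and> x \<in> {-1..1} \<and>
             (\<exists>l < length as. \<exists>y\<in>{-1..1}. l \<noteq> j \<and> (as ! j) x = (as ! l) y \<and> ov j l)})"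

definition all_virtual :: "nat \<Rightarrow> nat \<Rightarrow> bool" where
  "all_virtual j l \<longleftrightarrow> False"

definition stacked :: "nat \<Rightarrow> (nat \<Rightarrow> nat \<Rightarrow> bool) \<Rightarrow> bool" where
  "stacked n ov \<longleftrightarrow>
     (\<exists>h :: nat \<Rightarrow> nat. inj_on h {..<n} \<and> (\<forall>j<n. \<forall>l<n. ov j l \<longleftrightarrow> h l < h j))"

text \<open>Exactly one pair of arcs crosses classically; any other arc has only virtual crossings.\<close>

definition one_classical :: "nat \<Rightarrow> (nat \<Rightarrow> nat \<Rightarrow> bool) \<Rightarrow> bool" where
  "one_classical n ov \<longleftrightarrow>
     (\<exists>a<n. \<exists>b<n. a \<noteq> b \<and> ov = (\<lambda>j l. j = a \<and> l = b))"

text \<open>The double point of the kink has parameters \<open>-1/2\<close> and \<open>1/2\<close>.\<close>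

definition kink :: "real \<Rightarrow> complex" where
  "kink x = Complex (x - 16/9 * x * bump x) (bump x)"

definition R2_separate :: "(real \<Rightarrow> complex) list" where
  "R2_separate = [\<lambda>x. Complex x 0, \<lambda>x. Complex x (9/16)]"

definition R2_bigon :: "(real \<Rightarrow> complex) list" where
  "R2_bigon = [\<lambda>x. Complex x 0, \<lambda>x. Complex x (9/16 - bump x)]"

definition R3_triangle :: "real \<Rightarrow> (real \<Rightarrow> complex) list" where
  "R3_triangle e =
     [\<lambda>x. Complex x (e * (8/9) * bump x), \<lambda>x. Complex x x, \<lambda>x. Complex x (- x)]"

inductive move :: "tangle \<Rightarrow> tangle \<Rightarrow> bool" where
  R1: "ov = {(0, - 1/2)} \<or> ov = {(0, 1/2)} \<Longrightarrow> move ([\<lambda>x. Complex x 0], {}) ([kink], ov)"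
| R2: "stacked 2 ov \<Longrightarrow> move (tangle_of R2_separate ov) (tangle_of R2_bigon ov)"
| R3: "stacked 3 ov \<Longrightarrow> move (tangle_of (R3_triangle 1) ov) (tangle_of (R3_triangle (- 1)) ov)"
| VR1: "move ([\<lambda>x. Complex x 0], {}) ([kink], {})"
| VR2: "move (tangle_of R2_separate all_virtual) (tangle_of R2_bigon all_virtual)"
| VR3: "move (tangle_of (R3_triangle 1) all_virtual) (tangle_of (R3_triangle (- 1)) all_virtual)"
| mixed: "one_classical 3 ov \<Longrightarrow>
            move (tangle_of (R3_triangle 1) ov) (tangle_of (R3_triangle (- 1)) ov)"


section \<open>Virtual links\<close>

definition diagram_step :: "nat \<Rightarrow> vdiagram \<Rightarrow> vdiagram \<Rightarrow> bool" where
  "diagram_step k D D' \<longleftrightarrow>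
     is_diagram k D \<and> is_diagram k D' \<and>
     (planar_isotopic k D D' \<or> (\<exists>T T'. move T T' \<and> tangle_replacement k T T' D D'))"

definition virtual_links :: "nat \<Rightarrow> vdiagram set set" where
  "virtual_links k =
     {D. is_diagram k D} //
     {(D, D'). is_diagram k D \<and> is_diagram k D' \<and> equivclp (diagram_step k) D D'}"

definition link_crossings ::
  "nat \<Rightarrow> vdiagram \<Rightarrow> nat \<Rightarrow> nat \<Rightarrow> ((nat \<times> real) \<times> (nat \<times> real)) set" where
  "link_crossings k D i j = {(p, q) \<in> crossings k D. {fst p, fst q} = {i, j}}"

definition min_link_crossings :: "nat \<Rightarrow> vdiagram set \<Rightarrow> nat \<Rightarrow> nat \<Rightarrow> nat" where
  "min_link_crossings k K i j = (LEAST n. \<exists>D\<in>K. card (link_crossings k D i j) = n)"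


section \<open>Parity of self-crossings\<close>

definition self_crossing :: "(nat \<times> real) \<times> (nat \<times> real) \<Rightarrow> bool" where
  "self_crossing c \<longleftrightarrow> fst (fst c) = fst (snd c)"

definition self_passages :: "nat \<Rightarrow> vdiagram \<Rightarrow> nat \<Rightarrow> real set" where
  "self_passages k D i =
     {t. \<exists>c\<in>crossings k D. self_crossing c \<and> ((i, t) = fst c \<or> (i, t) = snd c)}"

text \<open>
  The two stretches of the cyclic word between the two occurrences of a letter have lengths of
  the same parity, so it is enough to look at the one not containing the base point.
\<close>

definition even_crossing :: "nat \<Rightarrow> vdiagram \<Rightarrow> (nat \<times> real) \<times> (nat \<times> real) \<Rightarrow> bool" where
  "even_crossing k D c \<longleftrightarrow>
     (let t = snd (fst c); t' = snd (snd c)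
      in even (card (self_passages k D (fst (fst c)) \<inter> {min t t' <..< max t t'})))"


section \<open>The generalized link parity Alexander polynomial\<close>

datatype lvar = S | T | Z nat | W "nat set"

text \<open>
  Laurent polynomials over the integers: finitely supported families of integer coefficients
  indexed by monomials, a monomial being a finitely supported family of integer exponents.
\<close>

type_synonym laurent = "(lvar \<Rightarrow>\<^sub>0 int) \<Rightarrow>\<^sub>0 int"

definition vpow :: "lvar \<Rightarrow> int \<Rightarrow> laurent" where
  "vpow v n = Poly_Mapping.single (Poly_Mapping.single v n) 1"

definition over_coeff :: "nat \<Rightarrow> vdiagram \<Rightarrow> (nat \<times> real) \<times> (nat \<times> real) \<Rightarrow> laurent" where
  "over_coeff k D c =
     (let i = fst (fst c); j = fst (snd c); e = crossing_sign D c in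
      if i \<noteq> j then vpow (W {i, j}) e
      else if even_crossing k D c then vpow S e
      else vpow (Z i) e)"

definition under_coeff :: "nat \<Rightarrow> vdiagram \<Rightarrow> (nat \<times> real) \<times> (nat \<times> real) \<Rightarrow> laurent" where
  "under_coeff k D c =
     (let i = fst (fst c); j = fst (snd c); e = crossing_sign D c in
      if i \<noteq> j then vpow (W {i, j}) (- e)
      else if even_crossing k D c then vpow T e
      else vpow (Z i) (- e))"

definition mixed_coeff :: "nat \<Rightarrow> vdiagram \<Rightarrow> (nat \<times> real) \<times> (nat \<times> real) \<Rightarrow> laurent" where
  "mixed_coeff k D c =
     (let e = crossing_sign D c in
      if self_crossing c \<and> even_crossing k D c then 1 - vpow S e * vpow T e else 0)"

definition passages :: "nat \<Rightarrow> vdiagram \<Rightarrow> nat \<Rightarrow> real set" where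
  "passages k D i = {t. \<exists>c\<in>crossings k D. (i, t) = fst c \<or> (i, t) = snd c}"

text \<open>
  An arc is named by the passage at which it starts, and the arc formed by a whole component
  \<open>i\<close> without classical crossings is named \<open>(i, 0)\<close>.  Thus a passage is also the name of its
  outgoing arc; its incoming arc is named by the cyclically preceding passage.
\<close>

definition arcs :: "nat \<Rightarrow> vdiagram \<Rightarrow> (nat \<times> real) set" where
  "arcs k D =
     {(i, t). i \<in> {1..k} \<and> (t \<in> passages k D i \<or> passages k D i = {} \<and> t = 0)}"

definition arc_in :: "nat \<Rightarrow> vdiagram \<Rightarrow> nat \<times> real \<Rightarrow> nat \<times> real" where
  "arc_in k D p =
     (let P = passages k D (fst p); Q = {t\<in>P. t < snd p}
      in (fst p, if Q = {} then Max P else Max Q))"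

definition crossing_at :: "nat \<Rightarrow> vdiagram \<Rightarrow> nat \<times> real \<Rightarrow> (nat \<times> real) \<times> (nat \<times> real)" where
  "crossing_at k D p = (THE c. c \<in> crossings k D \<and> (p = fst c \<or> p = snd c))"

text \<open>
  The coefficient of the arc \<open>b\<close> in the right-hand side of the relation whose outgoing arc is \<open>a\<close>.
\<close>

definition relation_entry :: "nat \<Rightarrow> vdiagram \<Rightarrow> nat \<times> real \<Rightarrow> nat \<times> real \<Rightarrow> laurent" where
  "relation_entry k D a b =
     (if passages k D (fst a) = {} then (if b = a then 1 else 0)
      else
        let c = crossing_at k D a in
        if a = fst c then (if b = arc_in k D (fst c) then over_coeff k D c else 0)
        else (if b = arc_in k D (snd c) then under_coeff k D c else 0)
           + (if b = arc_in k D (fst c) then mixed_coeff k D c else 0))"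

text \<open>The matrix \<open>M - I\<close>, for an enumeration \<open>as\<close> of the arcs.\<close>

definition relation_matrix :: "nat \<Rightarrow> vdiagram \<Rightarrow> (nat \<times> real) list \<Rightarrow> laurent mat" where
  "relation_matrix k D as =
     mat (length as) (length as) (\<lambda>(x, y). relation_entry k D (as ! x) (as ! y))
       - 1\<^sub>m (length as)"

text \<open>
  The polynomial of a virtual link is only defined up to units \<open>\<plusminus>s\<^sup>at\<^sup>b\<close>; this is the set of all its
  values, over all diagrams of the virtual link.
\<close>

definition glpa_polynomials :: "nat \<Rightarrow> vdiagram set \<Rightarrow> laurent set" where
  "glpa_polynomials k K =
     {e * vpow S a * vpow T b * Determinant.det (relation_matrix k D as) | e a b D as.
        e \<in> {1, - 1} \<and> D \<in> K \<and> distinct as \<and> set as = arcs k D}"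

definition exponents :: "laurent \<Rightarrow> lvar \<Rightarrow> int set" where
  "exponents P v = (\<lambda>m. Poly_Mapping.lookup m v) ` Poly_Mapping.keys P"

definition e_max :: "laurent \<Rightarrow> lvar \<Rightarrow> int" where
  "e_max P v = (if P = 0 then 0 else Max (exponents P v))"

definition e_min :: "laurent \<Rightarrow> lvar \<Rightarrow> int" where
  "e_min P v = (if P = 0 then 0 else Min (exponents P v))"

end

theory Submission
  imports Defs
begin

text \<open>
  Expanding the determinant by the Leibniz formula, the two rows belonging to a link crossing of the
  components \<open>i\<close> and \<open>j\<close> contribute \<open>w\<^sup>0\<close> or \<open>w\<^sup>\<plusminus>\<^sup>1\<close>, with opposite signs in the two rows; so the exponents
  of \<open>w\<close> are bounded in absolute value by the number of these crossings in the diagram at hand.  It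
  remains to see that, up to a unit \<open>\<plusminus>s\<^sup>at\<^sup>b\<close>, the determinant does not depend on the diagram.

  Idle points, at which the outgoing arc equals the incoming one, change the determinant only by a
  sign.  Putting them at both ends of the strands of a move and eliminating the passages inside by
  column operations (with pivots \<open>-1\<close> or \<open>-st\<close>), one is left with a matrix that depends only on how
  the arcs leaving the strands are expressed by those entering them; these expressions agree on the
  two sides of a move.  Numbering the self-passages of a component consecutively, a crossing is even
  iff its two passages have numbers of different parity, so parities are easily compared; a triangle
  of self-crossings has one or three even crossings.  In a planar isotopy the base point may move,
  which shifts the numbering cyclically in a word of even length.
\<close>

section \<open>Determinants over finite index sets\<close>

text \<open>Parity is a global quantity: a move inserts letters into the cyclic word of a component
  and may thus affect crossings far away. So the condition carried along for every move is that each
  strand has equally many self-passages modulo 2 on both sides; then the numbering outside the disc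
  keeps its parity. Nothing is divided during the elimination. The arcs inside the disc are written
  down explicitly as combinations of the arcs entering it, and these combinations solve the
  relations; the powers of the variables being units is all that is used of the ring. The pivot
  \<open>-st\<close>, or its inverse, comes from a kink traversed under-strand first: the arc
  between the two passages leaves the under-passage and enters the over-passage, so it occurs in its
  own relation with coefficient \<open>1 - st\<close>, and subtracting the identity leaves
  \<open>-st\<close>. This is the source of the powers of \<open>s\<close> and \<open>t\<close> in
  the ambiguity; the other pivots and the idle points cost signs only. In a triangle with exactly
  one even crossing, the other two crossings carry the same variable \<open>z\<close> or
  \<open>w\<close>; without this the two sides could not be compared.\<close>

definition enum_mat :: "'a list \<Rightarrow> ('a \<Rightarrow> 'a \<Rightarrow> 'r) \<Rightarrow> 'r mat" where
  "enum_mat xs M = Matrix.mat (length xs) (length xs) (\<lambda>(x, y). M (xs ! x) (xs ! y))"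

text \<open>Indexing by an unordered set lets points be added and removed without renumbering. The
  enumeration picked by \<open>SOME\<close> does not matter, by
  \<open>det_enum_mat_perm\<close>.\<close>

definition sdet :: "'a set \<Rightarrow> ('a \<Rightarrow> 'a \<Rightarrow> 'r::comm_ring_1) \<Rightarrow> 'r" where
  "sdet A M = Determinant.det (enum_mat (SOME xs. distinct xs \<and> set xs = A) M)"

lemma enum_mat_carrier [simp]: "enum_mat xs M \<in> carrier_mat (length xs) (length xs)"
  by (simp add: enum_mat_def)

text \<open>One permutation acts on rows and columns at once, so its sign enters squared.\<close>

lemma det_enum_mat_perm:
  fixes M :: "'a \<Rightarrow> 'a \<Rightarrow> 'r::comm_ring_1"
  assumes "distinct xs" "distinct ys" "set xs = set ys"
  shows "Determinant.det (enum_mat xs M) = Determinant.det (enum_mat ys M)"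
proof -
  let ?n = "length xs"
  have "mset xs = mset ys" by (rule iffD1[OF set_eq_iff_mset_eq_distinct[OF assms(1,2)] assms(3)])
  then obtain p where p: "p permutes {..<length ys}" and xs: "permute_list p ys = xs"
    by (rule mset_eq_permutation)
  have len: "length ys = ?n" using xs by auto
  have p0: "p permutes {0..<?n}" using p len by (simp add: atLeast0LessThan)
  have pn: "p i < ?n" if "i < ?n" for i using permutes_in_image[OF p0, of i] that by simp
  have nth: "xs ! i = ys ! p i" if "i < ?n" for i
    using permute_list_nth[OF p, of i] xs that len by simp
  define B where "B = Matrix.mat ?n ?n (\<lambda>(i, j). M (ys ! p i) (ys ! j))"
  have 1: "Determinant.det B = signof p * Determinant.det (enum_mat ys M)"
  proof -
    have "B = Matrix.mat ?n ?n (\<lambda>(i, j). enum_mat ys M $$ (p i, j))"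
      unfolding B_def enum_mat_def len by (rule cong_mat) (auto simp: pn)
    then show ?thesis using det_permute_rows[OF enum_mat_carrier[of ys M, unfolded len] p0] by (simp only:)
  qed
  \<comment> \<open>The columns are permuted by permuting the rows of the transpose.\<close>
  have "Determinant.det (transpose_mat (enum_mat xs M)) = signof p * Determinant.det (transpose_mat B)"
  proof -
    have "transpose_mat (enum_mat xs M) = Matrix.mat ?n ?n (\<lambda>(i, j). transpose_mat B $$ (p i, j))"
      by (rule eq_matI) (auto simp: B_def enum_mat_def pn nth)
    moreover have "transpose_mat B \<in> carrier_mat ?n ?n" by (simp add: B_def)
    ultimately show ?thesis using det_permute_rows[OF _ p0] by (simp only:)
  qed
  then have "Determinant.det (enum_mat xs M) = signof p * Determinant.det B"
    using det_transpose[OF enum_mat_carrier[of xs M]] det_transpose[of B ?n] by (simp add: B_def)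
  with 1 have "Determinant.det (enum_mat xs M) = (signof p * signof p) * Determinant.det (enum_mat ys M)"
    by simp
  moreover have "signof p * signof p = (1::'r)" by (simp add: sign_def)
  ultimately show ?thesis by (simp only: mult_1_left)
qed

lemma sdet_list:
  assumes "distinct xs"
  shows "sdet (set xs) M = Determinant.det (enum_mat xs M)"
proof -
  have "\<exists>ys. distinct ys \<and> set ys = set xs" using assms by blast
  then have "distinct (SOME ys. distinct ys \<and> set ys = set xs) \<and> set (SOME ys. distinct ys \<and> set ys = set xs) = set xs"
    by (rule someI_ex)
  then show ?thesis unfolding sdet_def using assms by (intro det_enum_mat_perm) auto
qed

lemma sdet_cong:
  assumes "finite A" "\<And>x y. x \<in> A \<Longrightarrow> y \<in> A \<Longrightarrow> M x y = M' x y"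
  shows "sdet A M = sdet A M'"
proof -
  obtain xs where xs: "distinct xs" "set xs = A" using finite_distinct_list[OF assms(1)] by blast
  have "enum_mat xs M = enum_mat xs M'"
    unfolding enum_mat_def by (rule cong_mat) (use assms xs in auto)
  then show ?thesis using sdet_list[OF xs(1)] xs(2) by metis
qed

lemma sdet_reindex:
  assumes "finite A" "inj_on f A"
  shows "sdet (f ` A) M = sdet A (\<lambda>x y. M (f x) (f y))"
proof -
  obtain xs where xs: "distinct xs" "set xs = A" using finite_distinct_list[OF assms(1)] by blast
  have d: "distinct (map f xs)" using xs assms by (simp add: distinct_map)
  have "enum_mat (map f xs) M = enum_mat xs (\<lambda>x y. M (f x) (f y))"
    unfolding enum_mat_def by (simp, rule cong_mat) (auto)
  then show ?thesis using sdet_list[OF xs(1)] sdet_list[OF d] xs(2) by (metis set_map)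
qed

lemma sdet_mult:
  fixes M F :: "'a \<Rightarrow> 'a \<Rightarrow> 'r::comm_ring_1"
  assumes "finite A"
  shows "sdet A (\<lambda>x y. \<Sum>z\<in>A. M x z * F z y) = sdet A M * sdet A F"
proof -
  obtain xs where xs: "distinct xs" "set xs = A" using finite_distinct_list[OF assms(1)] by blast
  have "enum_mat xs M * enum_mat xs F = enum_mat xs (\<lambda>x y. \<Sum>z\<in>A. M x z * F z y)"
  proof (rule eq_matI)
    fix i j assume "i < dim_row (enum_mat xs (\<lambda>x y. \<Sum>z\<in>A. M x z * F z y))"
      and "j < dim_col (enum_mat xs (\<lambda>x y. \<Sum>z\<in>A. M x z * F z y))"
    then have ij: "i < length xs" "j < length xs" by (simp_all add: enum_mat_def)
    have "(\<Sum>z\<in>A. M (xs ! i) z * F z (xs ! j)) = (\<Sum>l<length xs. M (xs ! i) (xs ! l) * F (xs ! l) (xs ! j))"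
      using xs by (intro sum.reindex_bij_betw[symmetric] bij_betw_nth) auto
    then show "(enum_mat xs M * enum_mat xs F) $$ (i, j) = enum_mat xs (\<lambda>x y. \<Sum>z\<in>A. M x z * F z y) $$ (i, j)"
      using ij by (simp add: enum_mat_def scalar_prod_def atLeast0LessThan)
  qed (simp_all add: enum_mat_def)
  moreover have "sdet A G = Determinant.det (enum_mat xs G)" for G :: "'a \<Rightarrow> 'a \<Rightarrow> 'r"
    using sdet_list[OF xs(1)] xs(2) by simp
  ultimately show ?thesis
    using det_mult[OF enum_mat_carrier[of xs M] enum_mat_carrier[of xs F]] by simp
qed

lemma sdet_empty [simp]: "sdet {} M = 1"
  using sdet_list[of "[]" M] by (simp add: enum_mat_def)

text \<open>Laplace expansion along the row of \<open>b\<close>, in which only the diagonal entry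
  can survive.\<close>

lemma sdet_insert_trivial_row:
  assumes "finite A" "b \<notin> A" "\<And>y. y \<in> A \<Longrightarrow> M b y = 0"
  shows "sdet (insert b A) M = M b b * sdet A M"
proof -
  obtain xs where xs: "distinct xs" "set xs = A" using finite_distinct_list[OF assms(1)] by blast
  have d: "distinct (xs @ [b])" using xs assms by simp
  let ?n = "length xs"
  \<comment> \<open>Transposition turns the row of \<open>b\<close> into a column vanishing on
    \<open>A\<close>, which gives the zero block.\<close>
  define T where "T = four_block_mat (transpose_mat (enum_mat xs M)) (0\<^sub>m ?n 1)
     (Matrix.mat 1 ?n (\<lambda>(i, j). M (xs ! j) b)) (Matrix.mat 1 1 (\<lambda>_. M b b))"
  have "transpose_mat (enum_mat (xs @ [b]) M) = T"
    by (rule eq_matI) (use assms xs in \<open>auto simp: T_def enum_mat_def nth_append\<close>)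
  then have "Determinant.det (enum_mat (xs @ [b]) M) = Determinant.det T"
    by (metis det_transpose enum_mat_carrier)
  also have "\<dots> = Determinant.det (transpose_mat (enum_mat xs M)) * Determinant.det (Matrix.mat 1 1 (\<lambda>_. M b b))"
    unfolding T_def by (rule det_four_block_mat_upper_right_zero_col[where n = ?n])
      (auto simp: enum_mat_def)
  also have "Determinant.det (transpose_mat (enum_mat xs M)) = sdet A M"
    by (metis det_transpose enum_mat_carrier sdet_list xs)
  also have "Determinant.det (Matrix.mat 1 1 (\<lambda>_. M b b)) = M b b"
    by (subst det_single) auto
  finally have "Determinant.det (enum_mat (xs @ [b]) M) = M b b * sdet A M" by (simp only: mult.commute)
  moreover have "set (xs @ [b]) = insert b A" using xs by simp
  ultimately show ?thesis using sdet_list[OF d, of M] by (simp only:)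
qed

text \<open>Induction, expanding along a row of \<open>B\<close> of minimal rank: all its
  off-diagonal entries vanish. A constant rank expresses that the \<open>B\<close> block is
  diagonal.\<close>

lemma sdet_triangular_rows:
  fixes rk :: "'a \<Rightarrow> nat"
  assumes "finite B" "finite C" "B \<inter> C = {}"
    and "\<And>b y. b \<in> B \<Longrightarrow> y \<in> C \<Longrightarrow> M b y = 0"
    and "\<And>b b'. b \<in> B \<Longrightarrow> b' \<in> B \<Longrightarrow> b' \<noteq> b \<Longrightarrow> rk b \<le> rk b' \<Longrightarrow> M b b' = 0"
  shows "sdet (B \<union> C) M = (\<Prod>b\<in>B. M b b) * sdet C M"
  using assms
proof (induction "card B" arbitrary: B)
  case 0
  then show ?case by simp
next
  case (Suc n)
  then have "B \<noteq> {}" by auto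
  define b where "b = arg_min_on rk B"
  have b: "b \<in> B" "\<And>y. y \<in> B \<Longrightarrow> rk b \<le> rk y"
    using arg_min_if_finite(1)[OF Suc.prems(1) \<open>B \<noteq> {}\<close>, of rk] arg_min_least[OF Suc.prems(1) \<open>B \<noteq> {}\<close>]
    by (auto simp: b_def)
  have "sdet (insert b ((B - {b}) \<union> C)) M = M b b * sdet ((B - {b}) \<union> C) M"
    using Suc.prems b by (intro sdet_insert_trivial_row) auto
  also have "sdet ((B - {b}) \<union> C) M = (\<Prod>x\<in>B - {b}. M x x) * sdet C M"
    proof (rule Suc.hyps(1))
    show "n = card (B - {b})" using Suc.hyps(2) Suc.prems(1) b(1) by simp
  qed (use Suc.prems in auto)
  also have "insert b ((B - {b}) \<union> C) = B \<union> C" using b by auto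
  finally show ?case
    by (simp only: prod.remove[OF Suc.prems(1) b(1), of "\<lambda>x. M x x"] mult.assoc)
qed

text \<open>Column operations with the coefficients \<open>E\<close> clear the columns of \<open>C\<close> in the rows of \<open>B\<close>.\<close>

lemma sdet_eliminate:
  fixes rk :: "'a \<Rightarrow> nat"
  assumes fin: "finite B" "finite C" and disj: "B \<inter> C = {}"
    and E0: "\<And>b y. b \<in> B \<Longrightarrow> y \<in> C \<Longrightarrow> (\<Sum>z\<in>B. M b z * E z y) + M b y = 0"
    and rk: "\<And>b b'. b \<in> B \<Longrightarrow> b' \<in> B \<Longrightarrow> b' \<noteq> b \<Longrightarrow> rk b \<le> rk b' \<Longrightarrow> M b b' = 0"
  shows "sdet (B \<union> C) M = (\<Prod>b\<in>B. M b b) * sdet C (\<lambda>x y. (\<Sum>z\<in>B. M x z * E z y) + M x y)"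
proof -
  \<comment> \<open>The matrix of the column operations: the identity plus a block with rows in
    \<open>B\<close> and columns in \<open>C\<close>, hence of determinant 1.\<close>
  define F where "F = (\<lambda>z y. if z = y then 1 else if z \<in> B \<and> y \<in> C then E z y else 0)"
  define N where "N = (\<lambda>x y. \<Sum>z\<in>B \<union> C. M x z * F z y)"
  have "sdet (C \<union> B) F = (\<Prod>b\<in>C. F b b) * sdet B F"
    by (rule sdet_triangular_rows[where rk = "\<lambda>_. 0"]) (use fin disj in \<open>auto simp: F_def\<close>)
  moreover have "sdet (B \<union> {}) F = (\<Prod>b\<in>B. F b b) * sdet {} F"
    by (rule sdet_triangular_rows[where rk = "\<lambda>_. 0"]) (use fin disj in \<open>auto simp: F_def\<close>)
  ultimately have "sdet (B \<union> C) F = 1" by (simp add: F_def Un_commute)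
  then have "sdet (B \<union> C) M = sdet (B \<union> C) N"
    using sdet_mult[of "B \<union> C" M F] fin unfolding N_def by simp
  have NB: "N x y = M x y" if "y \<in> B" for x y
  proof -
    have "N x y = (\<Sum>z\<in>B \<union> C. if z = y then M x z else 0)"
      unfolding N_def F_def by (rule sum.cong) (use that disj in auto)
    then show ?thesis using that fin by simp
  qed
  have NC: "N x y = (\<Sum>z\<in>B. M x z * E z y) + M x y" if "y \<in> C" for x y
  proof -
    have "N x y = (\<Sum>z\<in>B. M x z * F z y) + (\<Sum>z\<in>C. M x z * F z y)"
      unfolding N_def using fin disj by (simp add: sum.union_disjoint)
    also have "(\<Sum>z\<in>B. M x z * F z y) = (\<Sum>z\<in>B. M x z * E z y)"
      by (rule sum.cong) (use that disj in \<open>auto simp: F_def\<close>)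
    also have "(\<Sum>z\<in>C. M x z * F z y) = (\<Sum>z\<in>C. if z = y then M x z else 0)"
      by (rule sum.cong) (use that disj in \<open>auto simp: F_def\<close>)
    finally show ?thesis using that fin by simp
  qed
  \<comment> \<open>The operations leave the \<open>B\<close> block of \<open>M\<close> unchanged,
    so it is still triangular, while \<open>E0\<close> clears the rows of \<open>B\<close> on
    \<open>C\<close>.\<close>
  have "sdet (B \<union> C) N = (\<Prod>b\<in>B. N b b) * sdet C N"
    by (rule sdet_triangular_rows[where rk = rk]) (use fin disj rk E0 NB NC in auto)
  also have "(\<Prod>b\<in>B. N b b) = (\<Prod>b\<in>B. M b b)" by (rule prod.cong) (auto simp: NB)
  also have "sdet C N = sdet C (\<lambda>x y. (\<Sum>z\<in>B. M x z * E z y) + M x y)"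
    by (rule sdet_cong) (use fin NC in auto)
  finally show ?thesis using \<open>sdet (B \<union> C) M = sdet (B \<union> C) N\<close> by simp
qed

section \<open>Cyclic words with idle points\<close>

type_synonym passage = "nat \<times> real"

text \<open>The cyclic predecessor on the component of \<open>p\<close>: if no point of
  \<open>N\<close> comes earlier, it wraps round the base point to the last one. A point alone on
  its component precedes itself.\<close>

definition prev :: "passage set \<Rightarrow> passage \<Rightarrow> passage" where
  "prev N p =
     (let P = {t. (fst p, t) \<in> N}; Q = {t\<in>P. t < snd p}
      in (fst p, if Q = {} then Max P else Max Q))"

text \<open>The open cyclic interval from \<open>b\<close> to \<open>a\<close>. It wraps round the
  base point unless \<open>b < a\<close>, and for \<open>b = a\<close> it is everything except that
  point.\<close>

definition between :: "real \<Rightarrow> real \<Rightarrow> real \<Rightarrow> bool" where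
  "between b c a \<longleftrightarrow> (if b < a then b < c \<and> c < a else c < a \<or> b < c)"

lemma finite_slice: "finite N \<Longrightarrow> finite {t. (i, t) \<in> N}"
  by (rule finite_subset[of _ "snd ` N"]) force+

lemma prev_props:
  assumes "finite N" "(fst a, t) \<in> N"
  shows "prev N a \<in> N" "fst (prev N a) = fst a"
    "\<And>c. (fst a, c) \<in> N \<Longrightarrow> \<not> between (snd (prev N a)) c (snd a)"
proof -
  define P where "P = {t. (fst a, t) \<in> N}"
  define Q where "Q = {t\<in>P. t < snd a}"
  have fP: "finite P" "P \<noteq> {}" and fQ: "finite Q"
    using assms by (auto simp: P_def Q_def finite_slice)
  have e: "prev N a = (fst a, if Q = {} then Max P else Max Q)"
    by (simp only: prev_def P_def Q_def Let_def)
  show "fst (prev N a) = fst a" by (simp add: e)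
  have "snd (prev N a) \<in> P"
    using Max_in[OF fP] Max_in[OF fQ] by (auto simp: e Q_def)
  then show "prev N a \<in> N" by (auto simp: e P_def)
  fix c assume "(fst a, c) \<in> N"
  then have c: "c \<in> P" by (simp add: P_def)
  show "\<not> between (snd (prev N a)) c (snd a)"
  proof (cases "Q = {}")
    case True
    then show ?thesis using Max_ge[OF fP(1) c] Max_in[OF fP] c by (auto simp: e between_def Q_def)
  next
    case False
    then have "Max Q < snd a" using Max_in[OF fQ False] by (simp add: Q_def)
    moreover have "c \<le> Max Q" if "c < snd a" using that c by (intro Max_ge fQ) (simp add: Q_def)
    ultimately show ?thesis using False by (auto simp: e between_def)
  qed
qed

text \<open>Two candidates with an empty cyclic interval before \<open>a\<close> would each lie in
  the other's interval unless equal. This characterization replaces the maxima of the definition in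
  what follows.\<close>

lemma prev_eqI:
  assumes "finite N" "b \<in> N" "fst b = fst a"
    and "\<And>c. (fst a, c) \<in> N \<Longrightarrow> \<not> between (snd b) c (snd a)"
  shows "prev N a = b"
proof -
  have *: "(fst a, snd b) \<in> N" using assms(2,3) by (metis prod.collapse)
  note p = prev_props[OF assms(1) *]
  have "(fst a, snd (prev N a)) \<in> N" using p(1,2) by (metis prod.collapse)
  from assms(4)[OF this] p(3)[OF *] have "snd (prev N a) = snd b"
    by (auto simp: between_def split: if_splits)
  then show ?thesis using p(2) assms(3) by (simp add: prod_eq_iff)
qed

text \<open>Each passage belongs to at most one crossing, and in one role only; this makes the
  descriptions by \<open>THE\<close> in \<open>rel\<close> meaningful.\<close>

definition matching :: "('p \<times> 'p) set \<Rightarrow> bool" where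
  "matching Cr \<longleftrightarrow> inj_on fst Cr \<and> inj_on snd Cr \<and> fst ` Cr \<inter> snd ` Cr = {}"

text \<open>
  Besides the passages of crossings, \<open>N\<close> may contain idle points, at which the outgoing arc
  equals the incoming one; \<open>w\<close> gives the three coefficients of a crossing.
\<close>

definition rel ::
  "(passage \<times> passage) set \<Rightarrow> (passage \<times> passage \<Rightarrow> 'r \<times> 'r \<times> 'r) \<Rightarrow>
   passage set \<Rightarrow> passage \<Rightarrow> passage \<Rightarrow> 'r::comm_ring_1" where
  "rel Cr w N a b =
     (if a \<in> fst ` Cr then
        (if b = prev N a then fst (w (THE c. c \<in> Cr \<and> fst c = a)) else 0)
      else if a \<in> snd ` Cr then
        (let c = (THE c. c \<in> Cr \<and> snd c = a)
         in (if b = prev N a then fst (snd (w c)) else 0) +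
            (if b = prev N (fst c) then snd (snd (w c)) else 0))
      else if b = prev N a then 1 else 0)"

definition relmat where
  "relmat Cr w N = (\<lambda>x y. rel Cr w N x y - (if x = y then 1 else 0))"

definition gdet where
  "gdet Cr w N = sdet N (relmat Cr w N)"

lemma rel_over:
  assumes "matching Cr" "(p, q) \<in> Cr"
  shows "rel Cr w N p b = (if b = prev N p then fst (w (p, q)) else 0)"
proof -
  have "(THE c. c \<in> Cr \<and> fst c = p) = (p, q)"
    by (rule the_equality) (use assms in \<open>auto simp: matching_def inj_on_def\<close>)
  moreover have "p \<in> fst ` Cr" using assms(2) by force
  ultimately show ?thesis by (simp add: rel_def)
qed

lemma rel_under:
  assumes "matching Cr" "(p, q) \<in> Cr"
  shows "rel Cr w N q b = (if b = prev N q then fst (snd (w (p, q))) else 0) +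
            (if b = prev N p then snd (snd (w (p, q))) else 0)"
proof -
  have "(THE c. c \<in> Cr \<and> snd c = q) = (p, q)"
    by (rule the_equality) (use assms in \<open>auto simp: matching_def inj_on_def\<close>)
  moreover have "q \<in> snd ` Cr" "q \<notin> fst ` Cr" using assms by (force simp: matching_def)+
  ultimately show ?thesis by (simp add: rel_def Let_def)
qed

lemma rel_idle:
  "a \<notin> fst ` Cr \<Longrightarrow> a \<notin> snd ` Cr \<Longrightarrow> rel Cr w N a b = (if b = prev N a then 1 else 0)"
  by (simp add: rel_def)

text \<open>Deleting \<open>d\<close> bypasses it: the point that came right after \<open>d\<close>
  now comes after the predecessor of \<open>d\<close>. The second point \<open>s\<close> on the
  component keeps \<open>d\<close> from being its own predecessor.\<close>

lemma prev_insert: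
  assumes fin: "finite N" and d: "d \<notin> N" and s: "(fst d, s) \<in> N" and p: "p \<in> N"
  shows "prev N p = (if prev (insert d N) p = d then prev (insert d N) d else prev (insert d N) p)"
proof -
  let ?N = "insert d N"
  have fN: "finite ?N" using fin by simp
  have p': "(fst p, snd p) \<in> N" using p by simp
  have p'': "(fst p, snd p) \<in> ?N" using p by simp
  have d': "(fst d, snd d) \<in> ?N" by simp
  note pp = prev_props[OF fN p''] and dd = prev_props[OF fN d']
  have "s \<noteq> snd d" using d s by auto
  then have "prev ?N d \<noteq> d" using dd(3)[of s] s by (auto simp: between_def)
  then have dN: "prev ?N d \<in> N" using dd(1) by blast
  show ?thesis
  proof (cases "prev ?N p = d")
    case True
    have fp: "fst p = fst d" using True pp(2) by simp
    have np: "snd p \<noteq> snd d" using d p fp by (metis prod_eq_iff)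
    have "prev N p = prev ?N d"
    proof (rule prev_eqI[OF fin dN])
      show "fst (prev ?N d) = fst p" using dd(2) fp by simp
      fix c assume c: "(fst p, c) \<in> N"
      have 1: "\<not> between (snd d) c (snd p)" using pp(3)[of c] c True by simp
      have 2: "\<not> between (snd (prev ?N d)) c (snd d)" using dd(3)[of c] c fp by simp
      have 3: "\<not> between (snd (prev ?N d)) (snd p) (snd d)" using dd(3)[of "snd p"] p' fp by simp
      have 4: "c \<noteq> snd d" using c d fp by auto
      from 1 2 3 4 np show "\<not> between (snd (prev ?N d)) c (snd p)"
        by (auto simp: between_def split: if_splits)
    qed
    then show ?thesis using True by simp
  next
    case False
    have "prev N p = prev ?N p"
      by (rule prev_eqI[OF fin]) (use pp False in auto)
    then show ?thesis using False by simp
  qed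
qed

text \<open>The relation of \<open>d\<close> equates it with the arc before it, with pivot
  \<open>-1\<close>. Substituting that arc for \<open>d\<close> in the other rows is precisely the
  change of \<open>prev\<close> described by \<open>prev_insert\<close>. Without \<open>s\<close>
  the row of \<open>d\<close> would be zero.\<close>

lemma gdet_insert_idle:
  assumes mt: "matching Cr" and fin: "finite N" and pts: "fst ` Cr \<subseteq> N" "snd ` Cr \<subseteq> N"
    and d: "d \<notin> N" and s: "(fst d, s) \<in> N"
  shows "gdet Cr w (insert d N) = - gdet Cr w N"
proof -
  let ?N = "insert d N"
  let ?E = "\<lambda>z y. if y = prev ?N d then 1 else 0"
  have dC: "d \<notin> fst ` Cr" "d \<notin> snd ` Cr" using pts d by auto
  have d': "(fst d, snd d) \<in> ?N" by simp
  have "s \<noteq> snd d" using d s by auto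
  then have nd: "prev ?N d \<noteq> d"
    using prev_props(3)[OF _ d', of s] fin s by (auto simp: between_def)
  have "sdet ({d} \<union> N) (relmat Cr w ?N) = (\<Prod>b\<in>{d}. relmat Cr w ?N b b) *
      sdet N (\<lambda>x y. (\<Sum>z\<in>{d}. relmat Cr w ?N x z * ?E z y) + relmat Cr w ?N x y)"
    by (rule sdet_eliminate[where rk = "\<lambda>_. 0"])
      (use fin d dC nd in \<open>auto simp: relmat_def rel_idle\<close>)
  also have "(\<Prod>b\<in>{d}. relmat Cr w ?N b b) = - 1"
    using dC nd by (simp add: relmat_def rel_idle)
  also have "sdet N (\<lambda>x y. (\<Sum>z\<in>{d}. relmat Cr w ?N x z * ?E z y) + relmat Cr w ?N x y) =
      sdet N (relmat Cr w N)"
  proof (rule sdet_cong[OF fin])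
    fix x y assume x: "x \<in> N" and y: "y \<in> N"
    note pi = prev_insert[OF fin d s]
    have dy: "y \<noteq> d" and dx: "d \<noteq> x" using x y d by auto
    consider q where "(x, q) \<in> Cr" | p where "(p, x) \<in> Cr" | "x \<notin> fst ` Cr" "x \<notin> snd ` Cr"
      by force
    then have "rel Cr w ?N x d * (if y = prev ?N d then 1 else 0) + rel Cr w ?N x y = rel Cr w N x y"
    proof cases
      case 1
      then show ?thesis using dy pi[OF x] by (simp add: rel_over[OF mt 1])
    next
      case 2
      then have "p \<in> N" using pts by force
      from pi[OF this] show ?thesis using dy pi[OF x] by (simp add: rel_under[OF mt 2])
    next
      case 3
      then show ?thesis using dy pi[OF x] by (simp add: rel_idle)
    qed
    then show "(\<Sum>z\<in>{d}. relmat Cr w ?N x z * ?E z y) + relmat Cr w ?N x y = relmat Cr w N x y"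
      using dx by (auto simp: relmat_def algebra_simps)
  qed
  finally show ?thesis by (simp add: gdet_def)
qed

lemma gdet_superset:
  assumes mt: "matching Cr" and fin: "finite N'" and sub: "N \<subseteq> N'"
    and pts: "fst ` Cr \<subseteq> N" "snd ` Cr \<subseteq> N"
    and comp: "\<And>i t. (i, t) \<in> N' \<Longrightarrow> \<exists>s. (i, s) \<in> N"
  shows "gdet Cr w N' \<in> {gdet Cr w N, - gdet Cr w N}"
proof -
  have fN: "finite N" using fin sub by (rule finite_subset[rotated])
  have "finite (N' - N)" using fin by simp
  then have "\<forall>F. N' - N = F \<longrightarrow> gdet Cr w (N \<union> (N' - N)) \<in> {gdet Cr w N, - gdet Cr w N}"
  proof -
    have "gdet Cr w (N \<union> F) \<in> {gdet Cr w N, - gdet Cr w N}" if "finite F" "F \<subseteq> N' - N" for F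
      using that
    proof (induction F)
      case empty
      then show ?case by simp
    next
      case (insert d F)
      obtain s where "(fst d, s) \<in> N" using comp[of "fst d" "snd d"] insert.prems by auto
      then have "gdet Cr w (insert d (N \<union> F)) = - gdet Cr w (N \<union> F)"
        using insert fN pts by (intro gdet_insert_idle[OF mt]) auto
      then show ?case using insert by auto
    qed
    then show ?thesis using fin by blast
  qed
  moreover have "N \<union> (N' - N) = N'" using sub by auto
  ultimately show ?thesis by simp
qed

text \<open>For planar isotopies, where \<open>f\<close> is the change of parameters on the
  passages. Commuting with \<open>prev\<close> is how preservation of the cyclic order enters the
  matrix.\<close>

lemma gdet_image:
  assumes mt: "matching Cr" and fin: "finite N" and inj: "inj_on f N"
    and pts: "fst ` Cr \<subseteq> N" "snd ` Cr \<subseteq> N"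
    and prev: "\<And>p. p \<in> N \<Longrightarrow> prev (f ` N) (f p) = f (prev N p)"
    and prevN: "\<And>p. p \<in> N \<Longrightarrow> prev N p \<in> N"
    and mt': "matching Cr'" and Cr': "Cr' = (\<lambda>(p, q). (f p, f q)) ` Cr"
    and w: "\<And>p q. (p, q) \<in> Cr \<Longrightarrow> w' (f p, f q) = w (p, q)"
  shows "gdet Cr' w' (f ` N) = gdet Cr w N"
proof -
  have "sdet (f ` N) (relmat Cr' w' (f ` N)) = sdet N (\<lambda>x y. relmat Cr' w' (f ` N) (f x) (f y))"
    by (rule sdet_reindex[OF fin inj])
  also have "\<dots> = sdet N (relmat Cr w N)"
  proof (rule sdet_cong[OF fin])
    fix x y assume x: "x \<in> N" and y: "y \<in> N"
    have eq: "f y = f z \<longleftrightarrow> y = z" if "z \<in> N" for z using inj y that by (auto dest: inj_onD)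
    have eqx: "f x = f y \<longleftrightarrow> x = y" using inj x y by (auto dest: inj_onD)
    consider q where "(x, q) \<in> Cr" | p where "(p, x) \<in> Cr" | "x \<notin> fst ` Cr" "x \<notin> snd ` Cr"
      by force
    then have "rel Cr' w' (f ` N) (f x) (f y) = rel Cr w N x y"
    proof cases
      case 1
      then have "(f x, f q) \<in> Cr'" by (auto simp: Cr')
      then show ?thesis
        using x by (simp add: rel_over[OF mt 1] rel_over[OF mt'] prev eq prevN w[OF 1])
    next
      case 2
      then have 3: "(f p, f x) \<in> Cr'" and p: "p \<in> N" using pts by (force simp: Cr')+
      then show ?thesis
        using x by (simp add: rel_under[OF mt 2] rel_under[OF mt' 3] prev eq prevN w[OF 2])
    next
      case 3
      have "p \<noteq> x \<and> q \<noteq> x \<and> p \<in> N \<and> q \<in> N" if "(p, q) \<in> Cr" for p q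
        using that 3 pts by force
      then have "f x \<noteq> f p \<and> f x \<noteq> f q" if "(p, q) \<in> Cr" for p q
        using inj x that by (metis inj_onD)
      then have "f x \<notin> fst ` Cr'" "f x \<notin> snd ` Cr'"
        unfolding Cr' by (force, force)
      then show ?thesis using x 3 by (simp add: rel_idle prev eq prevN)
    qed
    then show "relmat Cr' w' (f ` N) (f x) (f y) = relmat Cr w N x y"
      using eqx by (simp add: relmat_def)
  qed
  finally show ?thesis by (simp add: gdet_def)
qed

section \<open>Strands of a tangle\<close>

text \<open>The part of \<open>tangle_in\<close> about parameters only. As no strand meets the base
  point, the cyclic order along strand \<open>j\<close> is the linear order of
  \<open>r j * x\<close>.\<close>

locale strands =
  fixes n :: nat and c :: "nat \<Rightarrow> nat" and m r :: "nat \<Rightarrow> real"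
  assumes r_nonzero: "j < n \<Longrightarrow> r j \<noteq> 0"
    and lower: "j < n \<Longrightarrow> 0 < m j - \<bar>r j\<bar>"
    and upper: "j < n \<Longrightarrow> m j + \<bar>r j\<bar> < 1"
    and disjoint_strands: "j < n \<Longrightarrow> l < n \<Longrightarrow> j \<noteq> l \<Longrightarrow>
      strand_points c m r j \<inter> strand_points c m r l = {}"
begin

definition pt :: "nat \<Rightarrow> real \<Rightarrow> passage" where
  "pt j x = (c j, m j + r j * x)"

text \<open>For \<open>r j < 0\<close> the component runs through the arc backwards and enters it at
  local parameter \<open>1\<close>; the sign makes \<open>start\<close> and \<open>final\<close>
  follow the direction of travel.\<close>

definition start :: "nat \<Rightarrow> passage" where
  "start j = pt j (- sgn (r j))"

definition final :: "nat \<Rightarrow> passage" where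
  "final j = pt j (sgn (r j))"

lemma start_eq: "start j = (c j, m j - \<bar>r j\<bar>)"
  by (simp add: start_def pt_def abs_sgn)

lemma final_eq: "final j = (c j, m j + \<bar>r j\<bar>)"
  by (simp add: final_def pt_def abs_sgn)

lemma sgn_in: "sgn (r j) \<in> {-1..1}" "- sgn (r j) \<in> {-1..1}"
  by (auto simp: sgn_if)

lemma sgn_notin: "j < n \<Longrightarrow> sgn (r j) \<notin> {-1<..<1}" "j < n \<Longrightarrow> - sgn (r j) \<notin> {-1<..<1}"
  using r_nonzero[of j] by (auto simp: sgn_if)

lemma pt_in_strand: "x \<in> {-1..1} \<Longrightarrow> pt j x \<in> strand_points c m r j"
  by (auto simp: pt_def strand_points_def)

lemma pt_eq_iff:
  assumes "j < n" "l < n" "x \<in> {-1..1}" "y \<in> {-1..1}"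
  shows "pt j x = pt l y \<longleftrightarrow> j = l \<and> x = y"
proof (cases "j = l")
  case True
  then show ?thesis using r_nonzero[OF assms(1)] by (simp add: pt_def)
next
  case False
  then show ?thesis
    using disjoint_strands[OF assms(1,2)] pt_in_strand[OF assms(3), of j] pt_in_strand[OF assms(4), of l]
    by auto
qed

lemma snd_pt_mono:
  assumes "j < n" "x \<in> {-1..1}"
  shows "snd (start j) \<le> snd (pt j x)" "snd (pt j x) \<le> snd (final j)"
proof -
  have "\<bar>r j * x\<bar> \<le> \<bar>r j\<bar> * 1"
    using assms(2) unfolding abs_mult by (intro mult_left_mono) auto
  then show "snd (start j) \<le> snd (pt j x)" "snd (pt j x) \<le> snd (final j)"
    by (auto simp: start_eq final_eq pt_def abs_le_iff)
qed

lemma snd_pt_strict: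
  assumes "j < n" "x \<in> {-1<..<1}"
  shows "snd (start j) < snd (pt j x)" "snd (pt j x) < snd (final j)"
proof -
  have x: "x \<in> {-1..1}" using assms(2) by auto
  have "pt j x \<noteq> start j" "pt j x \<noteq> final j"
    using pt_eq_iff[OF assms(1,1) x] sgn_in[of j] sgn_notin[OF assms(1)] assms(2)
    by (auto simp: start_def final_def)
  then show "snd (start j) < snd (pt j x)" "snd (pt j x) < snd (final j)"
    using snd_pt_mono[OF assms(1) x] by (auto simp: start_eq final_eq pt_def)
qed

lemma strand_coordinate:
  assumes "j < n" "snd (start j) \<le> t" "t \<le> snd (final j)"
  obtains x where "x \<in> {-1..1}" "(c j, t) = pt j x"
proof
  have r: "r j \<noteq> 0" by (rule r_nonzero[OF assms(1)])
  have "\<bar>t - m j\<bar> \<le> \<bar>r j\<bar>"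
    using assms(2,3) by (auto simp: start_eq final_eq abs_le_iff)
  then have "\<bar>(t - m j) / r j\<bar> \<le> 1" using r by (simp add: abs_divide)
  then show "(t - m j) / r j \<in> {-1..1}" unfolding abs_le_iff atLeastAtMost_iff by linarith
  show "(c j, t) = pt j ((t - m j) / r j)" using r by (simp add: pt_def)
qed

text \<open>No wrapping occurs within a strand, so the cyclic interval is an ordinary one and every
  point of it is some \<open>pt j y\<close>.\<close>

lemma prev_pt:
  assumes "finite N" "j < n" "x \<in> {-1..1}" "x' \<in> {-1..1}" "r j * x' < r j * x" "pt j x' \<in> N"
    and "\<And>y. y \<in> {-1..1} \<Longrightarrow> r j * x' < r j * y \<Longrightarrow> r j * y < r j * x \<Longrightarrow> pt j y \<notin> N"
  shows "prev N (pt j x) = pt j x'"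
proof (rule prev_eqI[OF assms(1,6)])
  show "fst (pt j x') = fst (pt j x)" by (simp add: pt_def)
  fix d assume d: "(fst (pt j x), d) \<in> N"
  show "\<not> between (snd (pt j x')) d (snd (pt j x))"
  proof
    assume "between (snd (pt j x')) d (snd (pt j x))"
    then have 1: "snd (pt j x') < d" "d < snd (pt j x)"
      using assms(5) by (auto simp: between_def pt_def)
    then have "snd (start j) \<le> d" "d \<le> snd (final j)"
      using snd_pt_mono[OF assms(2,3)] snd_pt_mono[OF assms(2,4)] by linarith+
    then obtain y where y: "y \<in> {-1..1}" "(c j, d) = pt j y"
      by (rule strand_coordinate[OF assms(2)])
    then have "pt j y \<in> N" using d by (simp add: pt_def)
    with assms(7)[OF y(1)] 1 y(2) show False by (simp add: pt_def)
  qed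
qed

text \<open>The strands without their ends: the ends stay in the matrix as idle points when the
  inside is eliminated.\<close>

definition inner :: "passage set" where
  "inner = (\<Union>j<n. pt j ` {-1<..<1})"

lemma innerI: "j < n \<Longrightarrow> x \<in> {-1<..<1} \<Longrightarrow> pt j x \<in> inner"
  by (auto simp: inner_def simp del: greaterThanLessThan_iff)

text \<open>A strand is entered at \<open>start j\<close> and left at \<open>final j\<close>, both
  in \<open>C\<close>; so of all outside points only \<open>final j\<close> can have a predecessor
  among the new points.\<close>

lemma prev_outer:
  assumes fin: "finite (C \<union> B)" and B: "B \<subseteq> inner" and C: "C \<inter> inner = {}"
    and ends: "\<And>j. j < n \<Longrightarrow> start j \<in> C \<and> final j \<in> C"
    and x: "x \<in> C" and nx: "\<And>j. j < n \<Longrightarrow> x \<noteq> final j"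
  shows "prev (C \<union> B) x = prev C x"
proof -
  have fC: "finite C" using fin by simp
  have x': "(fst x, snd x) \<in> C" using x by simp
  note p = prev_props[OF fC x']
  define b where "b = prev C x"
  have outside: "snd z \<le> snd (start j) \<or> snd (final j) \<le> snd z" 
    if z: "z \<in> C" "fst z = c j" and j: "j < n" for z j
  proof (rule ccontr)
    assume "\<not> ?thesis"
    then have 1: "snd (start j) < snd z" "snd z < snd (final j)" by auto
    then obtain y where y: "y \<in> {-1..1}" "(c j, snd z) = pt j y"
      using strand_coordinate[OF j, of "snd z"] by auto
    then have "z = pt j y" using z(2) by (metis prod.collapse)
    moreover have "y \<noteq> 1 \<and> y \<noteq> - 1"
      using 1 y(2) by (auto simp: start_def final_def pt_def sgn_if split: if_splits)
    then have "y \<in> {-1<..<1}" using y(1) by auto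
    ultimately have "z \<in> inner" using j innerI by simp
    then show False using C z(1) by auto
  qed
  show ?thesis
  proof (rule prev_eqI[OF fin])
    show "prev C x \<in> C \<union> B" "fst (prev C x) = fst x" using p by auto
    fix d assume d: "(fst x, d) \<in> C \<union> B"
    show "\<not> between (snd (prev C x)) d (snd x)"
    proof (cases "(fst x, d) \<in> C")
      case True
      then show ?thesis using p(3) by simp
    next
      case False
      then have "(fst x, d) \<in> inner" using d B by auto
      then obtain j y where j: "j < n" "y \<in> {-1<..<1}" "(fst x, d) = pt j y" by (auto simp: inner_def)
      then have fx: "fst x = c j" and dy: "d = snd (pt j y)" by (auto simp: pt_def)
      have 1: "\<not> between (snd b) (snd (start j)) (snd x)" "\<not> between (snd b) (snd (final j)) (snd x)"
        using p(3)[of "snd (start j)"] p(3)[of "snd (final j)"] ends[OF j(1)] fx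
        by (auto simp: b_def start_def final_def pt_def)
      have 2: "snd b \<le> snd (start j) \<or> snd (final j) \<le> snd b"
        by (rule outside) (use p fx j in \<open>auto simp: b_def\<close>)
      have "snd x \<noteq> snd (final j)"
        using nx[OF j(1)] fx by (auto simp: final_def pt_def prod_eq_iff)
      then have 3: "snd x \<le> snd (start j) \<or> snd (final j) < snd x"
        using outside[OF x fx j(1)] by auto
      show ?thesis
        using 1 2 3 snd_pt_strict[OF j(1,2)] unfolding dy b_def[symmetric]
        by (auto simp: between_def split: if_splits)
    qed
  qed
qed

text \<open>A combination of the arcs entering the strands, as a row of the matrix: an arc is named
  by the point at which it starts, so the arc entering strand \<open>l\<close> is the column
  \<open>start l\<close>.\<close>

definition form :: "(nat \<Rightarrow> 'r::comm_ring_1) \<Rightarrow> passage \<Rightarrow> 'r" where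
  "form k y = (\<Sum>l<n. if y = start l then k l else 0)"

lemma form_unit:
  assumes "j < n"
  shows "form (\<lambda>l. if l = j then 1 else 0) y = (if y = start j then 1 else 0)"
proof -
  have "start l = start j \<longleftrightarrow> l = j" if "l < n" for l
    using pt_eq_iff[OF that assms sgn_in(2) sgn_in(2)] by (auto simp: start_def)
  then have "form (\<lambda>l. if l = j then 1 else 0) y = (\<Sum>l<n. if l = j then (if y = start j then 1 else 0) else 0)"
    unfolding form_def by (intro sum.cong) auto
  then show ?thesis using assms by simp
qed

lemma form_add: "form (\<lambda>l. k l + k' l) y = form k y + form k' y"
  by (simp add: form_def sum.distrib[symmetric] cong: if_cong) (intro sum.cong; simp)

lemma form_scale: "form (\<lambda>l. a * k l) y = a * form k y"
  by (simp add: form_def sum_distrib_left cong: if_cong) (intro sum.cong; simp)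

lemma final_inj: "j < n \<Longrightarrow> l < n \<Longrightarrow> final j = final l \<longleftrightarrow> j = l"
  using pt_eq_iff[OF _ _ sgn_in(1) sgn_in(1)] by (auto simp: final_def)

text \<open>
  The matrix left over when the passages inside the strands are eliminated: the arc leaving strand
  \<open>j\<close> is the combination with coefficients \<open>L j\<close> of the arcs entering the strands.
\<close>

definition reduced where
  "reduced Cr w C L = (\<lambda>x y. (if \<exists>j<n. x = final j then form (L (THE j. j < n \<and> x = final j)) y
      else rel Cr w C x y) - (if x = y then 1 else 0))"

end

section \<open>Crossings, arcs and exponents of a diagram\<close>

lemma vpow_mult: "vpow v a * vpow v b = vpow v (a + b)"
  by (simp add: vpow_def mult_single single_add)

lemma vpow_0 [simp]: "vpow v 0 = 1"
  by (simp add: vpow_def)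

lemma vpow_inverse: "vpow v 1 * vpow v (- 1) = 1" "vpow v (- 1) * vpow v 1 = 1"
  by (simp_all add: vpow_mult)

definition monomial_units :: "laurent set" where
  "monomial_units = {e * vpow S a * vpow T b | e a b. e \<in> {1, - 1}}"

lemma monomial_unitsI: "e \<in> {1, - 1} \<Longrightarrow> e * vpow S a * vpow T b \<in> monomial_units"
  by (auto simp: monomial_units_def)

lemma monomial_units_one: "1 \<in> monomial_units" "- 1 \<in> monomial_units"
  using monomial_unitsI[of 1 0 0] monomial_unitsI[of "- 1" 0 0] by simp_all

lemma monomial_units_mult:
  assumes "u \<in> monomial_units" "v \<in> monomial_units"
  shows "u * v \<in> monomial_units"
proof -
  obtain e a b e' a' b' where u: "u = e * vpow S a * vpow T b" "e \<in> {1, - 1}"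
    and v: "v = e' * vpow S a' * vpow T b'" "e' \<in> {1, - 1}"
    using assms unfolding monomial_units_def by blast
  have "u * v = (e * e') * (vpow S a * vpow S a') * (vpow T b * vpow T b')"
    unfolding u v by (simp only: mult.assoc mult.commute mult.left_commute)
  also have "\<dots> \<in> monomial_units"
    unfolding vpow_mult by (rule monomial_unitsI) (use u v in auto)
  finally show ?thesis .
qed

lemma monomial_units_inverse:
  assumes "u \<in> monomial_units"
  shows "\<exists>v\<in>monomial_units. v * u = 1"
proof -
  obtain e a b where u: "u = e * vpow S a * vpow T b" "e \<in> {1, - 1}"
    using assms unfolding monomial_units_def by blast
  have "(e * vpow S (- a) * vpow T (- b)) * u =
      (e * e) * (vpow S (- a) * vpow S a) * (vpow T (- b) * vpow T b)"
    unfolding u by (simp only: mult.assoc mult.commute mult.left_commute)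
  also have "\<dots> = 1" unfolding vpow_mult using u(2) by auto
  finally show ?thesis using monomial_unitsI[OF u(2)] by blast
qed

section \<open>Crossings of a diagram as a matching of passages\<close>

lemma matchingD:
  assumes "matching Cr"
  shows "(p, q) \<in> Cr \<Longrightarrow> (p, q') \<in> Cr \<Longrightarrow> q = q'"
    and "(p, q) \<in> Cr \<Longrightarrow> (p', q) \<in> Cr \<Longrightarrow> p = p'"
    and "(p, q) \<in> Cr \<Longrightarrow> (q, q') \<notin> Cr"
proof -
  have i: "inj_on fst Cr" "inj_on snd Cr" and d: "fst ` Cr \<inter> snd ` Cr = {}"
    using assms by (auto simp: matching_def)
  show "(p, q) \<in> Cr \<Longrightarrow> (p, q') \<in> Cr \<Longrightarrow> q = q'" using inj_onD[OF i(1), of "(p, q)" "(p, q')"] by simp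
  show "(p, q) \<in> Cr \<Longrightarrow> (p', q) \<in> Cr \<Longrightarrow> p = p'" using inj_onD[OF i(2), of "(p, q)" "(p', q)"] by simp
  show "(q, q') \<notin> Cr" if "(p, q) \<in> Cr"
  proof
    assume "(q, q') \<in> Cr"
    then have "q \<in> fst ` Cr \<inter> snd ` Cr" using that by (simp add: rev_image_eqI)
    then show False using d by simp
  qed
qed

lemma matching_the_crossing:
  assumes "matching Cr" "(p, q) \<in> Cr" "a = p \<or> a = q"
  shows "(THE c. c \<in> Cr \<and> (a = fst c \<or> a = snd c)) = (p, q)"
proof (rule the_equality)
  show "(p, q) \<in> Cr \<and> (a = fst (p, q) \<or> a = snd (p, q))" using assms by auto
  fix c assume "c \<in> Cr \<and> (a = fst c \<or> a = snd c)"
  then obtain p' q' where c: "c = (p', q')" "(p', q') \<in> Cr" "a = p' \<or> a = q'" by (metis prod.collapse)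
  then show "c = (p, q)" using assms matchingD[OF assms(1)] by metis
qed

lemma double_pairs_sym: "(p, q) \<in> double_pairs k D \<Longrightarrow> (q, p) \<in> double_pairs k D"
  by (auto simp: double_pairs_def)

lemma matching_crossings:
  assumes "is_diagram k D"
  shows "matching (crossings k D)" "finite (crossings k D)"
proof -
  have u: "\<And>p q r. (p, q) \<in> double_pairs k D \<Longrightarrow> (p, r) \<in> double_pairs k D \<Longrightarrow> q = r"
    and o: "\<And>p q. (p, q) \<in> double_pairs k D \<Longrightarrow> \<not> (p \<in> over D \<and> q \<in> over D)"
    and f: "finite (double_pairs k D)"
    using assms unfolding is_diagram_def by blast+
  have "inj_on fst (crossings k D)" "inj_on snd (crossings k D)"
    using u double_pairs_sym unfolding crossings_def inj_on_def by auto blast+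
  moreover have "fst ` crossings k D \<inter> snd ` crossings k D = {}"
    using o unfolding crossings_def by auto
  ultimately show "matching (crossings k D)" by (simp add: matching_def)
  show "finite (crossings k D)" by (rule finite_subset[OF _ f]) (auto simp: crossings_def)
qed

definition crossing_points :: "nat \<Rightarrow> vdiagram \<Rightarrow> passage set" where
  "crossing_points k D = fst ` crossings k D \<union> snd ` crossings k D"

lemma passages_eq: "passages k D i = {t. (i, t) \<in> crossing_points k D}"
  by (auto simp: passages_def crossing_points_def image_iff)

lemma crossing_points_subset: "crossing_points k D \<subseteq> passage_points k"
  by (auto simp: crossing_points_def crossings_def double_pairs_def)

lemma finite_crossing_points: "is_diagram k D \<Longrightarrow> finite (crossing_points k D)"
  using matching_crossings(2) by (simp add: crossing_points_def)

definition crossing_weight where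
  "crossing_weight k D c = (over_coeff k D c, under_coeff k D c, mixed_coeff k D c)"

text \<open>The point sets from which the polynomial may be computed; \<open>arcs\<close> is one of
  them. Each component must carry a point, which is idle when the component has no classical
  crossing.\<close>

definition arc_set :: "nat \<Rightarrow> vdiagram \<Rightarrow> passage set \<Rightarrow> bool" where
  "arc_set k D N \<longleftrightarrow> finite N \<and> crossing_points k D \<subseteq> N \<and> N \<subseteq> passage_points k \<and>
     (\<forall>i\<in>{1..k}. \<exists>t. (i, t) \<in> N)"

definition alexander :: "nat \<Rightarrow> vdiagram \<Rightarrow> passage set \<Rightarrow> laurent" where
  "alexander k D N = gdet (crossings k D) (crossing_weight k D) N"

text \<open>Neither set need contain the other, so both are compared with their union.\<close>

lemma alexander_arc_set:
  assumes D: "is_diagram k D" and N: "arc_set k D N" and N': "arc_set k D N'"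
  shows "alexander k D N' \<in> {alexander k D N, - alexander k D N}"
proof -
  note mt = matching_crossings(1)[OF D]
  have "gdet (crossings k D) (crossing_weight k D) (N \<union> N') \<in> {gdet (crossings k D) (crossing_weight k D) M, - gdet (crossings k D) (crossing_weight k D) M}"
    if "M \<in> {N, N'}" for M
    by (rule gdet_superset[OF mt])
      (use that N N' in \<open>auto simp: arc_set_def crossing_points_def passage_points_def\<close>)
  note * = this[of N] this[of N']
  have "b \<in> {a, - a}" if "x \<in> {a, - a}" "x \<in> {b, - b}" for x a b :: laurent
    using that by (auto simp: equation_minus_iff)
  from this[of _ "alexander k D N" "alexander k D N'"] * show ?thesis unfolding alexander_def by blast
qed

lemma arc_set_arcs:
  assumes "is_diagram k D"
  shows "arc_set k D (arcs k D)"
proof -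
  have "arcs k D \<subseteq> crossing_points k D \<union> {1..k} \<times> {0}"
    by (auto simp: arcs_def passages_eq)
  then have "finite (arcs k D)"
    by (rule finite_subset) (simp add: finite_crossing_points[OF assms])
  moreover have "crossing_points k D \<subseteq> arcs k D"
    using crossing_points_subset[of k D] by (auto simp: arcs_def passages_eq passage_points_def)
  moreover have "arcs k D \<subseteq> passage_points k"
    using crossing_points_subset[of k D] by (auto simp: arcs_def passages_eq passage_points_def)
  moreover have "\<exists>t. (i, t) \<in> arcs k D" if "i \<in> {1..k}" for i
    using that by (auto simp: arcs_def)
  ultimately show ?thesis by (simp add: arc_set_def)
qed

lemma arc_in_eq_prev:
  assumes "fst p \<in> {1..k}" "passages k D (fst p) \<noteq> {}"
  shows "arc_in k D p = prev (arcs k D) p"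
proof -
  have "{t. (fst p, t) \<in> arcs k D} = passages k D (fst p)" using assms by (auto simp: arcs_def)
  then show ?thesis by (simp add: arc_in_def prev_def Let_def)
qed

lemma relation_entry_eq_rel:
  assumes D: "is_diagram k D" and a: "a \<in> arcs k D"
  shows "relation_entry k D a b = rel (crossings k D) (crossing_weight k D) (arcs k D) a b"
proof (cases "passages k D (fst a) = {}")
  case True
  then have a0: "a = (fst a, 0)" using a by (auto simp: arcs_def)
  \<comment> \<open>A component without classical crossings has the single arc
    \<open>(i, 0)\<close>, and the idle relation becomes \<open>x = x\<close>.\<close>
  have "prev (arcs k D) a = a"
  proof (rule prev_eqI)
    show "finite (arcs k D)" using arc_set_arcs[OF D] by (simp add: arc_set_def)
    fix c assume "(fst a, c) \<in> arcs k D"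
    then have "c = 0" using True by (auto simp: arcs_def)
    then show "\<not> between (snd a) c (snd a)" by (subst a0, subst a0) (simp add: between_def)
  qed (use a in auto)
  moreover have "a \<notin> crossing_points k D"
    using True by (cases a) (auto simp: passages_eq)
  then have "a \<notin> fst ` crossings k D" "a \<notin> snd ` crossings k D"
    by (auto simp: crossing_points_def)
  ultimately show ?thesis using True by (simp add: relation_entry_def rel_idle)
next
  case False
  note mt = matching_crossings(1)[OF D]
  have i: "fst a \<in> {1..k}" using a by (auto simp: arcs_def)
  have "a \<in> crossing_points k D" using a False by (auto simp: arcs_def passages_eq)
  then consider q where "(a, q) \<in> crossings k D" | p where "(p, a) \<in> crossings k D"
    by (auto simp: crossing_points_def)
  then show ?thesis
  proof cases
    case 1
    have "crossing_at k D a = (a, q)"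
      unfolding crossing_at_def by (rule matching_the_crossing[OF mt 1]) simp
    then show ?thesis using False arc_in_eq_prev[OF i False]
      by (simp add: relation_entry_def rel_over[OF mt 1] crossing_weight_def)
  next
    case 2
    have "p \<in> crossing_points k D" using 2 by (force simp: crossing_points_def)
    then have p: "fst p \<in> {1..k}" "passages k D (fst p) \<noteq> {}"
      using crossing_points_subset[of k D] by (auto simp: passages_eq passage_points_def) (metis prod.collapse)
    have ap: "a \<noteq> p" using matchingD(3)[OF mt, of p p p] 2 by blast
    have "crossing_at k D a = (p, a)"
      unfolding crossing_at_def by (rule matching_the_crossing[OF mt 2]) simp
    then show ?thesis using False arc_in_eq_prev[OF i False] arc_in_eq_prev[OF p] ap
      by (simp add: relation_entry_def rel_under[OF mt 2] crossing_weight_def Let_def)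
  qed
qed

lemma det_relation_matrix:
  assumes D: "is_diagram k D" and xs: "distinct xs" "set xs = arcs k D"
  shows "Determinant.det (relation_matrix k D xs) = alexander k D (arcs k D)"
proof -
  have "xs ! x \<in> arcs k D" if "x < length xs" for x
    using nth_mem[OF that] unfolding xs(2) .
  then have "relation_matrix k D xs = enum_mat xs (relmat (crossings k D) (crossing_weight k D) (arcs k D))"
    by (intro eq_matI)
      (simp_all add: relation_matrix_def enum_mat_def relmat_def nth_eq_iff_index_eq[OF xs(1)]
         relation_entry_eq_rel[OF D])
  then show ?thesis
    using sdet_list[OF xs(1), of "relmat (crossings k D) (crossing_weight k D) (arcs k D)"]
    unfolding xs(2) alexander_def gdet_def by simp
qed

section \<open>Bounds for the exponents of a variable\<close>

definition exponents_in :: "lvar \<Rightarrow> int \<Rightarrow> int \<Rightarrow> laurent \<Rightarrow> bool" where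
  "exponents_in v lo hi P \<longleftrightarrow>
     (\<forall>q\<in>Poly_Mapping.keys P. lo \<le> Poly_Mapping.lookup q v \<and> Poly_Mapping.lookup q v \<le> hi)"

lemma exponents_in_mono: "exponents_in v lo hi P \<Longrightarrow> lo' \<le> lo \<Longrightarrow> hi \<le> hi' \<Longrightarrow> exponents_in v lo' hi' P"
  by (fastforce simp: exponents_in_def)

text \<open>The zero polynomial satisfies every bound. For this reason intervals are tracked instead
  of extreme exponents: cancellation in sums then needs no case distinction.\<close>

lemma exponents_in_0 [simp]: "exponents_in v lo hi 0"
  by (simp add: exponents_in_def)

lemma exponents_in_add: "exponents_in v lo hi P \<Longrightarrow> exponents_in v lo hi Q \<Longrightarrow> exponents_in v lo hi (P + Q)"
  using Poly_Mapping.keys_add[of P Q] by (auto simp: exponents_in_def)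

lemma exponents_in_uminus: "exponents_in v lo hi P \<Longrightarrow> exponents_in v lo hi (- P)"
  by (simp add: exponents_in_def)

lemma exponents_in_diff: "exponents_in v lo hi P \<Longrightarrow> exponents_in v lo hi Q \<Longrightarrow> exponents_in v lo hi (P - Q)"
  using exponents_in_add[OF _ exponents_in_uminus, of v lo hi P Q] by simp

lemma exponents_in_sum: "(\<And>x. x \<in> A \<Longrightarrow> exponents_in v lo hi (f x)) \<Longrightarrow> exponents_in v lo hi (sum f A)"
  by (induction A rule: infinite_finite_induct) (auto intro: exponents_in_add)

lemma exponents_in_mult:
  assumes "exponents_in v lo hi P" "exponents_in v lo' hi' Q"
  shows "exponents_in v (lo + lo') (hi + hi') (P * Q)"
  unfolding exponents_in_def
proof
  fix q assume "q \<in> Poly_Mapping.keys (P * Q)"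
  then obtain a b where "a \<in> Poly_Mapping.keys P" "b \<in> Poly_Mapping.keys Q" "q = a + b"
    using Poly_Mapping.keys_mult[of P Q] by blast
  then show "lo + lo' \<le> Poly_Mapping.lookup q v \<and> Poly_Mapping.lookup q v \<le> hi + hi'"
    using assms by (auto simp: exponents_in_def lookup_add intro: add_mono)
qed

lemma exponents_in_vpow: "exponents_in v (if u = v then a else 0) (if u = v then a else 0) (vpow u a)"
  by (auto simp: exponents_in_def vpow_def lookup_single)

lemma exponents_in_1: "exponents_in v 0 0 1"
  using exponents_in_vpow[of v v 0] by simp

lemma exponents_in_prod:
  "(\<And>x. x \<in> A \<Longrightarrow> exponents_in v (lo x) (hi x) (f x)) \<Longrightarrow> exponents_in v (sum lo A) (sum hi A) (prod f A)"
  by (induction A rule: infinite_finite_induct) (auto intro: exponents_in_1 exponents_in_mult)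

text \<open>Each product in the Leibniz formula takes one entry from every row, so bounds that
  depend on the row only add up.\<close>

lemma exponents_in_det:
  assumes A: "A \<in> carrier_mat n n"
    and e: "\<And>x y. x < n \<Longrightarrow> y < n \<Longrightarrow> exponents_in v (lo x) (hi x) (A $$ (x, y))"
  shows "exponents_in v (sum lo {0..<n}) (sum hi {0..<n}) (Determinant.det A)"
  unfolding det_def'[OF A]
proof (rule exponents_in_sum)
  fix p assume "p \<in> {p. p permutes {0..<n}}"
  then have p: "p x < n" if "x < n" for x using permutes_in_image[of p "{0..<n}" x] that by simp
  have "exponents_in v (sum lo {0..<n}) (sum hi {0..<n}) (\<Prod>x = 0..<n. A $$ (x, p x))"
    by (rule exponents_in_prod) (use e p in auto)
  then show "exponents_in v (sum lo {0..<n}) (sum hi {0..<n}) (signof p * (\<Prod>x = 0..<n. A $$ (x, p x)))"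
    by (auto simp: sign_def intro: exponents_in_uminus)
qed

lemma exponents_in_sdet:
  assumes fin: "finite A"
    and e: "\<And>x y. x \<in> A \<Longrightarrow> y \<in> A \<Longrightarrow> exponents_in v (lo x) (hi x) (M x y)"
  shows "exponents_in v (sum lo A) (sum hi A) (sdet A M)"
proof -
  obtain xs where xs: "distinct xs" "set xs = A" using finite_distinct_list[OF fin] by blast
  have s: "sum f A = (\<Sum>x = 0..<length xs. f (xs ! x))" for f :: "'a \<Rightarrow> int"
    using sum.reindex_bij_betw[OF bij_betw_nth[OF xs(1) _ xs(2)[symmetric], of "{0..<length xs}"], of f]
    by (simp add: atLeast0LessThan)
  have "exponents_in v (\<Sum>x = 0..<length xs. lo (xs ! x)) (\<Sum>x = 0..<length xs. hi (xs ! x))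
      (Determinant.det (enum_mat xs M))"
    by (rule exponents_in_det) (use e xs in \<open>auto simp: enum_mat_def\<close>)
  then show ?thesis using sdet_list[OF xs(1), of M] xs(2) s by simp
qed

text \<open>A crossing of the two components has an entry \<open>w^e\<close> in its over-row and
  \<open>w^-e\<close> in its under-row. Together with the exponent 0 of the identity matrix, one row
  allows \<open>[0, 1]\<close> and the other \<open>[-1, 0]\<close>, whatever the sign; all
  remaining rows are free of \<open>w\<close>.\<close>

lemma alexander_exponents:
  assumes D: "is_diagram k D" and N: "arc_set k D N" and ij: "i \<noteq> j"
  shows "exponents_in (W {i, j}) (- int (card (link_crossings k D i j))) (card (link_crossings k D i j))
    (alexander k D N)"
proof -
  let ?v = "W {i, j}" and ?L = "link_crossings k D i j" and ?s = "crossing_sign D"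
  note mt = matching_crossings(1)[OF D]
  have LC: "?L \<subseteq> crossings k D" by (auto simp: link_crossings_def)
  then have finL: "finite ?L" by (rule finite_subset) (rule matching_crossings(2)[OF D])
  have finN: "finite N" and pts: "fst ` crossings k D \<subseteq> N" "snd ` crossings k D \<subseteq> N"
    using N by (auto simp: arc_set_def crossing_points_def)
  \<comment> \<open>\<open>g 1 a\<close> bounds the exponents in row \<open>a\<close> from above and
    \<open>- g (- 1) a\<close> from below. Truncation at 0 accounts for the entries free of
    \<open>w\<close>.\<close>
  define g :: "int \<Rightarrow> passage \<Rightarrow> int" where
    "g e a = (\<Sum>c\<in>?L. (if fst c = a then max 0 (e * ?s c) else 0) + (if snd c = a then max 0 (- (e * ?s c)) else 0))" for e a
  \<comment> \<open>The sign is 1 or -1, so of the two truncated terms of a crossing exactly one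
    equals 1.\<close>
  have g_sum: "sum (g e) N = int (card ?L)" if "e \<in> {1, - 1}" for e
  proof -
    have "sum (g e) N = (\<Sum>c\<in>?L. \<Sum>a\<in>N. (if fst c = a then max 0 (e * ?s c) else 0) + (if snd c = a then max 0 (- (e * ?s c)) else 0))"
      unfolding g_def by (rule sum.swap)
    also have "\<dots> = (\<Sum>c\<in>?L. 1)"
    proof (rule sum.cong[OF refl])
      fix c assume "c \<in> ?L"
      then have "fst c \<in> N" "snd c \<in> N" using LC pts by auto
      then show "(\<Sum>a\<in>N. (if fst c = a then max 0 (e * ?s c) else 0) + (if snd c = a then max 0 (- (e * ?s c)) else 0)) = 1"
        using finN that by (auto simp: sum.distrib crossing_sign_def)
    qed
    finally show ?thesis by simp
  qed
  have g_ge: "g e (fst c) \<ge> max 0 (e * ?s c)" "g e (snd c) \<ge> max 0 (- (e * ?s c))" if "c \<in> ?L" for e c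
  proof -
    let ?t = "\<lambda>a c. (if fst c = a then max 0 (e * ?s c) else 0) + (if snd c = a then max 0 (- (e * ?s c)) else (0::int))"
    have "?t a c \<le> g e a" for a
      unfolding g_def using finL that by (intro member_le_sum) auto
    from this[of "fst c"] this[of "snd c"] show "g e (fst c) \<ge> max 0 (e * ?s c)" "g e (snd c) \<ge> max 0 (- (e * ?s c))"
      by (auto split: if_splits)
  qed
  have g_nonneg: "g e a \<ge> 0" for e a unfolding g_def by (rule sum_nonneg) auto
  have "exponents_in ?v (sum (\<lambda>x. - g (- 1) x) N) (sum (g 1) N) (sdet N (relmat (crossings k D) (crossing_weight k D) N))"
  proof (rule exponents_in_sdet[OF finN])
    fix x y assume x: "x \<in> N" "y \<in> N"
    have zero: "exponents_in ?v (- g (- 1) x) (g 1 x) P" if "exponents_in ?v 0 0 P" for P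
      by (rule exponents_in_mono[OF that]) (use g_nonneg in auto)
    have oth: "exponents_in ?v 0 0 (vpow S e)" "exponents_in ?v 0 0 (vpow T e)" "exponents_in ?v 0 0 (vpow (Z l) e)" for e l
      using exponents_in_vpow[of ?v S e] exponents_in_vpow[of ?v T e] exponents_in_vpow[of ?v "Z l" e] by simp_all
    have mix: "exponents_in ?v 0 0 (mixed_coeff k D c)" for c
      using exponents_in_mult[OF oth(1,2)] exponents_in_diff[OF exponents_in_1] by (auto simp: mixed_coeff_def Let_def)
    have W: "{l, l'} = {i, j}" if "W {l, l'} = ?v" for l l' using that by simp
    have "exponents_in ?v (- g (- 1) x) (g 1 x) (rel (crossings k D) (crossing_weight k D) N x y)"
    proof -
      consider q where "(x, q) \<in> crossings k D" | p where "(p, x) \<in> crossings k D" | "x \<notin> fst ` crossings k D" "x \<notin> snd ` crossings k D"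
        by force
      then show ?thesis
      proof cases
        case 1
        have "exponents_in ?v (- g (- 1) x) (g 1 x) (over_coeff k D (x, q))"
        proof (cases "{fst x, fst q} = {i, j}")
          case True
          then have "(x, q) \<in> ?L" using 1 by (auto simp: link_crossings_def)
          note g = g_ge(1)[OF this, of 1] g_ge(1)[OF this, of "- 1"]
          have "fst x \<noteq> fst q" using True ij by (auto simp: doubleton_eq_iff)
          then have "over_coeff k D (x, q) = vpow ?v (?s (x, q))"
            by (simp add: over_coeff_def Let_def True)
          then show ?thesis using exponents_in_vpow[of ?v ?v "?s (x, q)"] g
            by (auto elim!: exponents_in_mono)
        next
          case False
          then have "exponents_in ?v 0 0 (vpow (W {fst x, fst q}) e)" for e
            using exponents_in_vpow[of ?v "W {fst x, fst q}" e] by simp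
          then show ?thesis using oth zero by (auto simp: over_coeff_def Let_def)
        qed
        then show ?thesis by (simp add: rel_over[OF mt 1] crossing_weight_def)
      next
        case 2
        have "exponents_in ?v (- g (- 1) x) (g 1 x) (under_coeff k D (p, x))"
        proof (cases "{fst p, fst x} = {i, j}")
          case True
          then have "(p, x) \<in> ?L" using 2 by (auto simp: link_crossings_def)
          note g = g_ge(2)[OF this, of 1] g_ge(2)[OF this, of "- 1"]
          have "fst p \<noteq> fst x" using True ij by (auto simp: doubleton_eq_iff)
          then have "under_coeff k D (p, x) = vpow ?v (- ?s (p, x))"
            by (simp add: under_coeff_def Let_def True)
          then show ?thesis using exponents_in_vpow[of ?v ?v "- ?s (p, x)"] g
            by (auto elim!: exponents_in_mono)
        next
          case False
          then have "exponents_in ?v 0 0 (vpow (W {fst p, fst x}) e)" for e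
            using exponents_in_vpow[of ?v "W {fst p, fst x}" e] by simp
          then show ?thesis using oth zero by (auto simp: under_coeff_def Let_def)
        qed
        then show ?thesis using zero[OF mix, of "(p, x)"] zero[OF exponents_in_0]
          unfolding rel_under[OF mt 2] crossing_weight_def fst_conv snd_conv
          by (intro exponents_in_add) (simp_all split: if_split)
      next
        case 3
        then show ?thesis using zero[OF exponents_in_1] by (simp add: rel_idle)
      qed
    qed
    then show "exponents_in ?v (- g (- 1) x) (g 1 x) (relmat (crossings k D) (crossing_weight k D) N x y)"
      unfolding relmat_def using zero[OF exponents_in_1] by (auto intro: exponents_in_diff)
  qed
  then show ?thesis using g_sum by (simp add: alexander_def gdet_def sum_negf)
qed

section \<open>Parity through the numbering of self-passages\<close>

definition self_index :: "nat \<Rightarrow> vdiagram \<Rightarrow> nat \<Rightarrow> real \<Rightarrow> nat" where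
  "self_index k D i t = card {u \<in> self_passages k D i. u < t}"

lemma self_passages_eq:
  "self_passages k D i = snd ` (fst ` {c \<in> crossings k D. fst (fst c) = i \<and> fst (snd c) = i}) \<union>
     snd ` (snd ` {c \<in> crossings k D. fst (fst c) = i \<and> fst (snd c) = i})"
proof (rule Set.set_eqI)
  fix t
  have "t \<in> self_passages k D i \<longleftrightarrow>
      (\<exists>c\<in>{c \<in> crossings k D. fst (fst c) = i \<and> fst (snd c) = i}. snd (fst c) = t \<or> snd (snd c) = t)"
  proof
    assume "t \<in> self_passages k D i"
    then obtain p q where "(p, q) \<in> crossings k D" "fst p = fst q" "(i, t) = p \<or> (i, t) = q"
      unfolding self_passages_def self_crossing_def by auto
    then show "\<exists>c\<in>{c \<in> crossings k D. fst (fst c) = i \<and> fst (snd c) = i}. snd (fst c) = t \<or> snd (snd c) = t"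
      by (intro bexI[of _ "(p, q)"]) auto
  next
    assume "\<exists>c\<in>{c \<in> crossings k D. fst (fst c) = i \<and> fst (snd c) = i}. snd (fst c) = t \<or> snd (snd c) = t"
    then obtain c where c: "c \<in> crossings k D" "fst (fst c) = i" "fst (snd c) = i" "snd (fst c) = t \<or> snd (snd c) = t"
      by auto
    then have "(i, t) = fst c \<or> (i, t) = snd c" by (auto simp: prod_eq_iff)
    moreover have "fst (fst c) = fst (snd c)" using c by simp
    ultimately show "t \<in> self_passages k D i"
      using c(1) unfolding self_passages_def self_crossing_def by blast
  qed
  then show "t \<in> self_passages k D i \<longleftrightarrow>
    t \<in> snd ` (fst ` {c \<in> crossings k D. fst (fst c) = i \<and> fst (snd c) = i}) \<union>
      snd ` (snd ` {c \<in> crossings k D. fst (fst c) = i \<and> fst (snd c) = i})"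
    unfolding image_image by (auto simp: image_iff)
qed

lemma finite_self_passages: "is_diagram k D \<Longrightarrow> finite (self_passages k D i)"
  using matching_crossings(2)[of k D] by (simp add: self_passages_eq)

text \<open>Every self-crossing contributes two distinct passages. Because of this, a shift of the
  base point changes all numbers on a component by the same parity.\<close>

lemma even_card_self_passages:
  assumes "is_diagram k D"
  shows "even (card (self_passages k D i))"
proof -
  define Cr where "Cr = {c \<in> crossings k D. fst (fst c) = i \<and> fst (snd c) = i}"
  have fin: "finite Cr" using matching_crossings(2)[OF assms] by (simp add: Cr_def)
  have mt: "inj_on fst (crossings k D)" "inj_on snd (crossings k D)" "fst ` crossings k D \<inter> snd ` crossings k D = {}"
    using matching_crossings(1)[OF assms] by (auto simp: matching_def)
  have sub: "Cr \<subseteq> crossings k D" by (auto simp: Cr_def)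
  have i1: "inj_on snd (fst ` Cr)" "inj_on snd (snd ` Cr)"
    by (auto simp: inj_on_def Cr_def)
  have c1: "card (snd ` (fst ` Cr)) = card Cr" "card (snd ` (snd ` Cr)) = card Cr"
    using card_image[OF i1(1)] card_image[OF i1(2)] card_image[OF inj_on_subset[OF mt(1) sub]]
      card_image[OF inj_on_subset[OF mt(2) sub]] by simp_all
  have "snd ` (fst ` Cr) \<inter> snd ` (snd ` Cr) = {}"
  proof (rule ccontr)
    assume "\<not> ?thesis"
    then obtain c d where "c \<in> Cr" "d \<in> Cr" "snd (fst c) = snd (snd d)" by blast
    then have "fst c = snd d" by (auto simp: Cr_def prod_eq_iff)
    moreover have "fst c \<in> fst ` crossings k D" "snd d \<in> snd ` crossings k D"
      using sub \<open>c \<in> Cr\<close> \<open>d \<in> Cr\<close> by auto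
    ultimately show False using mt(3) by auto
  qed
  then have "card (self_passages k D i) = card Cr + card Cr"
    unfolding self_passages_eq Cr_def[symmetric] using fin c1 by (simp add: card_Un_disjoint)
  then show ?thesis by simp
qed

text \<open>The two numbers differ by one more than the number of letters between the occurrences.
  In this form the parity is a sum of one term per passage.\<close>

lemma even_crossing_iff:
  assumes D: "is_diagram k D" and c: "(p, q) \<in> crossings k D" and self: "fst p = fst q"
  shows "even_crossing k D (p, q) \<longleftrightarrow>
    odd (self_index k D (fst p) (snd p) + self_index k D (fst p) (snd q))"
proof -
  let ?P = "self_passages k D (fst p)"
  have fin: "finite ?P" by (rule finite_self_passages[OF D])
  have pP: "snd p \<in> ?P" "snd q \<in> ?P"
    unfolding self_passages_eq image_image
    by (rule UnI1, rule image_eqI[of _ _ "(p, q)"]; use c self in simp)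
      (rule UnI2, rule image_eqI[of _ _ "(p, q)"]; use c self in simp)
  have pq: "snd p \<noteq> snd q"
    using c self by (auto simp: crossings_def double_pairs_def prod_eq_iff)
  \<comment> \<open>The summand 1 counts \<open>a\<close> itself.\<close>
  have *: "card {u \<in> ?P. u < b} = card {u \<in> ?P. u < a} + 1 + card (?P \<inter> {a<..<b})" if "a < b" "a \<in> ?P" for a b
  proof -
    have "{u \<in> ?P. u < b} = insert a ({u \<in> ?P. u < a} \<union> (?P \<inter> {a<..<b}))" using that by auto
    moreover have "card (insert a ({u \<in> ?P. u < a} \<union> (?P \<inter> {a<..<b}))) = Suc (card ({u \<in> ?P. u < a} \<union> (?P \<inter> {a<..<b})))"
      using fin by (subst card_insert_disjoint) auto
    moreover have "card ({u \<in> ?P. u < a} \<union> (?P \<inter> {a<..<b})) = card {u \<in> ?P. u < a} + card (?P \<inter> {a<..<b})"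
      using fin by (intro card_Un_disjoint) auto
    ultimately show ?thesis by simp
  qed
  show ?thesis
  proof (cases "snd p < snd q")
    case True
    then show ?thesis using *[OF True pP(1)] by (auto simp: even_crossing_def Let_def self_index_def)
  next
    case False
    then have "snd q < snd p" using pq by simp
    then show ?thesis using *[OF _ pP(2)] by (auto simp: even_crossing_def Let_def self_index_def)
  qed
qed

section \<open>Elimination of the passages of a tangle\<close>

text \<open>Odd self-crossings and link crossings have relations of the same shape, with
  \<open>v\<close> the variable \<open>z\<close> or \<open>w\<close>; \<open>ev\<close> marks the
  even self-crossings.\<close>

definition weight :: "bool \<Rightarrow> lvar \<Rightarrow> int \<Rightarrow> laurent \<times> laurent \<times> laurent" where
  "weight ev v e =
     (if ev then (vpow S e, vpow T e, 1 - vpow S e * vpow T e) else (vpow v e, vpow v (- e), 0))"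

definition entry :: "nat \<Rightarrow> nat \<Rightarrow> laurent" where
  "entry j l = (if l = j then 1 else 0)"

text \<open>A certificate that eliminating the passages inside yields \<open>L\<close>.
  \<open>X j\<close> holds the local parameters of the passages on strand \<open>j\<close>,
  \<open>pv\<close> leads to the preceding passage or to the entrance, and \<open>K j x\<close>
  expresses the arc leaving a passage by the arcs entering the strands. By \<open>rk\<close> each
  arc depends on arcs of smaller rank only; the one exception in \<open>rk_cross\<close> is a kink
  entered at its under-passage, whose diagonal entry must then be a unit.\<close>

locale transfer = strands +
  fixes X :: "nat \<Rightarrow> real set" and pv :: "nat \<Rightarrow> real \<Rightarrow> real"
    and K :: "nat \<Rightarrow> real \<Rightarrow> nat \<Rightarrow> laurent" and rk :: "nat \<Rightarrow> real \<Rightarrow> nat"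
    and In :: "(passage \<times> passage) set"
    and w :: "passage \<times> passage \<Rightarrow> laurent \<times> laurent \<times> laurent"
    and L :: "nat \<Rightarrow> nat \<Rightarrow> laurent"
  assumes X: "j < n \<Longrightarrow> finite (X j) \<and> X j \<subseteq> {-1<..<1}"
    and In: "(p, q) \<in> In \<Longrightarrow> \<exists>a<n. \<exists>b<n. \<exists>x\<in>X a. \<exists>y\<in>X b. p = pt a x \<and> q = pt b y"
    and X_In: "j < n \<Longrightarrow> x \<in> X j \<Longrightarrow> pt j x \<in> fst ` In \<union> snd ` In"
    and pv: "j < n \<Longrightarrow> x \<in> insert (sgn (r j)) (X j) \<Longrightarrow>
        pv j x \<in> insert (- sgn (r j)) (X j) \<and> r j * pv j x < r j * x \<and>
        (\<forall>y\<in>X j. \<not> (r j * pv j x < r j * y \<and> r j * y < r j * x))"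
    and K_start: "j < n \<Longrightarrow> K j (- sgn (r j)) = entry j"
    and K_over: "a < n \<Longrightarrow> b < n \<Longrightarrow> x \<in> X a \<Longrightarrow> y \<in> X b \<Longrightarrow> (pt a x, pt b y) \<in> In \<Longrightarrow>
        K a x l = fst (w (pt a x, pt b y)) * K a (pv a x) l"
    and K_under: "a < n \<Longrightarrow> b < n \<Longrightarrow> x \<in> X a \<Longrightarrow> y \<in> X b \<Longrightarrow> (pt a x, pt b y) \<in> In \<Longrightarrow>
        K b y l = fst (snd (w (pt a x, pt b y))) * K b (pv b y) l +
                  snd (snd (w (pt a x, pt b y))) * K a (pv a x) l"
    and rk_cross: "a < n \<Longrightarrow> b < n \<Longrightarrow> x \<in> X a \<Longrightarrow> y \<in> X b \<Longrightarrow> (pt a x, pt b y) \<in> In \<Longrightarrow>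
        pv a x \<in> X a \<Longrightarrow> rk a (pv a x) < rk b y \<or>
         a = b \<and> pv a x = y \<and> snd (snd (w (pt a x, pt b y))) - 1 \<in> monomial_units"
    and rk: "j < n \<Longrightarrow> x \<in> X j \<Longrightarrow> pv j x \<in> X j \<Longrightarrow> rk j (pv j x) < rk j x"
    and L: "j < n \<Longrightarrow> L j = K j (pv j (sgn (r j)))"

context transfer
begin

text \<open>The coefficients \<open>K\<close> serve as column operations. They clear the inside rows
  because \<open>K\<close> satisfies the relations, and they alter only those outside rows that see
  an inside arc, namely the rows of the points \<open>final j\<close>.\<close>

lemma tangle_reduce:
  assumes finC: "finite C" and C: "C \<inter> inner = {}"
    and ends: "\<And>j. j < n \<Longrightarrow> start j \<in> C \<and> final j \<in> C"
    and mt: "matching (Out \<union> In)"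
    and Out: "fst ` Out \<union> snd ` Out \<subseteq> C - (start ` {..<n} \<union> final ` {..<n})"
  shows "\<exists>u\<in>monomial_units. gdet (Out \<union> In) w (C \<union> (\<Union>j<n. pt j ` X j)) =
    u * sdet C (reduced Out w C (\<lambda>j. K j (pv j (sgn (r j)))))"
proof -
  define B where "B = (\<Union>j<n. pt j ` X j)"
  define N where "N = C \<union> B"
  let ?M = "relmat (Out \<union> In) w N"
  let ?L = "\<lambda>j. K j (pv j (sgn (r j)))"
  have Xc: "x \<in> {-1..1}" if "j < n" "x \<in> X j" for j x using X[OF that(1)] that(2) by auto
  have finB: "finite B" using X by (auto simp: B_def)
  have finN: "finite N" using finB finC by (simp add: N_def)
  have Bi: "B \<subseteq> inner" using X by (fastforce simp: B_def inner_def)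
  have BC: "B \<inter> C = {}" using Bi C by auto
  \<comment> \<open>Recovers strand and parameter from a passage, so that \<open>K\<close> and
    \<open>rk\<close> can be indexed by passages.\<close>
  define jj where "jj z = (THE jx. fst jx < n \<and> snd jx \<in> X (fst jx) \<and> z = pt (fst jx) (snd jx))" for z
  have jj: "jj (pt j x) = (j, x)" if "j < n" "x \<in> X j" for j x
    unfolding jj_def using that pt_eq_iff Xc by (intro the_equality) fastforce+
  define E where "E z y = form (K (fst (jj z)) (snd (jj z))) y" for z y
  have E: "E (pt j x) y = form (K j x) y" if "j < n" "x \<in> X j" for j x y
    by (simp add: E_def jj that)
  have pvX: "pv j x \<in> {-1..1}" if "j < n" "x \<in> insert (sgn (r j)) (X j)" for j x
    using pv[OF that] Xc[OF that(1)] sgn_in by fastforce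
  have prevN: "prev N (pt j x) = pt j (pv j x)" if j: "j < n" and x: "x \<in> insert (sgn (r j)) (X j)" for j x
  proof (rule prev_pt[OF finN j])
    note p = pv[OF j x]
    show "x \<in> {-1..1}" using x Xc[OF j] sgn_in by auto
    then have xle: "r j * x \<le> \<bar>r j\<bar>" using snd_pt_mono(2)[OF j, of x] by (simp add: pt_def final_eq)
    show "pv j x \<in> {-1..1}" by (rule pvX[OF j x])
    then have pge: "- \<bar>r j\<bar> \<le> r j * pv j x" using snd_pt_mono(1)[OF j, of "pv j x"] by (simp add: pt_def start_eq)
    show "r j * pv j x < r j * x" using p by simp
    show "pt j (pv j x) \<in> N"
      using p ends[OF j] j by (auto simp: N_def B_def start_def)
    fix y assume y: "y \<in> {-1..1}" "r j * pv j x < r j * y" "r j * y < r j * x"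
    have "y \<noteq> sgn (r j)" "y \<noteq> - sgn (r j)"
      using y(2,3) xle pge by (auto simp: abs_sgn)
    then have "y \<in> {-1<..<1}" using y(1) r_nonzero[OF j] by (auto simp: sgn_if split: if_splits)
    then have "pt j y \<notin> C" using C innerI[OF j] by auto
    moreover have "pt j y \<notin> B"
    proof
      assume "pt j y \<in> B"
      then obtain l z where l: "l < n" "z \<in> X l" "pt j y = pt l z" by (auto simp: B_def)
      then have "y \<in> X j" using pt_eq_iff[OF j l(1) y(1) Xc[OF l(1,2)]] by simp
      then show False using p y by auto
    qed
    ultimately show "pt j y \<notin> N" by (simp add: N_def)
  qed
  \<comment> \<open>Substitutes for the arc coming into \<open>x\<close>. If it starts inside, the
    sum over \<open>B\<close> replaces it by its form; otherwise it is the column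
    \<open>start j\<close>, whose form is a unit vector.\<close>
  have Esum: "(\<Sum>z\<in>B. (if z = pt j (pv j x) then a else 0) * E z y) + (if y = pt j (pv j x) then a else 0) =
      a * form (K j (pv j x)) y" if j: "j < n" and x: "x \<in> insert (sgn (r j)) (X j)" and y: "y \<in> C" for j x y a
  proof (cases "pv j x \<in> X j")
    have S: "(\<Sum>z\<in>B. (if z = p then a else 0) * E z y) = (if p \<in> B then a * E p y else 0)" for p
    proof -
      have "(\<Sum>z\<in>B. (if z = p then a else 0) * E z y) = (\<Sum>z\<in>B. if z = p then a * E z y else 0)"
        by (rule sum.cong) auto
      then show ?thesis using finB by simp
    qed
    case True
    then have "pt j (pv j x) \<in> B" using j by (auto simp: B_def)
    moreover from this have "y \<noteq> pt j (pv j x)" using y BC by auto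
    ultimately show ?thesis unfolding S using E[OF j True, of y] by simp
  next
    have S: "(\<Sum>z\<in>B. (if z = p then a else 0) * E z y) = 0" if "p \<notin> B" for p
      by (rule sum.neutral) (use that in auto)
    case False
    then have e: "pt j (pv j x) = start j" "pv j x = - sgn (r j)" using pv[OF j x] by (auto simp: start_def)
    then have "pt j (pv j x) \<notin> B" using ends[OF j] BC by auto
    moreover have "form (K j (pv j x)) y = (if y = start j then 1 else 0)"
    proof -
      have "K j (pv j x) = (\<lambda>l. if l = j then 1 else 0)"
        unfolding e(2) K_start[OF j] by (rule ext) (simp add: entry_def)
      then show ?thesis using form_unit[OF j] by (simp only:)
    qed
    ultimately show ?thesis using S[of "pt j (pv j x)"] unfolding e(1) by simp
  qed
  \<comment> \<open>After the substitution the relation of an inside passage reads as the recursion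
    for \<open>K\<close>, so the row agrees with the form of its own outgoing arc.\<close>
  have relB: "(\<Sum>z\<in>B. rel (Out \<union> In) w N (pt j x) z * E z y) + rel (Out \<union> In) w N (pt j x) y = form (K j x) y"
    if j: "j < n" and x: "x \<in> X j" and y: "y \<in> C" for j x y
  proof -
    have jx: "x \<in> insert (sgn (r j)) (X j)" using x by simp
    have "pt j x \<in> fst ` In \<union> snd ` In" by (rule X_In[OF j x])
    then consider q where "(pt j x, q) \<in> In" | p where "(p, pt j x) \<in> In" by force
    then show ?thesis
    proof cases
      case 1
      from In[OF this] obtain b y' where b: "b < n" "y' \<in> X b" "q = pt b y'" by auto
      have "rel (Out \<union> In) w N (pt j x) z = (if z = pt j (pv j x) then fst (w (pt j x, q)) else 0)" for z
        using rel_over[OF mt, of "pt j x" q w N z] 1 prevN[OF j jx] by simp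
      moreover have "K j x = (\<lambda>l. fst (w (pt j x, q)) * K j (pv j x) l)"
        using K_over[OF j b(1) x b(2)] 1 b(3) by (intro ext) simp
      ultimately show ?thesis
        using Esum[OF j jx y, of "fst (w (pt j x, q))"] form_scale[of "fst (w (pt j x, q))" "K j (pv j x)" y]
        by simp
    next
      case 2
      from In[OF this] obtain a x' where a: "a < n" "x' \<in> X a" "p = pt a x'" by auto
      then have ax: "x' \<in> insert (sgn (r a)) (X a)" by simp
      let ?be = "fst (snd (w (p, pt j x)))" and ?ga = "snd (snd (w (p, pt j x)))"
      have "rel (Out \<union> In) w N (pt j x) z = (if z = pt j (pv j x) then ?be else 0) + (if z = pt a (pv a x') then ?ga else 0)" for z
        using rel_under[OF mt, of p "pt j x" w N z] 2 prevN[OF j jx] prevN[OF a(1) ax] a(3) by simp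
      then have "(\<Sum>z\<in>B. rel (Out \<union> In) w N (pt j x) z * E z y) + rel (Out \<union> In) w N (pt j x) y =
         ?be * form (K j (pv j x)) y + ?ga * form (K a (pv a x')) y"
        using Esum[OF j jx y, of ?be] Esum[OF a(1) ax y, of ?ga]
        by (simp only: distrib_right sum.distrib) (simp add: algebra_simps)
      also have "\<dots> = form (\<lambda>l. ?be * K j (pv j x) l + ?ga * K a (pv a x') l) y"
        by (simp add: form_add form_scale)
      also have "(\<lambda>l. ?be * K j (pv j x) l + ?ga * K a (pv a x') l) = K j x"
        using K_under[OF a(1) j a(2) x] 2 a(3) by (intro ext) simp
      finally show ?thesis .
    qed
  qed
  \<comment> \<open>Separates the identity matrix: in an inside row it contributes the form of the
    arc itself, which cancels against \<open>relB\<close>.\<close>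
  have minus: "(\<Sum>z\<in>B. ?M x z * E z y) + ?M x y =
      ((\<Sum>z\<in>B. rel (Out \<union> In) w N x z * E z y) + rel (Out \<union> In) w N x y) -
      (if x \<in> B then E x y else 0) - (if x = y then 1 else 0)" for x y
  proof -
    have "(\<Sum>z\<in>B. ?M x z * E z y) = (\<Sum>z\<in>B. rel (Out \<union> In) w N x z * E z y) - (\<Sum>z\<in>B. if x = z then E z y else 0)"
      unfolding sum_subtractf[symmetric] by (rule sum.cong) (auto simp: relmat_def algebra_simps)
    then show ?thesis using finB by (simp add: relmat_def)
  qed
  \<comment> \<open>A nonzero entry points to an incoming arc on the same strand, or to that of the
    over-strand; both have smaller rank except in the kink case.\<close>
  have relBB: "rk j' x' < rk j x \<or> (j', x') = (j, x) \<and> ?M (pt j x) (pt j x) \<in> monomial_units"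
    if j: "j < n" and x: "x \<in> X j" and j': "j' < n" and x': "x' \<in> X j'"
      and nz: "rel (Out \<union> In) w N (pt j x) (pt j' x') \<noteq> 0" for j x j' x'
  proof -
    have jx: "x \<in> insert (sgn (r j)) (X j)" using x by simp
    have own: "rk j' x' < rk j x" if "pt j' x' = pt j (pv j x)"
    proof -
      have "j' = j" "x' = pv j x" using that pt_eq_iff[OF j' j Xc[OF j' x'] pvX[OF j jx]] by auto
      then show ?thesis using rk[OF j x] x' by simp
    qed
    have nown: "pt j (pv j x) \<noteq> pt j x" using pv[OF j jx] by (auto simp: pt_def)
    have "pt j x \<in> fst ` In \<union> snd ` In" by (rule X_In[OF j x])
    then consider q where "(pt j x, q) \<in> In" | p where "(p, pt j x) \<in> In" by force
    then show ?thesis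
    proof cases
      case 1
      then have "rel (Out \<union> In) w N (pt j x) (pt j' x') = (if pt j' x' = pt j (pv j x) then fst (w (pt j x, q)) else 0)"
        using rel_over[OF mt, of "pt j x" q w N] prevN[OF j jx] by simp
      then show ?thesis using nz own by (auto split: if_splits)
    next
      case 2
      from In[OF this] obtain a y where a: "a < n" "y \<in> X a" "p = pt a y" by auto
      then have ax: "y \<in> insert (sgn (r a)) (X a)" by simp
      let ?be = "fst (snd (w (p, pt j x)))" and ?ga = "snd (snd (w (p, pt j x)))"
      have R: "rel (Out \<union> In) w N (pt j x) z = (if z = pt j (pv j x) then ?be else 0) + (if z = pt a (pv a y) then ?ga else 0)" for z
        using rel_under[OF mt, of p "pt j x" w N z] 2 prevN[OF j jx] prevN[OF a(1) ax] a(3) by simp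
      show ?thesis
      proof (cases "pt j' x' = pt j (pv j x)")
        case True
        then show ?thesis using own by simp
      next
        case False
        then have "pt j' x' = pt a (pv a y)" using nz R[of "pt j' x'"] by (auto split: if_splits)
        then have e: "j' = a" "x' = pv a y" using pt_eq_iff[OF j' a(1) Xc[OF j' x'] pvX[OF a(1) ax]] by auto
        have "rk a (pv a y) < rk j x \<or> a = j \<and> pv a y = x \<and> ?ga - 1 \<in> monomial_units"
          using rk_cross[OF a(1) j a(2) x] 2 a(3) x' e by simp
        then show ?thesis
        proof
          assume "a = j \<and> pv a y = x \<and> ?ga - 1 \<in> monomial_units"
          moreover from this have "?M (pt j x) (pt j x) = ?ga - 1"
            using R[of "pt j x"] nown by (auto simp: relmat_def)
          ultimately show ?thesis using e by auto
        qed (use e in simp)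
      qed
    qed
  qed
  have diagU: "?M b b \<in> monomial_units" if b: "b \<in> B" for b
  proof -
    obtain j x where jx: "j < n" "x \<in> X j" "b = pt j x" using b by (auto simp: B_def)
    show ?thesis
    proof (cases "rel (Out \<union> In) w N b b = 0")
      case True
      then show ?thesis using monomial_units_one by (simp add: relmat_def)
    next
      case False
      then show ?thesis using relBB[OF jx(1,2,1,2)] jx(3) by simp
    qed
  qed
  define R where "R z = rk (fst (jj z)) (snd (jj z))" for z
  have "sdet (B \<union> C) ?M = (\<Prod>b\<in>B. ?M b b) * sdet C (\<lambda>x y. (\<Sum>z\<in>B. ?M x z * E z y) + ?M x y)"
  proof (rule sdet_eliminate[OF finB finC BC, where rk = R])
    fix b y assume b: "b \<in> B" and y: "y \<in> C"
    then obtain j x where jx: "j < n" "x \<in> X j" "b = pt j x" by (auto simp: B_def)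
    have "b \<noteq> y" using b y BC by auto
    then show "(\<Sum>z\<in>B. ?M b z * E z y) + ?M b y = 0"
      unfolding minus using relB[OF jx(1,2) y] b jx E[OF jx(1,2), of y] by simp
  next
    fix b b' assume b: "b \<in> B" "b' \<in> B" "b' \<noteq> b" "R b \<le> R b'"
    then obtain j x j' x' where jx: "j < n" "x \<in> X j" "b = pt j x" "j' < n" "x' \<in> X j'" "b' = pt j' x'"
      by (auto simp: B_def)
    then have "R b = rk j x" "R b' = rk j' x'" by (simp_all add: R_def jj)
    then show "?M b b' = 0"
      using relBB[OF jx(1,2,4,5)] b jx by (auto simp: relmat_def)
  qed
  also have "sdet C (\<lambda>x y. (\<Sum>z\<in>B. ?M x z * E z y) + ?M x y) = sdet C (reduced Out w C ?L)"
  proof (rule sdet_cong[OF finC])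
    fix x y assume x: "x \<in> C" and y: "y \<in> C"
    have xB: "x \<notin> B" using x BC by auto
    have "(\<Sum>z\<in>B. rel (Out \<union> In) w N x z * E z y) + rel (Out \<union> In) w N x y =
       (if \<exists>j<n. x = final j then form (?L (THE j. j < n \<and> x = final j)) y else rel Out w C x y)"
    proof (cases "\<exists>j<n. x = final j")
      case True
      then obtain j where j: "j < n" "x = final j" by auto
      have the: "(THE j. j < n \<and> x = final j) = j"
        by (rule the_equality) (use j final_inj in auto)
      have "x \<notin> fst ` (Out \<union> In)" "x \<notin> snd ` (Out \<union> In)"
      proof -
        have "p \<in> B \<and> q \<in> B" if "(p, q) \<in> In" for p q using In[OF that] by (auto simp: B_def)
        then have "x \<notin> fst ` In" "x \<notin> snd ` In" using xB by force+
        moreover have "x \<notin> fst ` Out" "x \<notin> snd ` Out" using Out j by auto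
        ultimately show "x \<notin> fst ` (Out \<union> In)" "x \<notin> snd ` (Out \<union> In)" by auto
      qed
      then have "rel (Out \<union> In) w N x z = (if z = pt j (pv j (sgn (r j))) then 1 else 0)" for z
        using prevN[OF j(1), of "sgn (r j)"] j(2) by (simp add: rel_idle final_def)
      then show ?thesis using Esum[OF j(1) _ y, of "sgn (r j)" 1] True the by simp
    next
      case False
      \<comment> \<open>An outside row keeps its incoming arcs, also the one of the over-strand in
        the row of an under-passage: neither of the points is some \<open>final j\<close>.\<close>
      have pC: "prev N p = prev C p" "prev C p \<in> C" if "p \<in> C" "\<And>j. j < n \<Longrightarrow> p \<noteq> final j" for p
        unfolding N_def using prev_outer[OF _ Bi C ends that] finN N_def prev_props(1)[OF finC, of p "snd p"] that(1) by auto
      have InB: "p \<in> B \<and> q \<in> B" if "(p, q) \<in> In" for p q using In[OF that] by (auto simp: B_def)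
      have mtO: "matching Out" using mt unfolding matching_def inj_on_Un image_Un by blast
      have z0: "z \<in> B \<Longrightarrow> z \<noteq> prev C p" if "p \<in> C" "\<And>j. j < n \<Longrightarrow> p \<noteq> final j" for z p
        using pC(2)[OF that] BC by auto
      have px: "prev N x = prev C x" "\<And>z. z \<in> B \<Longrightarrow> z \<noteq> prev C x" using pC z0 x False by blast+
      consider q where "(x, q) \<in> Out" | p where "(p, x) \<in> Out" | "x \<notin> fst ` (Out \<union> In)" "x \<notin> snd ` (Out \<union> In)"
      proof -
        have nIn: "x \<notin> fst ` In" "x \<notin> snd ` In" using InB xB by force+
        show ?thesis
        proof (cases "x \<in> fst ` Out \<or> x \<in> snd ` Out")
          case True
          then show ?thesis using that(1,2) by auto
        next
          case False
          then show ?thesis using that(3) nIn by (auto simp: image_Un)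
        qed
      qed
      then have "(\<forall>z\<in>B. rel (Out \<union> In) w N x z = 0) \<and> rel (Out \<union> In) w N x y = rel Out w C x y"
      proof cases
        case 1
        then show ?thesis using px rel_over[OF mt, of x q w N] rel_over[OF mtO, of x q w C] by auto
      next
        case 2
        then have p: "p \<in> C" "\<And>j. j < n \<Longrightarrow> p \<noteq> final j" using Out by force+
        show ?thesis using px z0[OF p] pC[OF p] rel_under[OF mt, of p x w N] rel_under[OF mtO, of p x w C] 2 by auto
      next
        case 3
        then have "x \<notin> fst ` Out" "x \<notin> snd ` Out" by auto
        then show ?thesis using 3 px by (simp add: rel_idle)
      qed
      then show ?thesis by (simp only: if_not_P[OF False]) simp
    qed
    then show "(\<Sum>z\<in>B. ?M x z * E z y) + ?M x y = reduced Out w C ?L x y"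
      unfolding minus reduced_def using xB by simp
  qed
  finally have "gdet (Out \<union> In) w N = (\<Prod>b\<in>B. ?M b b) * sdet C (reduced Out w C ?L)"
    by (simp add: gdet_def N_def Un_commute)
  moreover have "(\<Prod>b\<in>B'. ?M b b) \<in> monomial_units" if "finite B'" "B' \<subseteq> B" for B'
    using that by (induction B') (use diagU monomial_units_one monomial_units_mult in auto)
  ultimately show ?thesis using finB by (auto simp: N_def B_def)
qed

end

context strands
begin

text \<open>Passages and elimination order differ on the two sides of a move; only \<open>L\<close>
  has to be compared, so the rest is hidden.\<close>

definition has_transfer where
  "has_transfer In w L \<longleftrightarrow> (\<exists>X pv K rk. transfer n c m r X pv K rk In w L)"

lemma r_sgn_pos: "j < n \<Longrightarrow> 0 < r j * sgn (r j)"
  using r_nonzero[of j] by (auto simp: abs_sgn[symmetric])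

lemma reduced_cong:
  assumes "\<And>j. j < n \<Longrightarrow> L j = L' j"
  shows "reduced Cr w C L = reduced Cr w C L'"
proof -
  have "(\<exists>j<n. x = final j) \<Longrightarrow> (THE j. j < n \<and> x = final j) < n" for x
  proof -
    assume "\<exists>j<n. x = final j"
    then obtain j where j: "j < n" "x = final j" by auto
    have "(THE j. j < n \<and> x = final j) = j"
      by (rule the_equality) (use j final_inj in auto)
    then show ?thesis using j by simp
  qed
  then show ?thesis unfolding reduced_def by (intro ext) (auto simp: assms)
qed

lemma gdet_transfer:
  assumes finC: "finite C" and C: "C \<inter> inner = {}"
    and ends: "\<And>j. j < n \<Longrightarrow> start j \<in> C \<and> final j \<in> C"
    and mt: "matching (Out \<union> In)"
    and Out: "fst ` Out \<union> snd ` Out \<subseteq> C - (start ` {..<n} \<union> final ` {..<n})"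
    and tr: "has_transfer In w L"
  shows "\<exists>u\<in>monomial_units. gdet (Out \<union> In) w (C \<union> (fst ` In \<union> snd ` In)) = u * sdet C (reduced Out w C L)"
proof -
  from tr[unfolded has_transfer_def] obtain X pv K rk where td: "transfer n c m r X pv K rk In w L"
    by auto
  interpret transfer n c m r X pv K rk In w L by (rule td)
  have "\<exists>u\<in>monomial_units. gdet (Out \<union> In) w (C \<union> (\<Union>j<n. pt j ` X j)) =
    u * sdet C (reduced Out w C (\<lambda>j. K j (pv j (sgn (r j)))))"
    by (rule tangle_reduce[OF finC C ends mt Out])
  moreover have "(\<Union>j<n. pt j ` X j) = fst ` In \<union> snd ` In"
  proof
    show "(\<Union>j<n. pt j ` X j) \<subseteq> fst ` In \<union> snd ` In" using X_In by blast
    have "p \<in> (\<Union>j<n. pt j ` X j) \<and> q \<in> (\<Union>j<n. pt j ` X j)" if "(p, q) \<in> In" for p q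
      using In[OF that] by auto
    then show "fst ` In \<union> snd ` In \<subseteq> (\<Union>j<n. pt j ` X j)" by auto
  qed
  ultimately show ?thesis using reduced_cong[of L "\<lambda>j. K j (pv j (sgn (r j)))"] L by simp
qed

lemma sgn_bounds: "j < n \<Longrightarrow> x \<in> {-1<..<1} \<Longrightarrow> r j * (- sgn (r j)) < r j * x \<and> r j * x < r j * sgn (r j)"
  using snd_pt_strict[of j x] by (simp add: pt_def start_def final_def)

section \<open>Transfers of the small tangles\<close>

lemma has_transfer_empty: "has_transfer {} w entry"
proof -
  have "transfer n c m r (\<lambda>_. {}) (\<lambda>j x. - sgn (r j)) (\<lambda>j x. entry j) (\<lambda>_ _. 0) {} w entry"
    by unfold_locales (use r_sgn_pos in auto)
  then show ?thesis unfolding has_transfer_def by blast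
qed

text \<open>Serves the mixed move, where one classical crossing remains. Apart from its weight, the
  position of the crossing does not enter the result.\<close>

lemma has_transfer_single:
  assumes ab: "a < n" "b < n" "a \<noteq> b" and x: "x \<in> {-1<..<1}" "y \<in> {-1<..<1}"
  shows "has_transfer {(pt a x, pt b y)} w
    (\<lambda>j. if j = a then (\<lambda>l. fst (w (pt a x, pt b y)) * entry a l)
      else if j = b then (\<lambda>l. fst (snd (w (pt a x, pt b y))) * entry b l + snd (snd (w (pt a x, pt b y))) * entry a l)
      else entry j)"
proof -
  let ?X = "\<lambda>j. if j = a then {x} else if j = b then {y} else {}"
  let ?pv = "\<lambda>j z. if j = a \<and> z = sgn (r a) then x else if j = b \<and> z = sgn (r b) then y else - sgn (r j)"
  let ?A = "\<lambda>l. fst (w (pt a x, pt b y)) * entry a l"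
  let ?B = "\<lambda>l. fst (snd (w (pt a x, pt b y))) * entry b l + snd (snd (w (pt a x, pt b y))) * entry a l"
  let ?K = "\<lambda>j z. if j = a \<and> z = x then ?A else if j = b \<and> z = y then ?B else entry j"
  have s: "x \<noteq> sgn (r a)" "x \<noteq> - sgn (r a)" "y \<noteq> sgn (r b)" "y \<noteq> - sgn (r b)"
    using sgn_notin[OF ab(1)] sgn_notin[OF ab(2)] x by auto
  have s': "sgn (r j) \<noteq> - sgn (r j)" if "j < n" for j using r_nonzero[OF that] by (simp add: sgn_if)
  note rs = r_sgn_pos
  note bd = sgn_bounds[OF ab(1) x(1)] sgn_bounds[OF ab(2) x(2)]
  let ?In = "{(pt a x, pt b y)}"
  let ?L = "\<lambda>j. if j = a then ?A else if j = b then ?B else entry j"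
  have i: "a' = a \<and> b' = b" if "a' < n" "b' < n" "x' \<in> ?X a'" "y' \<in> ?X b'" "(pt a' x', pt b' y') \<in> ?In" for a' b' x' y'
  proof -
    have I: "x' \<in> {-1..1}" "y' \<in> {-1..1}" "x \<in> {-1..1}" "y \<in> {-1..1}"
      using that(3,4) x by (auto split: if_splits)
    then show ?thesis
      using that(5) pt_eq_iff[OF that(1) ab(1) I(1,3)] pt_eq_iff[OF that(2) ab(2) I(2,4)] by simp
  qed
  have "transfer n c m r ?X ?pv ?K (\<lambda>_ _. 0) ?In w ?L"
  proof
    fix j assume j: "j < n"
    show "finite (?X j) \<and> ?X j \<subseteq> {-1<..<1}" using x by auto
    show "?K j (- sgn (r j)) = entry j" using s by auto
    show "?L j = ?K j (?pv j (sgn (r j)))" using s by auto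
    fix z
    { assume "z \<in> ?X j"
      then show "pt j z \<in> fst ` ?In \<union> snd ` ?In" by (auto split: if_splits) }
    { assume z: "z \<in> insert (sgn (r j)) (?X j)"
      show "?pv j z \<in> insert (- sgn (r j)) (?X j) \<and> r j * ?pv j z < r j * z \<and>
        (\<forall>y\<in>?X j. \<not> (r j * ?pv j z < r j * y \<and> r j * y < r j * z))"
      proof (cases "z = sgn (r j)")
          case True
          then show ?thesis using ab s bd rs[OF j] by auto
        next
          case False
          then have "z \<in> ?X j" using z by simp
          then have "j = a \<and> z = x \<or> j = b \<and> z = y" by (simp split: if_splits)
          then show ?thesis using ab s bd by auto
        qed }
    assume "z \<in> ?X j" "?pv j z \<in> ?X j"
    then show "(0::nat) < 0" using s s'[OF j] by (auto split: if_splits)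
  next
    fix p q assume "(p, q) \<in> ?In"
    then show "\<exists>a<n. \<exists>b<n. \<exists>x\<in>?X a. \<exists>y\<in>?X b. p = pt a x \<and> q = pt b y"
      using ab by (intro exI[of _ a], simp) (intro exI[of _ b], simp)
  next
    fix a' b' x' y' l
    assume H: "a' < n" "b' < n" "x' \<in> ?X a'" "y' \<in> ?X b'" "(pt a' x', pt b' y') \<in> ?In"
    have e: "a' = a" "b' = b" "x' = x" "y' = y" using i[OF H] H(3,4) ab(3) by auto
    show "?K a' x' l = fst (w (pt a' x', pt b' y')) * ?K a' (?pv a' x') l"
      unfolding e using ab s by auto
    show "?K b' y' l = fst (snd (w (pt a' x', pt b' y'))) * ?K b' (?pv b' y') l +
        snd (snd (w (pt a' x', pt b' y'))) * ?K a' (?pv a' x') l"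
      unfolding e using ab s by auto
    assume "?pv a' x' \<in> ?X a'"
    then show "0 < (0::nat) \<or> a' = b' \<and> ?pv a' x' = y' \<and> snd (snd (w (pt a' x', pt b' y'))) - 1 \<in> monomial_units"
      unfolding e using ab s by auto
  qed
  then show ?thesis unfolding has_transfer_def by blast
qed

text \<open>
  Every strand has exactly two passages, the first at \<open>f j\<close> and the second at \<open>g j\<close>; \<open>A j\<close> and \<open>B j\<close>
  describe the arcs leaving them, and \<open>h\<close> orders the strands by height from the top.
\<close>

lemma has_transfer_two:
  fixes f g :: "nat \<Rightarrow> real" and A B :: "nat \<Rightarrow> nat \<Rightarrow> laurent" and h :: "nat \<Rightarrow> nat"
  defines "pre \<equiv> \<lambda>j x. if x = f j then entry j else A j"
    and "post \<equiv> \<lambda>j x. if x = f j then A j else B j"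
  assumes fg: "\<And>j. j < n \<Longrightarrow> f j \<in> {-1<..<1} \<and> g j \<in> {-1<..<1} \<and> r j * f j < r j * g j"
    and In: "\<And>p q. (p, q) \<in> In \<Longrightarrow> \<exists>a<n. \<exists>b<n. \<exists>x\<in>{f a, g a}. \<exists>y\<in>{f b, g b}. p = pt a x \<and> q = pt b y"
    and cover: "\<And>j. j < n \<Longrightarrow> pt j (f j) \<in> fst ` In \<union> snd ` In \<and> pt j (g j) \<in> fst ` In \<union> snd ` In"
    and K: "\<And>a b x y l. a < n \<Longrightarrow> b < n \<Longrightarrow> x \<in> {f a, g a} \<Longrightarrow> y \<in> {f b, g b} \<Longrightarrow> (pt a x, pt b y) \<in> In \<Longrightarrow>
        post a x l = fst (w (pt a x, pt b y)) * pre a x l \<and>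
        post b y l = fst (snd (w (pt a x, pt b y))) * pre b y l + snd (snd (w (pt a x, pt b y))) * pre a x l"
    and h: "\<And>a b x y. a < n \<Longrightarrow> b < n \<Longrightarrow> x \<in> {f a, g a} \<Longrightarrow> y \<in> {f b, g b} \<Longrightarrow> (pt a x, pt b y) \<in> In \<Longrightarrow>
        h a < h b \<or> a = b \<and> x = f a \<or>
        a = b \<and> x = g a \<and> y = f a \<and> snd (snd (w (pt a x, pt b y))) - 1 \<in> monomial_units"
  shows "has_transfer In w B"
proof -
  let ?X = "\<lambda>j. {f j, g j}"
  let ?pv = "\<lambda>j z. if z = sgn (r j) then g j else if z = g j then f j else - sgn (r j)"
  let ?K = "\<lambda>j z. if z = f j then A j else if z = g j then B j else entry j"
  \<comment> \<open>Higher strands are eliminated before lower ones, and on one strand the first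
    passage before the second.\<close>
  let ?rk = "\<lambda>j z. 2 * h j + (if z = g j then 1 else 0)"
  have d: "f j \<noteq> g j" "f j \<noteq> sgn (r j)" "f j \<noteq> - sgn (r j)" "g j \<noteq> sgn (r j)" "g j \<noteq> - sgn (r j)"
    if "j < n" for j
    using fg[OF that] sgn_notin[OF that] by auto
  have bd: "r j * (- sgn (r j)) < r j * f j" "r j * f j < r j * g j" "r j * g j < r j * sgn (r j)" if "j < n" for j
    using sgn_bounds[OF that, of "f j"] sgn_bounds[OF that, of "g j"] fg[OF that] by auto
  have Kpre: "?K j (?pv j x) = pre j x" "?K j x = post j x" if "j < n" "x \<in> ?X j" for j x
    using that d[OF that(1)] by (auto simp: pre_def post_def)
  have "transfer n c m r ?X ?pv ?K ?rk In w B"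
  proof
    fix j assume j: "j < n"
    show "finite (?X j) \<and> ?X j \<subseteq> {-1<..<1}" using fg[OF j] by auto
    show "?K j (- sgn (r j)) = entry j" using d[OF j] by auto
    show "B j = ?K j (?pv j (sgn (r j)))" using d[OF j] by auto
    fix x
    { assume x: "x \<in> ?X j"
      show "pt j x \<in> fst ` In \<union> snd ` In" using cover[OF j] x by auto
      show "?rk j (?pv j x) < ?rk j x" if "?pv j x \<in> ?X j" using that x d[OF j] by (auto split: if_splits) }
    assume x: "x \<in> insert (sgn (r j)) (?X j)"
    show "?pv j x \<in> insert (- sgn (r j)) (?X j) \<and> r j * ?pv j x < r j * x \<and>
        (\<forall>y\<in>?X j. \<not> (r j * ?pv j x < r j * y \<and> r j * y < r j * x))"
      using x d[OF j] bd[OF j] by auto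
  next
    fix p q assume "(p, q) \<in> In"
    then show "\<exists>a<n. \<exists>b<n. \<exists>x\<in>?X a. \<exists>y\<in>?X b. p = pt a x \<and> q = pt b y" by (rule In)
  next
    fix a b x y l assume ab: "a < n" "b < n" and x: "x \<in> ?X a" and y: "y \<in> ?X b" and i: "(pt a x, pt b y) \<in> In"
    show "?K a x l = fst (w (pt a x, pt b y)) * ?K a (?pv a x) l"
      using K[OF ab x y i] Kpre[OF ab(1) x] by simp
    show "?K b y l = fst (snd (w (pt a x, pt b y))) * ?K b (?pv b y) l + snd (snd (w (pt a x, pt b y))) * ?K a (?pv a x) l"
      using K[OF ab x y i] Kpre[OF ab(1) x] Kpre[OF ab(2) y] by simp
  next
    fix a b x y assume ab: "a < n" "b < n" and x: "x \<in> ?X a" and y: "y \<in> ?X b" and i: "(pt a x, pt b y) \<in> In"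
      and p: "?pv a x \<in> ?X a"
    have xg: "x = g a" "x \<noteq> f a" "?pv a x = f a" using p x d[OF ab(1)] by (auto split: if_splits)
    show "?rk a (?pv a x) < ?rk b y \<or> a = b \<and> ?pv a x = y \<and> snd (snd (w (pt a x, pt b y))) - 1 \<in> monomial_units"
      unfolding xg(3) using h[OF ab x y i] xg(2) d[OF ab(1)] by auto
  qed
  then show ?thesis unfolding has_transfer_def by blast
qed

end

lemma weight_even: "weight True v e = (vpow S e, vpow T e, 1 - vpow S e * vpow T e)"
  by (simp add: weight_def)

lemma weight_over_cancel: "fst (weight ev v e) * fst (weight ev v (- e)) = 1"
  by (simp add: weight_def vpow_mult)

lemma weight_under_cancel: "fst (snd (weight ev v e)) * fst (snd (weight ev v (- e))) = 1"
  by (simp add: weight_def vpow_mult)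

text \<open>The total coefficients with which the over-strand of a bigon enters the under-strand,
  for parallel and for antiparallel strands.\<close>

lemma mixed_cancel:
  fixes a a' b b' :: "'r::comm_ring_1"
  assumes "a * a' = 1" "b * b' = 1"
  shows "b' * (1 - a * b) + (1 - a' * b') * a = 0" "b * (1 - a' * b') * a + (1 - a * b) = 0"
proof -
  have c: "a * (a' * z) = z" "b * (b' * z) = z" for z
    using assms by (simp_all add: mult.assoc[symmetric])
  show "b' * (1 - a * b) + (1 - a' * b') * a = 0" "b * (1 - a' * b') * a + (1 - a * b) = 0"
    by (simp_all add: algebra_simps assms c)
qed

lemma weight_mixed_cancel:
  "fst (snd (weight ev v (- e))) * snd (snd (weight ev v e)) + snd (snd (weight ev v (- e))) * fst (weight ev v e) = 0"
  "fst (snd (weight ev v e)) * snd (snd (weight ev v (- e))) * fst (weight ev v e) + snd (snd (weight ev v e)) = 0"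
  using mixed_cancel[of "vpow S e" "vpow S (- e)" "vpow T e" "vpow T (- e)"]
  by (auto simp: weight_def vpow_mult)

text \<open>The arcs \<open>z\<close> and \<open>z'\<close> enter the over- and the under-strand of
  a bigon. In the second identity the under-strand first meets the crossing that the over-strand
  meets last; in the third both strands run in the same direction.\<close>

lemma opposite_crossings_cancel:
  fixes al al' be be' ga ga' :: "'r::comm_ring_1"
  assumes "al * al' = 1" "be * be' = 1" "be' * ga + ga' * al = 0" "be * ga' * al + ga = 0"
  shows "al' * (al * z) = z"
    and "be * (be' * z' + ga' * (al * z)) + ga * z = z'"
    and "be' * (be * z' + ga * z) + ga' * (al * z) = z'"
proof -
  have "al' * (al * z) = (al * al') * z" by (simp add: algebra_simps)
  then show "al' * (al * z) = z" using assms by simp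
  have "be * (be' * z' + ga' * (al * z)) + ga * z = (be * be') * z' + (be * ga' * al + ga) * z"
    by (simp add: algebra_simps)
  then show "be * (be' * z' + ga' * (al * z)) + ga * z = z'" using assms by simp
  have "be' * (be * z' + ga * z) + ga' * (al * z) = (be * be') * z' + (be' * ga + ga' * al) * z"
    by (simp add: algebra_simps)
  then show "be' * (be * z' + ga * z) + ga' * (al * z) = z'" using assms by simp
qed

context strands
begin

lemma has_transfer_R1:
  assumes n: "n = 1" and fg: "f \<in> {-1<..<1}" "g \<in> {-1<..<1}" "r 0 * f < r 0 * g"
    and xy: "(x, y) = (f, g) \<or> (x, y) = (g, f)"
    and w: "w (pt 0 x, pt 0 y) = weight True v e"
  shows "has_transfer {(pt 0 x, pt 0 y)} w entry"
proof -
  have d: "f \<noteq> g" using fg by auto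
  have pts: "pt 0 u = pt 0 z \<longleftrightarrow> u = z" for u z using r_nonzero[of 0] n by (simp add: pt_def)
  \<comment> \<open>The arc between the two passages. Entered at the over-passage it is
    \<open>s^e\<close> times the entering arc; otherwise it solves
    \<open>A = t^e x + (1 - s^e t^e) A\<close>, that is, \<open>A = s^-e x\<close>.\<close>
  define A where "A = (\<lambda>j l. (if x = f then vpow S e else vpow S (- e)) * entry j l)"
  show ?thesis
  proof (rule has_transfer_two[where f = "\<lambda>_. f" and g = "\<lambda>_. g" and A = A and h = "\<lambda>_. 0"])
    fix a b x' y' l
    assume ab: "a < n" "b < n" "x' \<in> {f, g}" "y' \<in> {f, g}" and i: "(pt a x', pt b y') \<in> {(pt 0 x, pt 0 y)}"
    have e: "a = 0" "b = 0" "x' = x" "y' = y" using ab(1,2) i n pts by auto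
    show "(if x' = f then A a else entry a) l = fst (w (pt a x', pt b y')) * (if x' = f then entry a else A a) l \<and>
       (if y' = f then A b else entry b) l =
       fst (snd (w (pt a x', pt b y'))) * (if y' = f then entry b else A b) l +
       snd (snd (w (pt a x', pt b y'))) * (if x' = f then entry a else A a) l"
    proof -
      have c: "vpow S e * (z * vpow S (- e)) = z" "vpow S e * (vpow T e * (z * vpow S (- e))) = vpow T e * z" for z
        using arg_cong[OF vpow_mult[of S e "- e"], of "\<lambda>u. u * z"]
          arg_cong[OF vpow_mult[of S e "- e"], of "\<lambda>u. u * (vpow T e * z)"]
        by (simp_all add: algebra_simps)
      show ?thesis
        using xy d unfolding e w by (auto simp: A_def weight_even algebra_simps c)
    qed
  next
    fix a b x' y'
    assume ab: "a < n" "b < n" "x' \<in> {f, g}" "y' \<in> {f, g}" and i: "(pt a x', pt b y') \<in> {(pt 0 x, pt 0 y)}"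
    have e: "a = 0" "b = 0" "x' = x" "y' = y" using ab(1,2) i n pts by auto
    \<comment> \<open>The pivot \<open>(1 - s^e t^e) - 1\<close> of a kink entered at its
      under-passage.\<close>
    have "(- 1) * vpow S e * vpow T e \<in> monomial_units" by (rule monomial_unitsI) simp
    then have "snd (snd (w (pt 0 x, pt 0 y))) - 1 \<in> monomial_units"
      unfolding w by (simp add: weight_even)
    then show "(0::nat) < 0 \<or> a = b \<and> x' = f \<or>
        a = b \<and> x' = g \<and> y' = f \<and> snd (snd (w (pt a x', pt b y'))) - 1 \<in> monomial_units"
      using xy unfolding e by auto
  qed (use n fg xy in auto)
qed

text \<open>The over-strand \<open>p\<close> meets the crossing at
  \<open>s = - sgn (r p) / 2\<close> first. The under-strand does so too iff both strands run in the
  same direction, which is the case distinction in the proof.\<close>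

lemma has_transfer_R2:
  assumes n: "n = 2" and ou: "(p, q) = (0, 1) \<or> (p, q) = (1, 0)" and s: "s \<in> {1 / 2, - 1 / 2}"
    and sr: "s = - sgn (r p) / 2"
    and w: "w (pt p s, pt q s) = weight ev v e" "w (pt p (- s), pt q (- s)) = weight ev v (- e)"
  shows "has_transfer {(pt p s, pt q s), (pt p (- s), pt q (- s))} w entry"
proof -
  let ?In = "{(pt p s, pt q s), (pt p (- s), pt q (- s))}"
  let ?f = "\<lambda>j. - sgn (r j) / 2" and ?g = "\<lambda>j. sgn (r j) / 2"
  \<comment> \<open>The arcs along the two sides of the bigon. In the antiparallel case the
    under-strand first picks up the over-strand's middle arc.\<close>
  define A where "A = (\<lambda>j l. if j = p then fst (weight ev v e) * entry p l
     else if sgn (r q) = sgn (r p) then fst (snd (weight ev v e)) * entry q l + snd (snd (weight ev v e)) * entry p l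
     else fst (snd (weight ev v (- e))) * entry q l + snd (snd (weight ev v (- e))) * (fst (weight ev v e) * entry p l))"
  have pq: "p < n" "q < n" "p \<noteq> q" using ou n by auto
  have r0: "r p \<noteq> 0" "r q \<noteq> 0" using r_nonzero pq by auto
  have sI: "s \<in> {-1..1}" "- s \<in> {-1..1}" "s \<noteq> - s" using s by auto
  have fgI: "sgn (r j) / 2 \<in> {-1..1}" "- sgn (r j) / 2 \<in> {-1..1}" for j by (auto simp: sgn_if)
  have sq: "s = ?f q \<and> - s = ?g q \<and> sgn (r q) = sgn (r p) \<or> s = ?g q \<and> - s = ?f q \<and> sgn (r q) \<noteq> sgn (r p)"
    using sr r0 by (auto simp: sgn_if)
  have sp: "s = ?f p" "- s = ?g p" using sr by auto
  have inv: "a = p \<and> b = q \<and> (x = s \<and> y = s \<or> x = - s \<and> y = - s)"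
    if "a < n" "b < n" "x \<in> {?f a, ?g a}" "y \<in> {?f b, ?g b}" "(pt a x, pt b y) \<in> ?In" for a b x y
  proof -
    have I: "x \<in> {-1..1}" "y \<in> {-1..1}" using that(3,4) fgI by blast+
    then show ?thesis
      using that(5) pt_eq_iff[OF that(1) pq(1) I(1) sI(1)] pt_eq_iff[OF that(1) pq(1) I(1) sI(2)]
        pt_eq_iff[OF that(2) pq(2) I(2) sI(1)] pt_eq_iff[OF that(2) pq(2) I(2) sI(2)] by auto
  qed
  have ends: "fst ` ?In \<union> snd ` ?In = {pt p s, pt p (- s), pt q s, pt q (- s)}" by auto
  have fp: "pt p (?f p) = pt p s" "pt p (?g p) = pt p (- s)"
    by (rule arg_cong[OF sp(1)[symmetric]], rule arg_cong[OF sp(2)[symmetric]])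
  have fq: "pt q (?f q) \<in> {pt q s, pt q (- s)}" "pt q (?g q) \<in> {pt q s, pt q (- s)}"
    using sq by (metis insertI1 insertI2)+
  show ?thesis
  proof (rule has_transfer_two[where f = ?f and g = ?g and A = A and h = "\<lambda>j. if j = p then 0 else 1"])
    fix j assume "j < n"
    then show "?f j \<in> {-1<..<1} \<and> ?g j \<in> {-1<..<1} \<and> r j * ?f j < r j * ?g j"
      using r_nonzero[of j] by (auto simp: sgn_if)
    have "j = p \<or> j = q" using \<open>j < n\<close> n ou by auto
    then show "pt j (?f j) \<in> fst ` ?In \<union> snd ` ?In \<and> pt j (?g j) \<in> fst ` ?In \<union> snd ` ?In"
      unfolding ends using fp fq by blast
  next
    fix p' q' assume "(p', q') \<in> ?In"
    then have "p' = pt p s \<and> q' = pt q s \<or> p' = pt p (- s) \<and> q' = pt q (- s)" by auto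
    then have "(p' = pt p (?f p) \<or> p' = pt p (?g p)) \<and> (q' = pt q (?f q) \<or> q' = pt q (?g q))"
      using sp sq by metis
    then show "\<exists>a<n. \<exists>b<n. \<exists>x\<in>{?f a, ?g a}. \<exists>y\<in>{?f b, ?g b}. p' = pt a x \<and> q' = pt b y"
      using pq(1,2) by blast
  next
    fix a b x y l assume ab: "a < n" "b < n" "x \<in> {?f a, ?g a}" "y \<in> {?f b, ?g b}" "(pt a x, pt b y) \<in> ?In"
    from inv[OF this] have e: "a = p" "b = q" "x = s \<and> y = s \<or> x = - s \<and> y = - s" by auto
    note E = opposite_crossings_cancel[OF weight_over_cancel[of ev v e] weight_under_cancel[of ev v e]
      weight_mixed_cancel(1)[of ev v e] weight_mixed_cancel(2)[of ev v e]]
    have ps: "(s = ?f p) = True" "(- s = ?f p) = False" using sr sI(3) by auto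
    have qs: "(s = ?f q) = (sgn (r q) = sgn (r p))" "(- s = ?f q) = (sgn (r q) \<noteq> sgn (r p))"
      using sr r0 by (auto simp: sgn_if)
    show "(if x = ?f a then A a else entry a) l = fst (w (pt a x, pt b y)) * (if x = ?f a then entry a else A a) l \<and>
       (if y = ?f b then A b else entry b) l =
       fst (snd (w (pt a x, pt b y))) * (if y = ?f b then entry b else A b) l +
       snd (snd (w (pt a x, pt b y))) * (if x = ?f a then entry a else A a) l"
      using e(3)
    proof
      assume xy: "x = s \<and> y = s"
      show ?thesis
        using pq(3) unfolding e(1,2) xy[THEN conjunct1] xy[THEN conjunct2] ps qs w
        by (simp add: A_def E)
    next
      assume xy: "x = - s \<and> y = - s"
      show ?thesis
        using pq(3) unfolding e(1,2) xy[THEN conjunct1] xy[THEN conjunct2] ps qs w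
        by (simp add: A_def E)
    qed
  next
    fix a b x y assume ab: "a < n" "b < n" "x \<in> {?f a, ?g a}" "y \<in> {?f b, ?g b}" "(pt a x, pt b y) \<in> ?In"
    show "(if a = p then 0 else 1) < (if b = p then 0 else (1::nat)) \<or> a = b \<and> x = ?f a \<or>
        a = b \<and> x = ?g a \<and> y = ?f a \<and> snd (snd (w (pt a x, pt b y))) - 1 \<in> monomial_units"
      using inv[OF ab] pq by auto
  qed
qed

end

text \<open>
  The combinations leaving the top, middle and bottom strand of a triangle, in terms of \<open>x1, x2, x3\<close>
  entering them.  The weights belong to the crossings top-middle, top-bottom and middle-bottom; \<open>p\<close>
  says that the top strand meets the middle one first, \<open>q\<close> that the middle strand meets the top one
  first, and \<open>s\<close> that the bottom strand meets the top one first.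
\<close>

definition triangle_out ::
  "bool \<Rightarrow> bool \<Rightarrow> bool \<Rightarrow> 'r \<times> 'r \<times> 'r \<Rightarrow> 'r \<times> 'r \<times> 'r \<Rightarrow> 'r \<times> 'r \<times> 'r \<Rightarrow>
   'r \<Rightarrow> 'r \<Rightarrow> 'r \<Rightarrow> 'r::comm_ring_1 \<times> 'r \<times> 'r" where
  "triangle_out p q s w1 w2 w3 x1 x2 x3 =
     (let tm = (if p then x1 else fst w2 * x1);
          tb = (if p then fst w1 * x1 else x1);
          M = (\<lambda>v. fst (snd w1) * v + snd (snd w1) * tm);
          mb = (if q then M x2 else x2);
          T = (\<lambda>v. fst (snd w2) * v + snd (snd w2) * tb);
          B = (\<lambda>v. fst (snd w3) * v + snd (snd w3) * mb)
      in (if p then fst w2 * tb else fst w1 * tm,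
          if q then fst w3 * mb else M (fst w3 * x2),
          if s then B (T x3) else T (B x3)))"

text \<open>The three signs are not independent: reversing a strand changes the signs of its two
  crossings and one of \<open>p\<close>, \<open>q\<close>, \<open>s\<close>, so one bit
  \<open>k\<close> together with these orders determines all signs. Negating \<open>p\<close>,
  \<open>q\<close>, \<open>s\<close> together keeps the signs.\<close>

lemma triangle_out_even:
  fixes a1 a2 b1 b2 :: "'r::comm_ring_1"
  assumes "a1 * a2 = 1" "b1 * b2 = 1"
  defines "w \<equiv> \<lambda>e. if e then (a1, b1, 1 - a1 * b1) else (a2, b2, 1 - a2 * b2)"
  shows "triangle_out p q s (w (k = (p = q))) (w (k = (p = s))) (w (k = (q = s))) x1 x2 x3 =
    triangle_out (\<not> p) (\<not> q) (\<not> s) (w (k = (p = q))) (w (k = (p = s))) (w (k = (q = s))) x1 x2 x3"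
proof -
  have c: "a1 * (a2 * z) = z" "b1 * (b2 * z) = z" for z
    using assms by (simp_all add: mult.assoc[symmetric])
  show ?thesis
    unfolding w_def
    by (cases p; cases q; cases s; cases k)
      (simp_all add: triangle_out_def Let_def algebra_simps assms(1,2) c)
qed

text \<open>Without mixed terms each strand is only multiplied by scalars, whose order is
  irrelevant.\<close>

lemma triangle_out_odd:
  "triangle_out p q s (a1, a2, 0) (b1, b2, 0) (c1, c2, 0) x1 x2 x3 =
    triangle_out (\<not> p) (\<not> q) (\<not> s) (a1, a2, 0) (b1, b2, 0) (c1, c2, 0) x1 x2 x3"
  by (cases p; cases q; cases s) (simp_all add: triangle_out_def Let_def algebra_simps)

text \<open>The strand missing the even crossing multiplies the other two by powers of one unit
  \<open>c1\<close>; the dependence of the signs on \<open>k\<close> makes these factors match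
  across the mixed term.\<close>

lemma triangle_out_one_even:
  fixes a1 a2 b1 b2 c1 c2 :: "'r::comm_ring_1"
  assumes "c1 * c2 = 1"
  defines "w \<equiv> \<lambda>e. if e then (a1, b1, 1 - a1 * b1) else (a2, b2, 1 - a2 * b2)"
    and "u \<equiv> \<lambda>e. if e then (c1, c2, 0) else (c2, c1, 0)"
  shows "triangle_out p q s (w (k = (p = q))) (u (k = (p = s))) (u (k = (q = s))) x1 x2 x3 =
    triangle_out (\<not> p) (\<not> q) (\<not> s) (w (k = (p = q))) (u (k = (p = s))) (u (k = (q = s))) x1 x2 x3"
    and "triangle_out p q s (u (k = (p = q))) (w (k = (p = s))) (u (k = (q = s))) x1 x2 x3 =
    triangle_out (\<not> p) (\<not> q) (\<not> s) (u (k = (p = q))) (w (k = (p = s))) (u (k = (q = s))) x1 x2 x3"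
    and "triangle_out p q s (u (k = (p = q))) (u (k = (p = s))) (w (k = (q = s))) x1 x2 x3 =
    triangle_out (\<not> p) (\<not> q) (\<not> s) (u (k = (p = q))) (u (k = (p = s))) (w (k = (q = s))) x1 x2 x3"
proof -
  have c: "c1 * (c2 * z) = z" for z
    using assms by (simp add: mult.assoc[symmetric])
  show "triangle_out p q s (w (k = (p = q))) (u (k = (p = s))) (u (k = (q = s))) x1 x2 x3 =
    triangle_out (\<not> p) (\<not> q) (\<not> s) (w (k = (p = q))) (u (k = (p = s))) (u (k = (q = s))) x1 x2 x3"
    unfolding w_def u_def
    by (cases p; cases q; cases s; cases k)
      (simp_all add: triangle_out_def Let_def algebra_simps assms(1) c)
  show "triangle_out p q s (u (k = (p = q))) (w (k = (p = s))) (u (k = (q = s))) x1 x2 x3 =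
    triangle_out (\<not> p) (\<not> q) (\<not> s) (u (k = (p = q))) (w (k = (p = s))) (u (k = (q = s))) x1 x2 x3"
    unfolding w_def u_def
    by (cases p; cases q; cases s; cases k)
      (simp_all add: triangle_out_def Let_def algebra_simps assms(1) c)
  show "triangle_out p q s (u (k = (p = q))) (u (k = (p = s))) (w (k = (q = s))) x1 x2 x3 =
    triangle_out (\<not> p) (\<not> q) (\<not> s) (u (k = (p = q))) (u (k = (p = s))) (w (k = (q = s))) x1 x2 x3"
    unfolding w_def u_def
    by (cases p; cases q; cases s; cases k)
      (simp_all add: triangle_out_def Let_def algebra_simps assms(1) c)
qed

text \<open>Across the move each strand meets its two crossings in the opposite order, while types,
  variables and signs persist. The listed types are those that occur in a diagram.\<close>

lemma triangle_out_flip: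
  assumes types: "e1 \<and> e2 \<and> e3 \<or> \<not> e1 \<and> \<not> e2 \<and> \<not> e3 \<or> e1 \<and> \<not> e2 \<and> \<not> e3 \<and> v2 = v3 \<or>
      \<not> e1 \<and> e2 \<and> \<not> e3 \<and> v1 = v3 \<or> \<not> e1 \<and> \<not> e2 \<and> e3 \<and> v1 = v2"
    and signs: "d1 = (if k = (p = q) then 1 else - 1)" "d2 = (if k = (p = s) then 1 else - 1)"
      "d3 = (if k = (q = s) then 1 else - 1)"
  shows "triangle_out p q s (weight e1 v1 d1) (weight e2 v2 d2) (weight e3 v3 d3) x1 x2 x3 =
    triangle_out (\<not> p) (\<not> q) (\<not> s) (weight e1 v1 d1) (weight e2 v2 d2) (weight e3 v3 d3) x1 x2 x3"
proof -
  have E: "weight True v (if e then 1 else - 1) =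
      (if e then (vpow S 1, vpow T 1, 1 - vpow S 1 * vpow T 1)
       else (vpow S (- 1), vpow T (- 1), 1 - vpow S (- 1) * vpow T (- 1)))" for v e
    by (simp add: weight_def)
  have O: "weight False v (if e then 1 else - 1) =
      (if e then (vpow v 1, vpow v (- 1), 0) else (vpow v (- 1), vpow v 1, 0))" for v e
    by (simp add: weight_def)
  have O': "weight False v e = (vpow v e, vpow v (- e), 0)" for v e
    by (simp add: weight_def)
  from types show ?thesis
  proof (elim disjE conjE)
    assume e: "e1" "e2" "e3"
    show ?thesis
      using triangle_out_even[OF vpow_inverse(1)[of S] vpow_inverse(1)[of T], of p q s k]
      by (simp only: e signs E)
  next
    assume e: "\<not> e1" "\<not> e2" "\<not> e3"
    then have e': "e1 = False" "e2 = False" "e3 = False" by auto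
    show ?thesis unfolding e' O' by (rule triangle_out_odd)
  next
    assume e: "e1" "\<not> e2" "\<not> e3" and v: "v2 = v3"
    then have e': "e1 = True" "e2 = False" "e3 = False" by auto
    show ?thesis
      using triangle_out_one_even(1)[OF vpow_inverse(1)[of v3], of p q s k "vpow S 1" "vpow T 1" "vpow S (- 1)" "vpow T (- 1)"]
      by (simp only: e' v signs E O)
  next
    assume e: "\<not> e1" "e2" "\<not> e3" and v: "v1 = v3"
    then have e': "e1 = False" "e2 = True" "e3 = False" by auto
    show ?thesis
      using triangle_out_one_even(2)[OF vpow_inverse(1)[of v3], of p q s k "vpow S 1" "vpow T 1" "vpow S (- 1)" "vpow T (- 1)"]
      by (simp only: e' v signs E O)
  next
    assume e: "\<not> e1" "\<not> e2" "e3" and v: "v1 = v2"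
    then have e': "e1 = False" "e2 = False" "e3 = True" by auto
    show ?thesis
      using triangle_out_one_even(3)[OF vpow_inverse(1)[of v2], of p q s k "vpow S 1" "vpow T 1" "vpow S (- 1)" "vpow T (- 1)"]
      by (simp only: e' v signs E O)
  qed
qed

context strands
begin

text \<open>As \<open>triangle_out\<close> is linear in the entering arcs, it can be applied to
  their \<open>l\<close>-th coordinates, one \<open>l\<close> at a time.\<close>

definition triangle_transfer where
  "triangle_transfer t m' b p q s w1 w2 w3 = (\<lambda>j l.
     let z = triangle_out p q s w1 w2 w3 (entry t l) (entry m' l) (entry b l)
     in if j = t then fst z else if j = m' then fst (snd z) else snd (snd z))"

lemma has_transfer_R3:
  assumes n: "n = 3" and tmb: "{t, m', b} = {0, 1, 2}"
    and P: "x1 \<in> {-1<..<1}" "x2 \<in> {-1<..<1}" "x3 \<in> {-1<..<1}" "x1 \<noteq> x2" "x1 \<noteq> x3" "x2 \<noteq> x3"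
    and w: "w (pt t x1, pt m' x1) = w1" "w (pt t x2, pt b x2) = w2" "w (pt m' x3, pt b x3) = w3"
  shows "has_transfer {(pt t x1, pt m' x1), (pt t x2, pt b x2), (pt m' x3, pt b x3)} w
    (triangle_transfer t m' b (r t * x1 < r t * x2) (r m' * x1 < r m' * x3) (r b * x2 < r b * x3) w1 w2 w3)"
proof -
  let ?In = "{(pt t x1, pt m' x1), (pt t x2, pt b x2), (pt m' x3, pt b x3)}"
  define p q s where "p = (r t * x1 < r t * x2)" and "q = (r m' * x1 < r m' * x3)" and "s = (r b * x2 < r b * x3)"
  have "card {t, m', b} = 3" unfolding tmb by simp
  then have d: "t \<noteq> m'" "t \<noteq> b" "m' \<noteq> b" by (auto simp: card_insert_if split: if_splits)
  have "t \<in> {0, 1, 2}" "m' \<in> {0, 1, 2}" "b \<in> {0, 1, 2}" using tmb by blast+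
  then have lt: "t < n" "m' < n" "b < n" unfolding n by auto
  have cases3: "j = t \<or> j = m' \<or> j = b" if "j < n" for j
  proof -
    have "j \<in> {0, 1, 2}" using that n by auto
    then show ?thesis using tmb by auto
  qed
  define f where "f j = (if j = t then (if p then x1 else x2) else if j = m' then (if q then x1 else x3) else (if s then x2 else x3))" for j
  define g where "g j = (if j = t then (if p then x2 else x1) else if j = m' then (if q then x3 else x1) else (if s then x3 else x2))" for j
  \<comment> \<open>Names as in \<open>triangle_out\<close>: \<open>tm\<close> and \<open>tb\<close>
    are the arcs of the top strand coming into its crossings with the middle and the bottom strand,
    \<open>mb\<close> that of the middle strand at the bottom one.\<close>
  define tm where "tm l = (if p then entry t l else fst w2 * entry t l)" for l
  define tb where "tb l = (if p then fst w1 * entry t l else entry t l)" for l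
  define M where "M l v = fst (snd w1) * v + snd (snd w1) * tm l" for l v
  define mb where "mb l = (if q then M l (entry m' l) else entry m' l)" for l
  define T' where "T' l v = fst (snd w2) * v + snd (snd w2) * tb l" for l v
  define B' where "B' l v = fst (snd w3) * v + snd (snd w3) * mb l" for l v
  define A where "A j l = (if j = t then (if p then fst w1 * entry t l else fst w2 * entry t l)
    else if j = m' then (if q then M l (entry m' l) else fst w3 * entry m' l)
    else (if s then T' l (entry b l) else B' l (entry b l)))" for j l
  define B where "B j l = (if j = t then (if p then fst w2 * tb l else fst w1 * tm l)
    else if j = m' then (if q then fst w3 * mb l else M l (fst w3 * entry m' l))
    else (if s then B' l (T' l (entry b l)) else T' l (B' l (entry b l))))" for j l
  have trB: "triangle_transfer t m' b p q s w1 w2 w3 = B"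
    by (intro ext) (simp add: triangle_transfer_def triangle_out_def Let_def B_def tm_def tb_def M_def mb_def T'_def B'_def)
  have I: "x1 \<in> {-1..1}" "x2 \<in> {-1..1}" "x3 \<in> {-1..1}" using P by auto
  have fgI: "f j \<in> {-1..1}" "g j \<in> {-1..1}" for j using I by (auto simp: f_def g_def)
  have inv: "(j = t \<and> j' = m' \<and> x = x1 \<and> y = x1) \<or> (j = t \<and> j' = b \<and> x = x2 \<and> y = x2) \<or> (j = m' \<and> j' = b \<and> x = x3 \<and> y = x3)"
    if H: "j < n" "j' < n" "x \<in> {f j, g j}" "y \<in> {f j', g j'}" "(pt j x, pt j' y) \<in> ?In" for j j' x y
  proof -
    have xy: "x \<in> {-1..1}" "y \<in> {-1..1}" using H(3,4) fgI by blast+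
    have "(pt j x = pt t x1 \<and> pt j' y = pt m' x1) \<or> (pt j x = pt t x2 \<and> pt j' y = pt b x2) \<or> (pt j x = pt m' x3 \<and> pt j' y = pt b x3)"
      using H(5) by blast
    then show ?thesis
      unfolding pt_eq_iff[OF H(1) lt(1) xy(1) I(1)] pt_eq_iff[OF H(2) lt(2) xy(2) I(1)]
        pt_eq_iff[OF H(1) lt(1) xy(1) I(2)] pt_eq_iff[OF H(2) lt(3) xy(2) I(2)]
        pt_eq_iff[OF H(1) lt(2) xy(1) I(3)] pt_eq_iff[OF H(2) lt(3) xy(2) I(3)] by blast
  qed
  have rr: "r j * x < r j * y \<or> r j * y < r j * x" if "j < n" "x \<noteq> y" for j x y
    using r_nonzero[OF that(1)] that(2) by (metis linorder_neqE_linordered_idom mult_left_cancel)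
  have ends: "fst ` ?In \<union> snd ` ?In = {pt t x1, pt t x2, pt m' x1, pt m' x3, pt b x2, pt b x3}" by auto
  have F: "f t = x1 \<longleftrightarrow> p" "f t = x2 \<longleftrightarrow> \<not> p" "f m' = x1 \<longleftrightarrow> q" "f m' = x3 \<longleftrightarrow> \<not> q" "f b = x2 \<longleftrightarrow> s" "f b = x3 \<longleftrightarrow> \<not> s"
    using P d by (auto simp: f_def)
  then have F': "x1 = f t \<longleftrightarrow> p" "x2 = f t \<longleftrightarrow> \<not> p" "x1 = f m' \<longleftrightarrow> q" "x3 = f m' \<longleftrightarrow> \<not> q" "x2 = f b \<longleftrightarrow> s" "x3 = f b \<longleftrightarrow> \<not> s"
    by auto
  have "has_transfer ?In w B"
  proof (rule has_transfer_two[where f = f and g = g and A = A and h = "\<lambda>j. if j = t then 0 else if j = m' then 1 else 2"])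
    fix j assume j: "j < n"
    from cases3[OF j] show "f j \<in> {-1<..<1} \<and> g j \<in> {-1<..<1} \<and> r j * f j < r j * g j"
      using P d rr[OF lt(1), of x1 x2] rr[OF lt(2), of x1 x3] rr[OF lt(3), of x2 x3]
      by (auto simp: f_def g_def p_def q_def s_def)
    from cases3[OF j] show "pt j (f j) \<in> fst ` ?In \<union> snd ` ?In \<and> pt j (g j) \<in> fst ` ?In \<union> snd ` ?In"
      unfolding ends by (elim disjE) (simp_all add: f_def g_def d d[symmetric])
  next
    have fgs: "{f t, g t} = {x1, x2}" "{f m', g m'} = {x1, x3}" "{f b, g b} = {x2, x3}"
      using d by (auto simp: f_def g_def)
    fix p' q' assume "(p', q') \<in> ?In"
    then consider "p' = pt t x1" "q' = pt m' x1" | "p' = pt t x2" "q' = pt b x2" | "p' = pt m' x3" "q' = pt b x3" by blast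
    then show "\<exists>a<n. \<exists>b<n. \<exists>x\<in>{f a, g a}. \<exists>y\<in>{f b, g b}. p' = pt a x \<and> q' = pt b y"
    proof cases
      case 1
      then show ?thesis using lt fgs by (intro exI[of _ t] conjI exI[of _ m']) auto
    next
      case 2
      then show ?thesis using lt fgs by (intro exI[of _ t] conjI exI[of _ b]) auto
    next
      case 3
      then show ?thesis using lt fgs by (intro exI[of _ m'] conjI exI[of _ b]) auto
    qed
  next
    fix j j' x y l assume H: "j < n" "j' < n" "x \<in> {f j, g j}" "y \<in> {f j', g j'}" "(pt j x, pt j' y) \<in> ?In"
    from inv[OF H] show "(if x = f j then A j else B j) l = fst (w (pt j x, pt j' y)) * (if x = f j then entry j else A j) l \<and>
       (if y = f j' then A j' else B j') l =
       fst (snd (w (pt j x, pt j' y))) * (if y = f j' then entry j' else A j') l +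
       snd (snd (w (pt j x, pt j' y))) * (if x = f j then entry j else A j) l"
    proof (elim disjE conjE)
      assume e: "j = t" "j' = m'" "x = x1" "y = x1"
      show ?thesis unfolding e w F' using d by (simp add: A_def B_def M_def tm_def tb_def)
    next
      assume e: "j = t" "j' = b" "x = x2" "y = x2"
      show ?thesis unfolding e w F' using d by (simp add: A_def B_def T'_def tm_def tb_def)
    next
      assume e: "j = m'" "j' = b" "x = x3" "y = x3"
      show ?thesis unfolding e w F' using d by (simp add: A_def B_def B'_def mb_def)
    qed
  next
    fix j j' x y assume H: "j < n" "j' < n" "x \<in> {f j, g j}" "y \<in> {f j', g j'}" "(pt j x, pt j' y) \<in> ?In"
    show "(if j = t then 0 else if j = m' then 1 else 2) < (if j' = t then 0 else if j' = m' then 1 else (2::nat)) \<or>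
        j = j' \<and> x = f j \<or> j = j' \<and> x = g j \<and> y = f j \<and> snd (snd (w (pt j x, pt j' y))) - 1 \<in> monomial_units"
      using inv[OF H] d by auto
  qed
  then show ?thesis unfolding trB[symmetric] p_def q_def s_def .
qed

end

section \<open>Tangles in diagrams\<close>

lemma crossing_weight_eq:
  "crossing_weight k D (p, q) = weight (fst p = fst q \<and> even_crossing k D (p, q))
     (if fst p = fst q then Z (fst p) else W {fst p, fst q}) (crossing_sign D (p, q))"
  by (auto simp: crossing_weight_def weight_def over_coeff_def under_coeff_def mixed_coeff_def
      self_crossing_def Let_def)

text \<open>Refers to the model tangle alone. Requiring distinct passages instead of distinct arcs
  admits the kink.\<close>

definition tangle_crossing ::
  "(real \<Rightarrow> complex) list \<Rightarrow> passage set \<Rightarrow> nat \<Rightarrow> real \<Rightarrow> nat \<Rightarrow> real \<Rightarrow> bool" where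
  "tangle_crossing as ov a x b y \<longleftrightarrow> a < length as \<and> b < length as \<and> x \<in> {-1..1} \<and> y \<in> {-1..1} \<and>
     (a, x) \<noteq> (b, y) \<and> (as ! a) x = (as ! b) y \<and> (a, x) \<in> ov"

text \<open>\<open>dv\<close> gives the tangents of the model arcs, for the signs. Crossings stay
  away from the ends of the strands, which are reserved for idle points.\<close>

locale tangle_diagram =
  fixes k :: nat and D :: vdiagram and as :: "(real \<Rightarrow> complex) list" and ov :: "passage set"
    and c :: "nat \<Rightarrow> nat" and m r :: "nat \<Rightarrow> real" and dv :: "nat \<Rightarrow> real \<Rightarrow> complex"
  assumes D: "is_diagram k D" and tin: "tangle_in k D (as, ov) c m r"
    and win: "j < length as \<Longrightarrow> x \<in> {-1..1} \<Longrightarrow> (as ! j) x \<in> window"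
    and deriv: "j < length as \<Longrightarrow> x \<in> {-1<..<1} \<Longrightarrow> ((as ! j) has_vector_derivative dv j x) (at x)"
    and interior: "tangle_crossing as ov a x b y \<Longrightarrow> x \<in> {-1<..<1} \<and> y \<in> {-1<..<1}"

sublocale tangle_diagram \<subseteq> strands "length as" c m r
  using tin by unfold_locales (auto simp: tangle_in_def)

context tangle_diagram
begin

lemma strand_tangle:
  assumes "j < length as" "x \<in> {-1..1}"
  shows "loc D (pt j x) = (as ! j) x" "pt j x \<in> over D \<longleftrightarrow> (j, x) \<in> ov"
  using tin assms unfolding tangle_in_def pt_def fst_conv snd_conv by blast+

lemma component: "j < length as \<Longrightarrow> c j \<in> {1..k}"
  using tin by (auto simp: tangle_in_def)

lemma pt_passage:
  assumes "j < length as" "x \<in> {-1..1}"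
  shows "pt j x \<in> passage_points k"
proof -
  have "0 < snd (pt j x)" "snd (pt j x) < 1"
    using snd_pt_mono[OF assms] lower[OF assms(1)] upper[OF assms(1)] by (auto simp: start_eq final_eq)
  then show ?thesis using component[OF assms(1)] by (auto simp: passage_points_def pt_def)
qed

definition region :: "passage set" where
  "region = (\<Union>j<length as. strand_points c m r j)"

lemma region_eq: "region = (\<Union>j<length as. pt j ` {-1..1})"
  by (simp add: region_def strand_points_def pt_def)

lemma regionE:
  assumes "p \<in> region"
  obtains j x where "j < length as" "x \<in> {-1..1}" "p = pt j x"
  using assms that unfolding region_eq by blast

lemma regionI: "j < length as \<Longrightarrow> x \<in> {-1..1} \<Longrightarrow> pt j x \<in> region"
  unfolding region_eq by blast

lemma window_region:
  assumes "p \<in> passage_points k"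
  shows "p \<in> region \<longleftrightarrow> loc D p \<in> window"
proof
  assume "p \<in> region"
  then obtain j x where jx: "j < length as" "x \<in> {-1..1}" "p = pt j x" by (rule regionE)
  then show "loc D p \<in> window" using strand_tangle(1)[OF jx(1,2)] win[OF jx(1,2)] by simp
next
  assume "loc D p \<in> window"
  then show "p \<in> region" using tin assms unfolding tangle_in_def region_def fst_conv by blast
qed

text \<open>The two passages lie at the same point of the plane, and the strands are exactly what
  lies over the window.\<close>

lemma crossing_region:
  assumes "(p, q) \<in> crossings k D"
  shows "p \<in> region \<longleftrightarrow> q \<in> region"
  using assms window_region[of p] window_region[of q] by (auto simp: crossings_def double_pairs_def)

lemma crossing_pt:
  assumes "a < length as" "b < length as" "x \<in> {-1..1}" "y \<in> {-1..1}"
  shows "(pt a x, pt b y) \<in> crossings k D \<longleftrightarrow> tangle_crossing as ov a x b y"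
  using assms strand_tangle[OF assms(1,3)] strand_tangle[OF assms(2,4)] pt_passage[OF assms(1,3)]
    pt_passage[OF assms(2,4)] pt_eq_iff[OF assms]
  by (auto simp: crossings_def double_pairs_def tangle_crossing_def)

definition inner_crossings where
  "inner_crossings = {(p, q). (p, q) \<in> crossings k D \<and> p \<in> region}"

definition outer_crossings where
  "outer_crossings = {(p, q). (p, q) \<in> crossings k D \<and> p \<notin> region}"

lemma crossings_split: "crossings k D = outer_crossings \<union> inner_crossings"
  by (auto simp: inner_crossings_def outer_crossings_def)

lemma inner_crossings_eq:
  "inner_crossings = {(pt a x, pt b y) | a x b y. tangle_crossing as ov a x b y}"
proof (rule Set.set_eqI)
  fix z
  show "z \<in> inner_crossings \<longleftrightarrow> z \<in> {(pt a x, pt b y) | a x b y. tangle_crossing as ov a x b y}"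
  proof
    assume z: "z \<in> inner_crossings"
    then obtain p q where pq: "z = (p, q)" "(p, q) \<in> crossings k D" "p \<in> region"
      by (auto simp: inner_crossings_def)
    then have "q \<in> region" using crossing_region by blast
    then obtain b y where b: "b < length as" "y \<in> {-1..1}" "q = pt b y" by (rule regionE)
    from pq(3) obtain a x where a: "a < length as" "x \<in> {-1..1}" "p = pt a x" by (rule regionE)
    have "tangle_crossing as ov a x b y" using crossing_pt[OF a(1) b(1) a(2) b(2)] pq a b by simp
    then show "z \<in> {(pt a x, pt b y) | a x b y. tangle_crossing as ov a x b y}" using pq a b by blast
  next
    assume "z \<in> {(pt a x, pt b y) | a x b y. tangle_crossing as ov a x b y}"
    then obtain a x b y where z: "z = (pt a x, pt b y)" and t: "tangle_crossing as ov a x b y" by blast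
    then have "a < length as" "b < length as" "x \<in> {-1..1}" "y \<in> {-1..1}" by (simp_all add: tangle_crossing_def)
    then show "z \<in> inner_crossings"
      unfolding z inner_crossings_def using crossing_pt t regionI by simp
  qed
qed

text \<open>Chain rule for the affine change from diagram to strand parameters; the factor
  \<open>1 / r j\<close> records the direction of travel.\<close>

lemma velocity_pt:
  assumes j: "j < length as" and x: "x \<in> {-1<..<1}"
  shows "velocity D (pt j x) = (1 / r j) *\<^sub>R dv j x"
proof -
  have r: "r j \<noteq> 0" by (rule r_nonzero[OF j])
  define h where "h t = (t - m j) / r j" for t
  define G where "G = h -` {-1<..<1}"
  have hx: "h (m j + r j * x) = x" using r by (simp add: h_def)
  have ht: "m j + r j * h t = t" for t using r by (simp add: h_def)
  have "continuous_on UNIV h" unfolding h_def by (intro continuous_intros) (use r in auto)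
  \<comment> \<open>The curve and the model arc agree only along the strand, so they are compared on
    an open parameter set.\<close>
  then have oG: "open G" unfolding G_def by (intro open_vimage) auto
  have "(h has_vector_derivative (1 / r j)) (at (m j + r j * x))"
    unfolding h_def using r by (auto intro!: derivative_eq_intros simp: has_real_derivative_iff_has_vector_derivative[symmetric])
  then have "(((as ! j) \<circ> h) has_vector_derivative (1 / r j) *\<^sub>R dv j x) (at (m j + r j * x))"
    by (rule vector_diff_chain_at) (use deriv[OF j x] hx in simp)
  then have "(curve D (c j) has_vector_derivative (1 / r j) *\<^sub>R dv j x) (at (m j + r j * x))"
  proof (rule has_vector_derivative_transform_within_open[OF _ oG])
    show "m j + r j * x \<in> G" using hx x by (simp add: G_def)
    fix t assume "t \<in> G"
    then have "h t \<in> {-1..1}" by (auto simp: G_def)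
    from strand_tangle(1)[OF j this] show "((as ! j) \<circ> h) t = curve D (c j) t"
      using ht[of t] by (simp add: loc_def pt_def)
  qed
  then show ?thesis by (simp add: velocity_def pt_def vector_derivative_at)
qed

text \<open>Reversing one strand reverses the sign. Multiplying by \<open>r a * r b\<close> has the
  same effect on the sign as dividing by it.\<close>

lemma sign_pt:
  assumes "a < length as" "b < length as" "x \<in> {-1<..<1}" "y \<in> {-1<..<1}"
  shows "crossing_sign D (pt a x, pt b y) =
    (if wedge (dv a x) (dv b y) * (r a * r b) > 0 then 1 else - 1)"
proof -
  have "wedge (velocity D (pt a x)) (velocity D (pt b y)) = wedge (dv a x) (dv b y) / (r a * r b)"
    using r_nonzero[OF assms(1)] r_nonzero[OF assms(2)]
    unfolding velocity_pt[OF assms(1,3)] velocity_pt[OF assms(2,4)] by (simp add: wedge_def field_simps)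
  then show ?thesis by (simp add: crossing_sign_def zero_less_divide_iff zero_less_mult_iff)
qed

section \<open>Numbering of self-passages along the strands\<close>

definition self_params :: "nat \<Rightarrow> real set" where
  "self_params j = {x. \<exists>l y. c l = c j \<and> (tangle_crossing as ov j x l y \<or> tangle_crossing as ov l y j x)}"

lemma self_params_interior: "x \<in> self_params j \<Longrightarrow> x \<in> {-1<..<1}"
  using interior by (auto simp: self_params_def simp del: greaterThanLessThan_iff)

lemma self_passage_pt:
  assumes j: "j < length as" and x: "x \<in> {-1..1}"
  shows "m j + r j * x \<in> self_passages k D (c j) \<longleftrightarrow> x \<in> self_params j"
proof
  assume "m j + r j * x \<in> self_passages k D (c j)"
  then obtain p q where pq: "(p, q) \<in> crossings k D" "fst p = fst q" "pt j x = p \<or> pt j x = q"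
    unfolding self_passages_def self_crossing_def pt_def by auto
  have "p \<in> region" "q \<in> region" using pq(3) crossing_region[OF pq(1)] regionI[OF j x] by auto
  then obtain a u b v where ab: "a < length as" "u \<in> {-1..1}" "p = pt a u" "b < length as" "v \<in> {-1..1}" "q = pt b v"
    by (meson regionE)
  have t: "tangle_crossing as ov a u b v" using pq(1) crossing_pt[OF ab(1,4,2,5)] ab by simp
  have cc: "c a = c b" using pq(2) ab by (simp add: pt_def)
  from pq(3) show "x \<in> self_params j"
  proof
    assume "pt j x = p"
    then have "a = j" "u = x" using pt_eq_iff[OF j ab(1) x ab(2)] ab(3) by auto
    then show ?thesis using t cc unfolding self_params_def by auto
  next
    assume "pt j x = q"
    then have "b = j" "v = x" using pt_eq_iff[OF j ab(4) x ab(5)] ab(6) by auto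
    then show ?thesis using t cc unfolding self_params_def by auto
  qed
next
  assume "x \<in> self_params j"
  then obtain l y where l: "c l = c j" "tangle_crossing as ov j x l y \<or> tangle_crossing as ov l y j x"
    by (auto simp: self_params_def)
  then have ly: "l < length as" "y \<in> {-1..1}" by (auto simp: tangle_crossing_def)
  have "(pt j x, pt l y) \<in> crossings k D \<or> (pt l y, pt j x) \<in> crossings k D"
    using l(2) crossing_pt[OF j ly(1) x ly(2)] crossing_pt[OF ly(1) j ly(2) x] by simp
  moreover have "fst (pt j x) = fst (pt l y)" "pt j x = (c j, m j + r j * x)" using l(1) by (simp_all add: pt_def)
  ultimately show "m j + r j * x \<in> self_passages k D (c j)"
    unfolding self_passages_def self_crossing_def mem_Collect_eq by (metis fst_conv snd_conv)
qed

text \<open>The number reached on entering the strand. Positions on it split into this global part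
  and \<open>local_index\<close>, which the model tangle and \<open>c\<close>, \<open>r\<close>
  determine.\<close>

definition base :: "nat \<Rightarrow> nat" where
  "base j = self_index k D (c j) (snd (start j))"

definition local_index :: "nat \<Rightarrow> real \<Rightarrow> nat" where
  "local_index j x = card {y \<in> self_params j. r j * y < r j * x}"

lemma inj_strand: "j < length as \<Longrightarrow> inj_on (\<lambda>y. m j + r j * y) A"
  using r_nonzero by (auto simp: inj_on_def)

lemma finite_self_params:
  assumes "j < length as"
  shows "finite (self_params j)"
proof (rule finite_imageD)
  show "finite ((\<lambda>y. m j + r j * y) ` self_params j)"
    by (rule finite_subset[OF _ finite_self_passages[OF D, of "c j"]])
      (use self_passage_pt[OF assms] self_params_interior in fastforce)
qed (rule inj_strand[OF assms])

lemma self_index_pt: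
  assumes j: "j < length as" and x: "x \<in> {-1..1}"
  shows "self_index k D (c j) (snd (pt j x)) = base j + local_index j x"
proof -
  let ?S = "self_passages k D (c j)"
  have eq: "{u \<in> ?S. u < snd (pt j x)} =
    {u \<in> ?S. u < snd (start j)} \<union> (\<lambda>y. m j + r j * y) ` {y \<in> self_params j. r j * y < r j * x}"
  proof (rule Set.set_eqI)
    fix u
    show "u \<in> {u \<in> ?S. u < snd (pt j x)} \<longleftrightarrow> u \<in> {u \<in> ?S. u < snd (start j)} \<union> (\<lambda>y. m j + r j * y) ` {y \<in> self_params j. r j * y < r j * x}"
    proof
      assume u: "u \<in> {u \<in> ?S. u < snd (pt j x)}"
      show "u \<in> {u \<in> ?S. u < snd (start j)} \<union> (\<lambda>y. m j + r j * y) ` {y \<in> self_params j. r j * y < r j * x}"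
      proof (cases "u < snd (start j)")
        case False
        then have "snd (start j) \<le> u" "u \<le> snd (final j)" using u snd_pt_mono[OF j x] by auto
        then obtain y where y: "y \<in> {-1..1}" "(c j, u) = pt j y" by (rule strand_coordinate[OF j])
        then have "u = m j + r j * y" by (simp add: pt_def)
        then show ?thesis using self_passage_pt[OF j y(1)] u by (auto simp: pt_def)
      qed (use u in auto)
    next
      assume "u \<in> {u \<in> ?S. u < snd (start j)} \<union> (\<lambda>y. m j + r j * y) ` {y \<in> self_params j. r j * y < r j * x}"
      then show "u \<in> {u \<in> ?S. u < snd (pt j x)}"
      proof
        assume "u \<in> {u \<in> ?S. u < snd (start j)}"
        then show ?thesis using snd_pt_mono(1)[OF j x] by auto
      next
        assume "u \<in> (\<lambda>y. m j + r j * y) ` {y \<in> self_params j. r j * y < r j * x}"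
        then obtain y where y: "y \<in> self_params j" "r j * y < r j * x" "u = m j + r j * y" by auto
        then have "y \<in> {-1..1}" using self_params_interior[OF y(1)] by auto
        then show ?thesis using self_passage_pt[OF j] y by (simp add: pt_def)
      qed
    qed
  qed
  have "card {u \<in> ?S. u < snd (pt j x)} = card {u \<in> ?S. u < snd (start j)} +
      card ((\<lambda>y. m j + r j * y) ` {y \<in> self_params j. r j * y < r j * x})"
    unfolding eq
  proof (rule card_Un_disjoint)
    show "finite {u \<in> ?S. u < snd (start j)}" using finite_self_passages[OF D] by simp
    show "finite ((\<lambda>y. m j + r j * y) ` {y \<in> self_params j. r j * y < r j * x})"
      using finite_self_params[OF j] by simp
    have "snd (start j) \<le> m j + r j * y" if "y \<in> self_params j" for y
      using snd_pt_strict(1)[OF j self_params_interior[OF that]] by (simp add: pt_def)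
    then show "{u \<in> ?S. u < snd (start j)} \<inter> (\<lambda>y. m j + r j * y) ` {y \<in> self_params j. r j * y < r j * x} = {}"
      by fastforce
  qed
  also have "card ((\<lambda>y. m j + r j * y) ` {y \<in> self_params j. r j * y < r j * x}) = local_index j x"
    unfolding local_index_def by (rule card_image[OF inj_strand[OF j]])
  finally show ?thesis by (simp add: self_index_def base_def)
qed

text \<open>Seen from a point not inside a strand, each strand has been passed entirely or not at
  all, so the tangle enters only through the number of self-passages per strand.\<close>

lemma self_index_outer:
  assumes t: "\<And>j. j < length as \<Longrightarrow> c j = i \<Longrightarrow> t \<le> snd (start j) \<or> snd (final j) \<le> t"
  shows "self_index k D i t = card {u \<in> self_passages k D i. (i, u) \<notin> region \<and> u < t} +
    (\<Sum>j | j < length as \<and> c j = i \<and> snd (final j) \<le> t. card (self_params j))"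
proof -
  let ?S = "self_passages k D i" and ?J = "{j. j < length as \<and> c j = i \<and> snd (final j) \<le> t}"
  let ?I = "\<lambda>j. (\<lambda>y. m j + r j * y) ` self_params j"
  have fJ: "finite ?J" by simp
  have sp: "y \<in> {-1..1}" if "y \<in> self_params j" for y j using self_params_interior[OF that] by auto
  have eq: "{u \<in> ?S. u < t} = {u \<in> ?S. (i, u) \<notin> region \<and> u < t} \<union> (\<Union>j\<in>?J. ?I j)"
  proof (rule Set.set_eqI)
    fix u
    show "u \<in> {u \<in> ?S. u < t} \<longleftrightarrow> u \<in> {u \<in> ?S. (i, u) \<notin> region \<and> u < t} \<union> (\<Union>j\<in>?J. ?I j)"
    proof
      assume u: "u \<in> {u \<in> ?S. u < t}"
      show "u \<in> {u \<in> ?S. (i, u) \<notin> region \<and> u < t} \<union> (\<Union>j\<in>?J. ?I j)"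
      proof (cases "(i, u) \<in> region")
        case True
        then obtain j y where j: "j < length as" "y \<in> {-1..1}" "(i, u) = pt j y" by (rule regionE)
        then have e: "c j = i" "u = m j + r j * y" by (simp_all add: pt_def)
        then have "y \<in> self_params j" using self_passage_pt[OF j(1,2)] u by auto
        moreover have "snd (start j) \<le> u" using snd_pt_mono(1)[OF j(1,2)] j(3) by (simp add: pt_def)
        then have "snd (final j) \<le> t" using t[OF j(1) e(1)] u by auto
        ultimately show ?thesis using j e by auto
      qed (use u in auto)
    next
      assume "u \<in> {u \<in> ?S. (i, u) \<notin> region \<and> u < t} \<union> (\<Union>j\<in>?J. ?I j)"
      then show "u \<in> {u \<in> ?S. u < t}"
      proof
        assume "u \<in> (\<Union>j\<in>?J. ?I j)"
        then obtain j y where j: "j < length as" "c j = i" "snd (final j) \<le> t" "y \<in> self_params j" "u = m j + r j * y"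
          by auto
        have "snd (pt j y) < snd (final j)" by (rule snd_pt_strict(2)[OF j(1) self_params_interior[OF j(4)]])
        then show ?thesis using self_passage_pt[OF j(1) sp[OF j(4)]] j by (simp add: pt_def)
      qed auto
    qed
  qed
  have "card {u \<in> ?S. u < t} = card {u \<in> ?S. (i, u) \<notin> region \<and> u < t} + card (\<Union>j\<in>?J. ?I j)"
    unfolding eq
  proof (rule card_Un_disjoint)
    show "finite {u \<in> ?S. (i, u) \<notin> region \<and> u < t}" using finite_self_passages[OF D] by simp
    show "finite (\<Union>j\<in>?J. ?I j)" using finite_self_params by auto
    have "(i, m j + r j * y) \<in> region" if "j < length as" "c j = i" "y \<in> self_params j" for j y
      using regionI[OF that(1) sp[OF that(3)]] that(2) by (simp add: pt_def)
    then show "{u \<in> ?S. (i, u) \<notin> region \<and> u < t} \<inter> (\<Union>j\<in>?J. ?I j) = {}" by fastforce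
  qed
  also have "card (\<Union>j\<in>?J. ?I j) = (\<Sum>j\<in>?J. card (?I j))"
  proof (rule card_UN_disjoint[OF fJ])
    show "\<forall>j\<in>?J. finite (?I j)" using finite_self_params by auto
    show "\<forall>j\<in>?J. \<forall>l\<in>?J. j \<noteq> l \<longrightarrow> ?I j \<inter> ?I l = {}"
    proof (intro ballI impI)
      fix j l assume jl: "j \<in> ?J" "l \<in> ?J" "j \<noteq> l"
      have "m j + r j * y \<noteq> m l + r l * z" if "y \<in> self_params j" "z \<in> self_params l" for y z
        using pt_eq_iff[of j l y z] jl sp[OF that(1)] sp[OF that(2)] by (auto simp: pt_def)
      then show "?I j \<inter> ?I l = {}" by auto
    qed
  qed
  also have "\<dots> = (\<Sum>j\<in>?J. card (self_params j))"
    by (rule sum.cong) (auto intro: card_image inj_strand)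
  finally show ?thesis by (simp add: self_index_def)
qed

text \<open>Of the global diagram only the components and the base numbers are left in the weight of
  a crossing inside.\<close>

lemma weight_pt:
  assumes t: "tangle_crossing as ov a x b y"
  shows "crossing_weight k D (pt a x, pt b y) =
    weight (c a = c b \<and> odd (base a + base b + local_index a x + local_index b y))
      (if c a = c b then Z (c a) else W {c a, c b})
      (if wedge (dv a x) (dv b y) * (r a * r b) > 0 then 1 else - 1)"
proof -
  have ab: "a < length as" "b < length as" "x \<in> {-1..1}" "y \<in> {-1..1}" using t by (simp_all add: tangle_crossing_def)
  have cr: "(pt a x, pt b y) \<in> crossings k D" using crossing_pt[OF ab] t by simp
  have f: "fst (pt a x) = c a" "fst (pt b y) = c b" by (simp_all add: pt_def)
  have "c a = c b \<and> even_crossing k D (pt a x, pt b y) \<longleftrightarrow>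
      c a = c b \<and> odd (base a + base b + local_index a x + local_index b y)"
  proof (cases "c a = c b")
    case True
    then show ?thesis
      using even_crossing_iff[OF D cr] self_index_pt[OF ab(1,3)] self_index_pt[OF ab(2,4)] f
      by (simp; blast)
  qed simp
  then show ?thesis
    unfolding crossing_weight_eq f using interior[OF t] sign_pt[OF ab(1,2)] by simp
qed

text \<open>The points \<open>(i, 0)\<close> ensure that every component carries a point; strands
  avoid parameter 0, so these points are the same on both sides of a move.\<close>

definition outer_arcs :: "passage set" where
  "outer_arcs = fst ` outer_crossings \<union> snd ` outer_crossings \<union> start ` {..<length as} \<union>
     final ` {..<length as} \<union> {1..k} \<times> {0}"

lemma outer_crossings_notin: "p \<in> fst ` outer_crossings \<union> snd ` outer_crossings \<Longrightarrow> p \<in> passage_points k - region"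
  using crossing_region crossing_points_subset[of k D]
  by (force simp: outer_crossings_def crossing_points_def)

lemma start_final_region: "j < length as \<Longrightarrow> start j \<in> region" "j < length as \<Longrightarrow> final j \<in> region"
  unfolding start_def final_def by (auto intro!: regionI sgn_in simp del: atLeastAtMost_iff)

lemma inner_region: "inner \<subseteq> region"
  unfolding inner_def region_eq by fastforce

lemma start_final_notin_inner:
  assumes "j < length as"
  shows "start j \<notin> inner" "final j \<notin> inner"
proof -
  have *: "pt j x \<notin> inner" if x: "x \<in> {-1..1}" "x \<notin> {-1<..<1}" for x
  proof
    assume "pt j x \<in> inner"
    then obtain l y where l: "l < length as" "y \<in> {-1<..<1}" "pt j x = pt l y" unfolding inner_def by blast
    then have "y \<in> {-1..1}" by auto
    then have "x = y" using pt_eq_iff[OF assms l(1) x(1)] l(3) by blast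
    then show False using l(2) x(2) by blast
  qed
  show "start j \<notin> inner" "final j \<notin> inner"
    unfolding start_def final_def by (rule *[OF sgn_in(2) sgn_notin(2)[OF assms]], rule *[OF sgn_in(1) sgn_notin(1)[OF assms]])
qed

lemma zero_notin_region: "(i, 0) \<notin> region"
proof
  assume "(i, 0) \<in> region"
  then obtain j x where j: "j < length as" "x \<in> {-1..1}" "(i, 0) = pt j x" by (rule regionE)
  have "snd (pt j x) = 0" unfolding j(3)[symmetric] by simp
  then show False using snd_pt_mono(1)[OF j(1,2)] lower[OF j(1)] by (simp add: start_eq)
qed

lemma alexander_transfer:
  assumes tr: "has_transfer inner_crossings (crossing_weight k D) L"
  shows "\<exists>u\<in>monomial_units. alexander k D (arcs k D) =
    u * sdet outer_arcs (reduced outer_crossings (crossing_weight k D) outer_arcs L)"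
proof -
  let ?In = "inner_crossings" and ?N = "outer_arcs \<union> (fst ` inner_crossings \<union> snd ` inner_crossings)"
  have finc: "finite (crossings k D)" by (rule matching_crossings(2)[OF D])
  have fino: "finite outer_crossings" "finite inner_crossings"
    using finc crossings_split by (metis finite_Un)+
  have finC: "finite outer_arcs" using fino by (simp add: outer_arcs_def)
  have "\<exists>u\<in>monomial_units. gdet (outer_crossings \<union> ?In) (crossing_weight k D) ?N =
     u * sdet outer_arcs (reduced outer_crossings (crossing_weight k D) outer_arcs L)"
  proof (rule gdet_transfer[OF finC _ _ _ _ tr])
    have "p \<notin> inner" if "p \<in> outer_arcs" for p
    proof -
      consider "p \<in> fst ` outer_crossings \<union> snd ` outer_crossings" | j where "j < length as" "p = start j \<or> p = final j" | i where "p = (i, 0)"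
        using \<open>p \<in> outer_arcs\<close> unfolding outer_arcs_def by blast
      then show ?thesis
      proof cases
        case 1
        then have "p \<notin> region" using outer_crossings_notin by blast
        then show ?thesis using inner_region by blast
      next
        case 2
        then show ?thesis using start_final_notin_inner by blast
      next
        case 3
        then show ?thesis using zero_notin_region inner_region by blast
      qed
    qed
    then show "outer_arcs \<inter> inner = {}" by blast
    show "matching (outer_crossings \<union> ?In)" using matching_crossings(1)[OF D] crossings_split by simp
    show "fst ` outer_crossings \<union> snd ` outer_crossings \<subseteq> outer_arcs - (start ` {..<length as} \<union> final ` {..<length as})"
    proof
      fix p assume p: "p \<in> fst ` outer_crossings \<union> snd ` outer_crossings"
      then have "p \<notin> region" using outer_crossings_notin by blast
      then have "p \<notin> start ` {..<length as} \<union> final ` {..<length as}" using start_final_region by auto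
      moreover have "p \<in> outer_arcs" using p by (auto simp: outer_arcs_def)
      ultimately show "p \<in> outer_arcs - (start ` {..<length as} \<union> final ` {..<length as})" by blast
    qed
  qed (auto simp: outer_arcs_def)
  then obtain u where u: "u \<in> monomial_units" "alexander k D ?N = u * sdet outer_arcs (reduced outer_crossings (crossing_weight k D) outer_arcs L)"
    unfolding alexander_def crossings_split[symmetric] by blast
  \<comment> \<open>Being admissible, the point set of the elimination differs from
    \<open>arcs\<close> at most in the sign of the determinant.\<close>
  have "arc_set k D ?N"
    unfolding arc_set_def
  proof (intro conjI ballI)
    show "finite ?N" using finC fino by simp
    show "crossing_points k D \<subseteq> ?N"
      by (subst crossing_points_def, subst crossings_split, subst crossings_split) (auto simp: outer_arcs_def)
    have "p \<in> passage_points k" if pN: "p \<in> ?N" for p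
    proof -
      consider "p \<in> fst ` outer_crossings \<union> snd ` outer_crossings" | j where "j < length as" "p = start j \<or> p = final j"
        | i where "i \<in> {1..k}" "p = (i, 0)" | "p \<in> crossing_points k D"
        using pN crossings_split unfolding outer_arcs_def crossing_points_def by blast
      then show ?thesis
      proof cases
        case 2
        then show ?thesis unfolding start_def final_def using pt_passage[OF _ sgn_in(1)] pt_passage[OF _ sgn_in(2)] by auto
      next
        case 3
        then show ?thesis by (simp add: passage_points_def)
      qed (use outer_crossings_notin crossing_points_subset in blast)+
    qed
    then show "?N \<subseteq> passage_points k" by blast
    fix i assume "i \<in> {1..k}"
    then show "\<exists>t. (i, t) \<in> ?N" by (auto simp: outer_arcs_def)
  qed
  from alexander_arc_set[OF D this arc_set_arcs[OF D]]
  have "\<exists>e\<in>{1, - 1}. alexander k D (arcs k D) = e * alexander k D ?N" by auto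
  then obtain e where e: "e \<in> {1, - 1}" "alexander k D (arcs k D) = e * alexander k D ?N" by blast
  then have "e \<in> monomial_units" using monomial_units_one by auto
  then have "e * u \<in> monomial_units" using u(1) by (rule monomial_units_mult)
  moreover have "alexander k D (arcs k D) = (e * u) * sdet outer_arcs (reduced outer_crossings (crossing_weight k D) outer_arcs L)"
    using e(2) u(2) by (simp add: mult.assoc)
  ultimately show ?thesis by blast
qed

end

section \<open>Comparing two diagrams that agree outside a disc\<close>

definition same_polynomial :: "nat \<Rightarrow> vdiagram \<Rightarrow> vdiagram \<Rightarrow> bool" where
  "same_polynomial k D D' \<longleftrightarrow>
     (\<exists>u\<in>monomial_units. alexander k D' (arcs k D') = u * alexander k D (arcs k D))"

lemma same_polynomial_refl: "same_polynomial k D D"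
  unfolding same_polynomial_def using monomial_units_one(1) by (intro bexI[of _ 1]) auto

lemma same_polynomial_sym:
  assumes "same_polynomial k D D'"
  shows "same_polynomial k D' D"
proof -
  obtain u where u: "u \<in> monomial_units" "alexander k D' (arcs k D') = u * alexander k D (arcs k D)"
    using assms by (auto simp: same_polynomial_def)
  obtain v where v: "v \<in> monomial_units" "v * u = 1" using monomial_units_inverse[OF u(1)] by blast
  have "alexander k D (arcs k D) = v * alexander k D' (arcs k D')"
    unfolding u(2) using v(2) by (simp add: mult.assoc[symmetric])
  then show ?thesis using v(1) by (auto simp: same_polynomial_def)
qed

lemma same_polynomial_trans:
  assumes "same_polynomial k D D'" "same_polynomial k D' D''"
  shows "same_polynomial k D D''"
  using assms monomial_units_mult unfolding same_polynomial_def by (metis mult.assoc)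

lemma rel_cong_weight:
  assumes mt: "matching Cr" and w: "\<And>z. z \<in> Cr \<Longrightarrow> w z = w' z"
  shows "rel Cr w N = rel Cr w' N"
proof (intro ext)
  fix x y
  consider q where "(x, q) \<in> Cr" | p where "(p, x) \<in> Cr" | "x \<notin> fst ` Cr" "x \<notin> snd ` Cr"
    by force
  then show "rel Cr w N x y = rel Cr w' N x y"
  proof cases
    case 1
    then show ?thesis using w[OF 1] by (simp add: rel_over[OF mt 1])
  next
    case 2
    then show ?thesis using w[OF 2] by (simp add: rel_under[OF mt 2])
  next
    case 3
    then show ?thesis by (simp add: rel_idle)
  qed
qed

lemma even_sum_cong:
  fixes f g :: "'a \<Rightarrow> nat"
  assumes "\<And>x. x \<in> A \<Longrightarrow> even (f x) = even (g x)"
  shows "even (sum f A) = even (sum g A)"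
  using assms by (induction A rule: infinite_finite_induct) auto

text \<open>The two sides of a move. \<open>self_parity\<close> is what keeps the parity of all
  crossings outside the disc.\<close>

locale tangle_pair =
  L: tangle_diagram k D as ov c m r dv + R: tangle_diagram k D' as' ov' c m r dv'
  for k D as ov c m r dv D' as' ov' dv' +
  assumes len: "length as' = length as"
    and agree: "p \<in> passage_points k \<Longrightarrow> p \<notin> L.region \<Longrightarrow>
      loc D p = loc D' p \<and> (p \<in> over D \<longleftrightarrow> p \<in> over D')"
    and self_parity: "j < length as \<Longrightarrow> even (card (L.self_params j)) = even (card (R.self_params j))"
begin

lemma region_eq: "R.region = L.region"
  by (simp add: L.region_def R.region_def len)

lemma outer_crossings_eq: "R.outer_crossings = L.outer_crossings"
proof -
  have "(p, q) \<in> crossings k D \<and> p \<notin> L.region \<longleftrightarrow> (p, q) \<in> crossings k D' \<and> p \<notin> L.region" for p q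
  proof (cases "p \<in> passage_points k \<and> q \<in> passage_points k \<and> p \<notin> L.region \<and> q \<notin> L.region")
    case True
    then show ?thesis using agree[of p] agree[of q] by (simp add: crossings_def double_pairs_def)
  next
    case False
    have "\<not> ((p, q) \<in> crossings k D \<and> p \<notin> L.region)"
      using False L.crossing_region[of p q] by (auto simp: crossings_def double_pairs_def)
    moreover have "\<not> ((p, q) \<in> crossings k D' \<and> p \<notin> L.region)"
      using False R.crossing_region[of p q] unfolding region_eq by (auto simp: crossings_def double_pairs_def)
    ultimately show ?thesis by blast
  qed
  then show ?thesis unfolding L.outer_crossings_def R.outer_crossings_def region_eq by auto
qed

text \<open>The curves agree near the passage: the strands form a closed parameter set. At parameter
  0 a neighbourhood also reaches negative parameters, which periodicity takes back to the unit
  interval.\<close>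

lemma velocity_outer:
  assumes p: "p \<in> passage_points k" "p \<notin> L.region"
  shows "velocity D p = velocity D' p"
proof -
  obtain i t where it: "p = (i, t)" by (cases p)
  have i: "i \<in> {1..k}" and t: "0 \<le> t" "t < 1" using p(1) it by (auto simp: passage_points_def)
  define Ri where "Ri = (\<Union>j\<in>{j. j < length as \<and> c j = i}. (\<lambda>x. m j + r j * x) ` {-1..1})"
  have Ri: "u \<in> Ri \<longleftrightarrow> (i, u) \<in> L.region" for u
    by (auto simp: Ri_def L.region_def strand_points_def)
  have Ri01: "0 < u \<and> u < 1" if uR: "u \<in> Ri" for u
  proof -
    obtain j x where j: "j < length as" "x \<in> {-1..1}" "(i, u) = L.pt j x"
      using uR[unfolded Ri] by (rule L.regionE)
    then have u: "u = snd (L.pt j x)" by (metis snd_conv)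
    show ?thesis
      using L.snd_pt_mono[OF j(1,2)] L.lower[OF j(1)] L.upper[OF j(1)] u by (simp add: L.start_eq L.final_eq)
  qed
  have cR: "compact Ri" unfolding Ri_def by (intro compact_UN compact_continuous_image continuous_intros) auto
  \<comment> \<open>Negative parameters \<open>u\<close> are compared through \<open>u + 1\<close>,
    hence the translate of the strands is removed as well.\<close>
  define G where "G = {-1<..<1} - Ri - (\<lambda>u. u - 1) ` Ri"
  have "compact ((\<lambda>u. u - 1) ` Ri)" using cR by (intro compact_continuous_image continuous_intros)
  then have oG: "open G" unfolding G_def using cR by (intro open_Diff compact_imp_closed) auto
  have "t \<notin> Ri" using p(2) it Ri by simp
  moreover have "t \<notin> (\<lambda>u. u - 1) ` Ri" using Ri01 t by fastforce
  ultimately have tG: "t \<in> G" using t by (auto simp: G_def)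
  have cl: "closed_immersion (curve D i)" "closed_immersion (curve D' i)"
    using L.D R.D i by (auto simp: is_diagram_def)
  have eq: "curve D i u = curve D' i u" if u: "u \<in> G" for u
  proof (cases "0 \<le> u")
    case True
    then have "(i, u) \<in> passage_points k" "(i, u) \<notin> L.region"
      using u i Ri[of u] by (auto simp: G_def passage_points_def)
    then show ?thesis using agree[of "(i, u)"] by (simp add: loc_def)
  next
    case False
    have "u + 1 \<notin> Ri"
    proof
      assume "u + 1 \<in> Ri"
      then have "(u + 1) - 1 \<in> (\<lambda>u. u - 1) ` Ri" by (rule imageI)
      then show False using u by (simp add: G_def)
    qed
    then have "(i, u + 1) \<in> passage_points k" "(i, u + 1) \<notin> L.region"
      using u i Ri[of "u + 1"] False by (auto simp: G_def passage_points_def)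
    then have "curve D i (u + 1) = curve D' i (u + 1)" using agree[of "(i, u + 1)"] by (simp add: loc_def)
    then show ?thesis using cl by (simp add: closed_immersion_def)
  qed
  have "vector_derivative (curve D i) (at t within UNIV) = vector_derivative (curve D' i) (at t within UNIV)"
  proof (rule vector_derivative_cong_eq)
    have "eventually (\<lambda>u. u \<in> G) (nhds t)" using oG tG by (rule eventually_nhds_in_open)
    then show "\<forall>\<^sub>F u in nhds t. u \<in> UNIV \<longrightarrow> curve D i u = curve D' i u"
      by (rule eventually_mono) (use eq in auto)
  qed auto
  then show ?thesis by (simp add: velocity_def it)
qed

lemma self_passages_outer:
  assumes "(i, u) \<notin> L.region"
  shows "u \<in> self_passages k D i \<longleftrightarrow> u \<in> self_passages k D' i"
proof -
  have *: "u \<in> self_passages k E i \<longleftrightarrow> (\<exists>z\<in>Q. self_crossing z \<and> ((i, u) = fst z \<or> (i, u) = snd z))"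
    if Q: "Q = {(p, q). (p, q) \<in> crossings k E \<and> p \<notin> L.region}"
      and cr: "\<And>p q. (p, q) \<in> crossings k E \<Longrightarrow> p \<in> L.region \<longleftrightarrow> q \<in> L.region" for E Q
  proof -
    have "z \<in> Q" if z: "z \<in> crossings k E" "(i, u) = fst z \<or> (i, u) = snd z" for z
    proof -
      obtain p q where pq: "z = (p, q)" by (cases z)
      then have "p \<notin> L.region" using z cr[of p q] assms by auto
      then show ?thesis using z pq Q by simp
    qed
    moreover have "Q \<subseteq> crossings k E" using Q by auto
    ultimately show ?thesis unfolding self_passages_def by blast
  qed
  show ?thesis
    using *[OF L.outer_crossings_def L.crossing_region]
      *[OF R.outer_crossings_def[unfolded region_eq] R.crossing_region[unfolded region_eq]]
    unfolding outer_crossings_eq by simp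
qed

lemma self_index_parity:
  assumes "\<And>j. j < length as \<Longrightarrow> c j = i \<Longrightarrow> t \<le> snd (L.start j) \<or> snd (L.final j) \<le> t"
  shows "even (self_index k D i t) = even (self_index k D' i t)"
proof -
  have "{u \<in> self_passages k D i. (i, u) \<notin> L.region \<and> u < t} =
      {u \<in> self_passages k D' i. (i, u) \<notin> R.region \<and> u < t}"
    unfolding region_eq using self_passages_outer by auto
  moreover have "even (\<Sum>j | j < length as \<and> c j = i \<and> snd (L.final j) \<le> t. card (L.self_params j)) =
      even (\<Sum>j | j < length as \<and> c j = i \<and> snd (L.final j) \<le> t. card (R.self_params j))"
    by (rule even_sum_cong) (use self_parity in auto)
  ultimately show ?thesis
    using L.self_index_outer[OF assms] R.self_index_outer[of i t] assms unfolding len by simp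
qed

lemma outside_strands:
  assumes j: "j < length as" and t: "\<And>x. x \<in> {-1<..<1} \<Longrightarrow> (c j, t) \<noteq> L.pt j x"
  shows "t \<le> snd (L.start j) \<or> snd (L.final j) \<le> t"
proof (rule ccontr)
  assume n: "\<not> ?thesis"
  then have "snd (L.start j) \<le> t" "t \<le> snd (L.final j)" by auto
  then obtain y where y: "y \<in> {-1..1}" "(c j, t) = L.pt j y" by (rule L.strand_coordinate[OF j])
  have "y \<noteq> 1 \<and> y \<noteq> - 1"
    using n y(2) by (auto simp: L.start_def L.final_def L.pt_def sgn_if split: if_splits)
  then have "y \<in> {-1<..<1}" using y(1) by auto
  then show False using t y(2) by blast
qed

text \<open>The start of a strand lies in the interior of no strand, so it counts as an outside
  point.\<close>

lemma base_parity:
  assumes j: "j < length as"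
  shows "even (L.base j) = even (R.base j)"
  unfolding L.base_def R.base_def
proof (rule self_index_parity)
  fix l assume l: "l < length as" "c l = c j"
  show "snd (L.start j) \<le> snd (L.start l) \<or> snd (L.final l) \<le> snd (L.start j)"
  proof (rule outside_strands[OF l(1)])
    fix x assume x: "x \<in> {-1<..<1::real}"
    then have x': "x \<in> {-1..1}" by auto
    show "(c l, snd (L.start j)) \<noteq> L.pt l x"
    proof
      assume "(c l, snd (L.start j)) = L.pt l x"
      then have "L.pt j (- sgn (r j)) = L.pt l x" using l(2) by (simp add: L.start_def L.pt_def)
      then have "j = l" "- sgn (r j) = x" using L.pt_eq_iff[OF j l(1) L.sgn_in(2) x'] by auto
      then show False using L.sgn_notin(2)[OF j] x by blast
    qed
  qed
qed

lemma weight_outer: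
  assumes z: "(p, q) \<in> L.outer_crossings"
  shows "crossing_weight k D (p, q) = crossing_weight k D' (p, q)"
proof -
  have cr: "(p, q) \<in> crossings k D" and cr': "(p, q) \<in> crossings k D'"
    using z outer_crossings_eq unfolding L.outer_crossings_def R.outer_crossings_def by blast+
  have "{p, q} \<subseteq> fst ` L.outer_crossings \<union> snd ` L.outer_crossings" using z by force
  then have pq: "p \<in> passage_points k" "p \<notin> L.region" "q \<in> passage_points k" "q \<notin> L.region"
    using L.outer_crossings_notin by blast+
  have s: "crossing_sign D (p, q) = crossing_sign D' (p, q)"
    using velocity_outer[OF pq(1,2)] velocity_outer[OF pq(3,4)] by (simp add: crossing_sign_def)
  have par: "even (self_index k D (fst z) (snd z)) = even (self_index k D' (fst z) (snd z))" if "z \<notin> L.region" for z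
  proof (rule self_index_parity, rule outside_strands)
    fix j x assume "j < length as" "c j = fst z" "x \<in> {-1<..<1::real}"
    then have "L.pt j x \<in> L.region" "(c j, snd z) = z" by (auto intro!: L.regionI)
    then show "(c j, snd z) \<noteq> L.pt j x" using that by auto
  qed auto
  have "even_crossing k D (p, q) = even_crossing k D' (p, q)" if f: "fst p = fst q"
    using even_crossing_iff[OF L.D cr f] even_crossing_iff[OF R.D cr' f] par[OF pq(2)] par[OF pq(4)] f by simp
  then have "(fst p = fst q \<and> even_crossing k D (p, q)) = (fst p = fst q \<and> even_crossing k D' (p, q))"
    by blast
  then show ?thesis unfolding crossing_weight_eq s by simp
qed

text \<open>With equal transfers and equal outside weights the two reduced matrices coincide; only
  the units of the eliminations differ.\<close>

lemma same_transfer: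
  assumes trL: "L.has_transfer L.inner_crossings (crossing_weight k D) F"
    and trR: "R.has_transfer R.inner_crossings (crossing_weight k D') F"
  shows "same_polynomial k D D'"
proof -
  have mt: "matching L.outer_crossings"
    using matching_crossings(1)[OF L.D] unfolding L.crossings_split matching_def inj_on_Un image_Un by blast
  have arcs: "R.outer_arcs = L.outer_arcs"
    by (simp add: L.outer_arcs_def R.outer_arcs_def outer_crossings_eq len)
  have re: "rel L.outer_crossings (crossing_weight k D) N = rel L.outer_crossings (crossing_weight k D') N" for N
    by (rule rel_cong_weight[OF mt]) (use weight_outer in auto)
  have red: "R.reduced R.outer_crossings (crossing_weight k D') R.outer_arcs F =
      L.reduced L.outer_crossings (crossing_weight k D) L.outer_arcs F"
    unfolding L.reduced_def R.reduced_def arcs outer_crossings_eq len L.form_def R.form_def re by simp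
  obtain u where u: "u \<in> monomial_units" "alexander k D (arcs k D) =
      u * sdet L.outer_arcs (L.reduced L.outer_crossings (crossing_weight k D) L.outer_arcs F)"
    using L.alexander_transfer[OF trL] by blast
  obtain u' where u': "u' \<in> monomial_units" "alexander k D' (arcs k D') =
      u' * sdet L.outer_arcs (L.reduced L.outer_crossings (crossing_weight k D) L.outer_arcs F)"
    using R.alexander_transfer[OF trR] unfolding arcs red[unfolded arcs] by blast
  obtain v where v: "v \<in> monomial_units" "v * u = 1" using monomial_units_inverse[OF u(1)] by blast
  have "alexander k D' (arcs k D') = (u' * v) * alexander k D (arcs k D)"
  proof -
    have "(u' * v) * alexander k D (arcs k D) = u' * (v * u) * sdet L.outer_arcs (L.reduced L.outer_crossings (crossing_weight k D) L.outer_arcs F)"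
      unfolding u(2) by (simp only: mult.assoc)
    then show ?thesis unfolding v(2) u'(2) by simp
  qed
  then show ?thesis unfolding same_polynomial_def using monomial_units_mult[OF u'(1) v(1)] by blast
qed

end

section \<open>The Reidemeister moves\<close>

definition tangle_ok ::
  "(real \<Rightarrow> complex) list \<Rightarrow> passage set \<Rightarrow> (nat \<Rightarrow> real \<Rightarrow> complex) \<Rightarrow> bool" where
  "tangle_ok as ov dv \<longleftrightarrow>
     (\<forall>j<length as. (\<forall>x\<in>{-1..1}. (as ! j) x \<in> window) \<and>
        (\<forall>x\<in>{-1<..<1}. ((as ! j) has_vector_derivative dv j x) (at x))) \<and>
     (\<forall>a x b y. tangle_crossing as ov a x b y \<longrightarrow> x \<in> {-1<..<1} \<and> y \<in> {-1<..<1})"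

lemma tangle_diagramI:
  "is_diagram k D \<Longrightarrow> tangle_in k D (as, ov) c m r \<Longrightarrow> tangle_ok as ov dv \<Longrightarrow> tangle_diagram k D as ov c m r dv"
  by unfold_locales (auto simp: tangle_ok_def simp del: greaterThanLessThan_iff atLeastAtMost_iff)

section \<open>Geometry of the model tangles\<close>

lemma window_iff: "Complex x y \<in> window \<longleftrightarrow> - 1 \<le> x \<and> x \<le> 1 \<and> - 2 \<le> y \<and> y \<le> 2"
  by (auto simp: window_def in_cbox_complex_iff)

lemma has_vector_derivative_Complex:
  assumes "(f has_real_derivative f') (at x)" "(g has_real_derivative g') (at x)"
  shows "((\<lambda>x. Complex (f x) (g x)) has_vector_derivative Complex f' g') (at x)"
proof -
  have "((\<lambda>x. f x *\<^sub>R (1::complex) + g x *\<^sub>R \<i>) has_vector_derivative (f' *\<^sub>R 1 + g' *\<^sub>R \<i>)) (at x)"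
    using assms by (auto intro!: derivative_eq_intros)
  then show ?thesis by (simp add: Complex_eq scaleR_conv_of_real mult.commute)
qed

lemma bump_deriv: "(bump has_real_derivative - 4 * x * (1 - x\<^sup>2)) (at x)"
  unfolding bump_def by (auto intro!: derivative_eq_intros simp: algebra_simps)

lemma bump_bounds:
  assumes "x \<in> {-1..1}"
  shows "0 \<le> bump x" "bump x \<le> 1"
proof -
  have "x\<^sup>2 \<le> 1" using assms by (simp add: abs_square_le_1 abs_le_iff)
  then show "0 \<le> bump x" "bump x \<le> 1" unfolding bump_def by (auto simp: power_le_one)
qed

lemma bump_minus [simp]: "bump (- x) = bump x"
  by (simp add: bump_def)

lemma bump_less:
  assumes "\<bar>x\<bar> < \<bar>y\<bar>" "\<bar>y\<bar> \<le> 1"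
  shows "bump y < bump x"
proof -
  have "x\<^sup>2 < y\<^sup>2" using power_strict_mono[of "\<bar>x\<bar>" "\<bar>y\<bar>" 2] assms(1) by simp
  moreover have "y\<^sup>2 \<le> 1" using assms(2) by (simp add: abs_square_le_1)
  ultimately show ?thesis unfolding bump_def by (intro power_strict_mono) auto
qed

lemma bump_half: "bump (1 / 2) = 9 / 16"
  by (simp add: bump_def power2_eq_square)

lemma bump_eq_iff:
  assumes "x \<in> {-1..1}" "y \<in> {-1..1}"
  shows "bump x = bump y \<longleftrightarrow> x = y \<or> x = - y"
proof -
  have "\<bar>x\<bar> \<le> 1" "\<bar>y\<bar> \<le> 1" using assms by auto
  then have "bump x = bump y \<longleftrightarrow> \<bar>x\<bar> = \<bar>y\<bar>"
    using bump_less[of x y] bump_less[of y x] by (metis bump_minus abs_if less_irrefl linorder_neqE_linordered_idom)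
  then show ?thesis by (auto simp: abs_eq_iff)
qed

lemma bump_eq_half:
  assumes "x \<in> {-1..1}"
  shows "bump x = 9 / 16 \<longleftrightarrow> x = 1 / 2 \<or> x = - (1 / 2)"
  using bump_eq_iff[of x "1 / 2"] assms by (simp add: bump_half)

text \<open>The constant is chosen so that \<open>8/9 * 9/16 = 1/2\<close>. A solution is
  nonnegative, and there the left-hand side decreases while the right-hand side increases, so it is
  unique.\<close>

lemma bump_fixed_point:
  assumes x: "x \<in> {-1..1}"
  shows "8 / 9 * bump x = x \<longleftrightarrow> x = 1 / 2"
proof
  assume e: "8 / 9 * bump x = x"
  then have "0 \<le> x" using bump_bounds[OF x] by linarith
  have "\<not> x < 1 / 2" using bump_less[of x "1 / 2"] bump_half e \<open>0 \<le> x\<close> by fastforce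
  moreover have "\<not> 1 / 2 < x" using bump_less[of "1 / 2" x] bump_half e x by fastforce
  ultimately show "x = 1 / 2" by linarith
next
  assume x: "x = 1 / 2"
  show "8 / 9 * bump x = x" unfolding x bump_half by simp
qed

lemma bump_fixed_point':
  assumes x: "x \<in> {-1..1}" and e: "e = 1 \<or> e = - 1"
  shows "e * (8 / 9) * bump x = x \<longleftrightarrow> x = e / 2" "e * (8 / 9) * bump x = - x \<longleftrightarrow> x = - e / 2"
  using e bump_fixed_point[OF x] bump_fixed_point[of "- x"] x by auto

lemma tangle_of_crossing:
  "tangle_crossing as (snd (tangle_of as ov)) a x b y \<longleftrightarrow>
     a < length as \<and> b < length as \<and> x \<in> {-1..1} \<and> y \<in> {-1..1} \<and> (a, x) \<noteq> (b, y) \<and> (as ! a) x = (as ! b) y \<and>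
     (\<exists>l<length as. \<exists>z\<in>{-1..1}. l \<noteq> a \<and> (as ! a) x = (as ! l) z \<and> ov a l)"
  by (auto simp: tangle_crossing_def tangle_of_def)

lemma fst_tangle_of [simp]: "fst (tangle_of as ov) = as"
  by (simp add: tangle_of_def)

abbreviation straight :: "(real \<Rightarrow> complex) list" where
  "straight \<equiv> [\<lambda>x. Complex x 0]"

lemma straight_crossing: "\<not> tangle_crossing straight ov a x b y"
  by (auto simp: tangle_crossing_def)

lemma straight_ok: "tangle_ok straight ov (\<lambda>j x. Complex 1 0)"
  unfolding tangle_ok_def using straight_crossing
  by (auto simp: window_iff intro!: has_vector_derivative_Complex derivative_eq_intros)

text \<open>Equal heights force \<open>x = - y\<close>. The first coordinate is odd, so at a double
  point it vanishes, that is, \<open>bump\<close> equals \<open>9/16\<close>.\<close>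

lemma kink_coincidence:
  assumes "x \<in> {-1..1}" "y \<in> {-1..1}" "x \<noteq> y"
  shows "kink x = kink y \<longleftrightarrow> x = 1 / 2 \<and> y = - 1 / 2 \<or> x = - 1 / 2 \<and> y = 1 / 2"
proof
  assume e: "kink x = kink y"
  then have b: "bump x = bump y" and re: "x - 16 / 9 * x * bump x = y - 16 / 9 * y * bump y"
    unfolding kink_def complex.inject by blast+
  have xy: "x = - y" using b bump_eq_iff[OF assms(1,2)] assms(3) by auto
  then have "y \<noteq> 0" using assms(3) by auto
  moreover have "y * (9 / 16 - bump y) = 0" using re b unfolding xy by (simp add: algebra_simps)
  ultimately have "bump y = 9 / 16" by simp
  then show "x = 1 / 2 \<and> y = - 1 / 2 \<or> x = - 1 / 2 \<and> y = 1 / 2"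
    using bump_eq_half[OF assms(2)] xy by auto
next
  assume "x = 1 / 2 \<and> y = - 1 / 2 \<or> x = - 1 / 2 \<and> y = 1 / 2"
  moreover have "kink (1 / 2) = Complex 0 (9 / 16)" unfolding kink_def bump_half by simp
  moreover have "bump (- 1 / 2) = 9 / 16" using bump_minus[of "1 / 2"] bump_half by simp
  then have "kink (- 1 / 2) = Complex 0 (9 / 16)" unfolding kink_def by simp
  ultimately show "kink x = kink y" by (elim disjE conjE) (simp_all only:)
qed

lemma kink_crossing:
  "tangle_crossing [kink] ov a x b y \<longleftrightarrow>
     a = 0 \<and> b = 0 \<and> (0, x) \<in> ov \<and> (x = 1 / 2 \<and> y = - 1 / 2 \<or> x = - 1 / 2 \<and> y = 1 / 2)"
  using kink_coincidence[of x y] by (auto simp: tangle_crossing_def)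

lemma kink_ok: "\<exists>dv. tangle_ok [kink] ov dv"
proof -
  let ?dv = "\<lambda>(j::nat) x. Complex (1 - (16 / 9 * bump x + 16 / 9 * x * (- 4 * x * (1 - x\<^sup>2)))) (- 4 * x * (1 - x\<^sup>2))"
  have w: "kink x \<in> window" if x: "x \<in> {-1..1}" for x
  proof -
    \<comment> \<open>The first coordinate is \<open>x * (1 - 16/9 * bump x)\<close>, and the second
      factor lies between \<open>-7/9\<close> and \<open>1\<close>.\<close>
    have "\<bar>x\<bar> \<le> 1" using x by auto
    moreover have "\<bar>1 - 16 / 9 * bump x\<bar> \<le> 1" using bump_bounds[OF x] by (auto simp: abs_le_iff)
    ultimately have "\<bar>x * (1 - 16 / 9 * bump x)\<bar> \<le> 1 * 1" unfolding abs_mult by (intro mult_mono) auto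
    then have "\<bar>x - 16 / 9 * x * bump x\<bar> \<le> 1" by (simp add: algebra_simps)
    then show ?thesis using bump_bounds[OF x] unfolding kink_def window_iff abs_le_iff by linarith
  qed
  have kd: "((\<lambda>x. Complex (x - 16 / 9 * x * bump x) (bump x)) has_vector_derivative
      Complex (1 - (16 / 9 * bump x + 16 / 9 * x * b)) b) (at x)"
    if b: "(bump has_real_derivative b) (at x)" for x b
    by (rule has_vector_derivative_Complex[OF _ b]) (auto intro!: derivative_eq_intros b simp: field_simps)
  have "(kink has_vector_derivative ?dv 0 x) (at x)" for x
    unfolding kink_def[abs_def] by (rule kd[OF bump_deriv])
  then have "tangle_ok [kink] ov ?dv"
    unfolding tangle_ok_def kink_crossing using w by auto
  then show ?thesis by blast
qed

lemma less_2: "(j::nat) < 2 \<longleftrightarrow> j = 0 \<or> j = 1" and less_3: "(j::nat) < 3 \<longleftrightarrow> j = 0 \<or> j = 1 \<or> j = 2"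
  by auto

lemma R2_separate_crossing: "\<not> tangle_crossing R2_separate ov a x b y"
  by (auto simp: tangle_crossing_def R2_separate_def less_Suc_eq numeral_2_eq_2)

lemma R2_separate_ok: "tangle_ok R2_separate ov (\<lambda>j x. Complex 1 0)"
  unfolding tangle_ok_def using R2_separate_crossing
  by (auto simp: window_iff R2_separate_def less_Suc_eq intro!: has_vector_derivative_Complex derivative_eq_intros)

lemma R2_bigon_nth: "R2_bigon ! 0 = (\<lambda>x. Complex x 0)" "R2_bigon ! 1 = (\<lambda>x. Complex x (9 / 16 - bump x))"
  "length R2_bigon = 2" "R2_bigon ! Suc 0 = (\<lambda>x. Complex x (9 / 16 - bump x))"
  by (simp_all add: R2_bigon_def)

text \<open>The arcs are graphs over their parameter, so they can meet only at equal
  parameters.\<close>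

lemma R2_coincidence:
  assumes "a < 2" "b < 2" "x \<in> {-1..1}"
  shows "(R2_bigon ! a) x = (R2_bigon ! b) y \<longleftrightarrow> x = y \<and> (a = b \<or> x = 1 / 2 \<or> x = - (1 / 2))"
  using assms(1,2) bump_eq_half[OF assms(3)] unfolding less_2 by (auto simp: R2_bigon_nth)

lemma R2_bigon_crossing:
  "tangle_crossing R2_bigon (snd (tangle_of R2_bigon ov)) a x b y \<longleftrightarrow>
     a < 2 \<and> b < 2 \<and> a \<noteq> b \<and> y = x \<and> (x = 1 / 2 \<or> x = - (1 / 2)) \<and> ov a b" (is "?L \<longleftrightarrow> ?R")
proof
  assume ?L
  then obtain l z where ab: "a < 2" "b < 2" "x \<in> {-1..1}" "(a, x) \<noteq> (b, y)" "(R2_bigon ! a) x = (R2_bigon ! b) y"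
    and l: "l < 2" "l \<noteq> a" "ov a l"
    unfolding tangle_of_crossing R2_bigon_nth(3) by blast
  then have "y = x" "a \<noteq> b" "x = 1 / 2 \<or> x = - (1 / 2)" using R2_coincidence[OF ab(1,2,3), of y] by auto
  moreover have "l = b" using \<open>a \<noteq> b\<close> l ab(1,2) unfolding less_2 by auto
  ultimately show ?R using ab l by simp
next
  assume R: ?R
  then have x: "x \<in> {-1..1}" by auto
  have "(R2_bigon ! a) x = (R2_bigon ! b) x" using R2_coincidence[OF _ _ x, of a b x] R by auto
  then show ?L unfolding tangle_of_crossing R2_bigon_nth(3) using R x by blast
qed

abbreviation R2_dv :: "nat \<Rightarrow> real \<Rightarrow> complex" where
  "R2_dv \<equiv> \<lambda>j x. if j = 0 then Complex 1 0 else Complex 1 (4 * x * (1 - x\<^sup>2))"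

lemma R2_bigon_ok: "tangle_ok R2_bigon (snd (tangle_of R2_bigon ov)) R2_dv"
proof -
  have "((R2_bigon ! j) has_vector_derivative R2_dv j x) (at x)" if "j < 2" for j x
    using that unfolding less_2
    by (auto simp: R2_bigon_nth intro!: has_vector_derivative_Complex derivative_eq_intros bump_deriv)
  moreover have "(R2_bigon ! j) x \<in> window" if "j < 2" "x \<in> {-1..1}" for j x
    using that bump_bounds[OF that(2)] unfolding less_2 by (auto simp: R2_bigon_nth window_iff)
  ultimately show ?thesis
    unfolding tangle_ok_def R2_bigon_crossing by (auto simp: R2_bigon_nth(3))
qed

lemma R3_nth: "R3_triangle e ! 0 = (\<lambda>x. Complex x (e * (8 / 9) * bump x))" "R3_triangle e ! 1 = (\<lambda>x. Complex x x)"
  "R3_triangle e ! 2 = (\<lambda>x. Complex x (- x))" "length (R3_triangle e) = 3"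
  "R3_triangle e ! Suc 0 = (\<lambda>x. Complex x x)"
  by (simp_all add: R3_triangle_def)

text \<open>The sum of two distinct indices below 3 identifies the pair. The curved arc 0 meets the
  diagonals at \<open>e / 2\<close> and \<open>- e / 2\<close>, and the diagonals meet at 0; passing
  from \<open>e\<close> to \<open>- e\<close> negates all three positions.\<close>

definition R3_pos :: "real \<Rightarrow> nat \<Rightarrow> nat \<Rightarrow> real" where
  "R3_pos e a b = (if a + b = 1 then e / 2 else if a + b = 2 then - e / 2 else 0)"

lemma R3_pos_sym: "R3_pos e a b = R3_pos e b a"
  by (simp add: R3_pos_def add.commute)

lemma R3_pos_minus: "R3_pos (- e) a b = - R3_pos e a b"
  by (simp add: R3_pos_def)

lemma R3_pos_inj:
  assumes "e = 1 \<or> e = - 1" "a < 3" "b < 3" "b' < 3" "a \<noteq> b" "a \<noteq> b'"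
  shows "R3_pos e a b = R3_pos e a b' \<longleftrightarrow> b = b'"
  using assms unfolding less_3 by (auto simp: R3_pos_def)

lemma R3_pos_interior: "e = 1 \<or> e = - 1 \<Longrightarrow> R3_pos e a b \<in> {-1<..<1}"
  by (auto simp: R3_pos_def)

lemma R3_coincidence:
  assumes "a < 3" "b < 3" "x \<in> {-1..1}" "e = 1 \<or> e = - 1"
  shows "(R3_triangle e ! a) x = (R3_triangle e ! b) y \<longleftrightarrow> x = y \<and> (a = b \<or> x = R3_pos e a b)"
proof -
  define h where "h = e * (8 / 9) * bump x"
  have h: "(h = x) = (x = e / 2)" "(h = - x) = (x = - e / 2)" "(x = h) = (x = e / 2)" "(- x = h) = (x = - e / 2)"
    using bump_fixed_point'[OF assms(3,4)] unfolding h_def by auto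
  have z: "(x = - x) = (x = 0)" "(- x = x) = (x = 0)" by auto
  have p: "R3_pos e 0 1 = e / 2" "R3_pos e 1 0 = e / 2" "R3_pos e 0 2 = - e / 2" "R3_pos e 2 0 = - e / 2"
    "R3_pos e 1 2 = 0" "R3_pos e 2 1 = 0"
    by (simp_all add: R3_pos_def)
  have "(R3_triangle e ! a) x = (R3_triangle e ! b) x \<longleftrightarrow> a = b \<or> x = R3_pos e a b"
    using assms(1,2) unfolding less_3
    by (elim disjE) (simp_all only: R3_nth complex.inject h_def[symmetric] h z p simp_thms, simp_all)
  moreover have "Re ((R3_triangle e ! a) x) = x" "Re ((R3_triangle e ! b) y) = y"
    using assms(1,2) unfolding less_3 by (auto simp: R3_nth)
  ultimately show ?thesis by metis
qed

lemma R3_crossing: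
  assumes e: "e = 1 \<or> e = - 1"
  shows "tangle_crossing (R3_triangle e) (snd (tangle_of (R3_triangle e) ov)) a x b y \<longleftrightarrow>
     a < 3 \<and> b < 3 \<and> a \<noteq> b \<and> x = R3_pos e a b \<and> y = R3_pos e a b \<and> ov a b" (is "?L \<longleftrightarrow> ?R")
proof
  assume ?L
  then obtain l z where ab: "a < 3" "b < 3" "x \<in> {-1..1}" "(a, x) \<noteq> (b, y)" "(R3_triangle e ! a) x = (R3_triangle e ! b) y"
    and l: "l < 3" "l \<noteq> a" "(R3_triangle e ! a) x = (R3_triangle e ! l) z" "ov a l"
    unfolding tangle_of_crossing R3_nth(4) by blast
  then have 1: "y = x" "a \<noteq> b" "x = R3_pos e a b" using R3_coincidence[OF ab(1,2,3) e, of y] by auto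
  have "x = R3_pos e a l" using R3_coincidence[OF ab(1) l(1) ab(3) e, of z] l by auto
  then have "l = b" using R3_pos_inj[OF e ab(1,2) l(1) 1(2)] 1(3) l(2) by auto
  then show ?R using 1 ab l by simp
next
  assume R: ?R
  then have x: "x \<in> {-1..1}" using R3_pos_interior[OF e, of a b] by auto
  have "(R3_triangle e ! a) x = (R3_triangle e ! b) x" using R3_coincidence[OF _ _ x e, of a b x] R by auto
  then show ?L unfolding tangle_of_crossing R3_nth(4) using R x by blast
qed

definition R3_dv :: "real \<Rightarrow> nat \<Rightarrow> real \<Rightarrow> complex" where
  "R3_dv e j x = (if j = 0 then Complex 1 (e * (8 / 9) * (- 4 * x * (1 - x\<^sup>2)))
     else if j = 1 then Complex 1 1 else Complex 1 (- 1))"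

lemma R3_ok:
  assumes e: "e = 1 \<or> e = - 1"
  shows "tangle_ok (R3_triangle e) (snd (tangle_of (R3_triangle e) ov)) (R3_dv e)"
proof -
  have "((R3_triangle e ! j) has_vector_derivative R3_dv e j x) (at x)" if "j < 3" for j x
    using that unfolding less_3
    by (auto simp: R3_nth R3_dv_def intro!: has_vector_derivative_Complex derivative_eq_intros bump_deriv)
  moreover have "(R3_triangle e ! j) x \<in> window" if "j < 3" "x \<in> {-1..1}" for j x
    using that bump_bounds[OF that(2)] e unfolding less_3 by (auto simp: R3_nth window_iff)
  ultimately show ?thesis
    unfolding tangle_ok_def R3_crossing[OF e] using R3_pos_interior[OF e] by (auto simp: R3_nth(4))
qed

definition R3_sign :: "nat \<Rightarrow> nat \<Rightarrow> real" where
  "R3_sign a b = wedge (R3_dv 1 a (R3_pos 1 a b)) (R3_dv 1 b (R3_pos 1 a b))"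

text \<open>The slope of arc 0 at \<open>e / 2\<close> or \<open>- e / 2\<close> contains the factor
  \<open>e\<close> twice, hence does not depend on it: the move preserves signs.\<close>

lemma R3_sign:
  assumes "a < 3" "b < 3" "a \<noteq> b" "e = 1 \<or> e = - 1"
  shows "wedge (R3_dv e a (R3_pos e a b)) (R3_dv e b (R3_pos e a b)) = R3_sign a b"
  using assms unfolding less_3 by (auto simp: R3_sign_def R3_dv_def R3_pos_def wedge_def power2_eq_square)

lemma R3_sign_values:
  "R3_sign 0 1 > 0" "R3_sign 1 0 < 0" "R3_sign 0 2 < 0" "R3_sign 2 0 > 0" "R3_sign 1 2 < 0" "R3_sign 2 1 > 0"
  by (simp_all add: R3_sign_def R3_dv_def R3_pos_def wedge_def power2_eq_square)

section \<open>Invariance under the single moves\<close>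

lemma tangle_pairI:
  assumes "tangle_diagram k D as ov c m r dv" "tangle_diagram k D' as' ov' c m r dv'"
    and "length as' = length as"
    and "\<forall>p \<in> passage_points k - (\<Union>j < length as. strand_points c m r j).
           loc D p = loc D' p \<and> (p \<in> over D \<longleftrightarrow> p \<in> over D')"
    and "\<And>j. j < length as \<Longrightarrow> even (card (tangle_diagram.self_params as ov c j)) =
      even (card (tangle_diagram.self_params as' ov' c j))"
  shows "tangle_pair k D as ov c m r dv D' as' ov' dv'"
proof -
  interpret L: tangle_diagram k D as ov c m r dv by fact
  interpret R: tangle_diagram k D' as' ov' c m r dv' by fact
  show ?thesis
    by unfold_locales (use assms(3-5) in \<open>auto simp: L.region_def\<close>)
qed

text \<open>Covers the purely virtual moves: neither side has a classical crossing, so every strand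
  passes its entering arc on.\<close>

lemma replacement_without_crossings:
  assumes LR: "tangle_diagram k D as ov c m r dv" "tangle_diagram k D' as' ov' c m r dv'"
    and len: "length as' = length as"
    and agree: "\<forall>p \<in> passage_points k - (\<Union>j < length as. strand_points c m r j).
           loc D p = loc D' p \<and> (p \<in> over D \<longleftrightarrow> p \<in> over D')"
    and no: "\<And>a x b y. \<not> tangle_crossing as ov a x b y" "\<And>a x b y. \<not> tangle_crossing as' ov' a x b y"
  shows "same_polynomial k D D'"
proof -
  interpret L: tangle_diagram k D as ov c m r dv by fact
  interpret R: tangle_diagram k D' as' ov' c m r dv' by fact
  interpret tangle_pair k D as ov c m r dv D' as' ov' dv'
    by (rule tangle_pairI[OF LR len agree]) (simp add: L.self_params_def R.self_params_def no)
  have "L.inner_crossings = {}" "R.inner_crossings = {}"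
    unfolding L.inner_crossings_eq R.inner_crossings_eq using no by auto
  then show ?thesis using same_transfer[of entry] L.has_transfer_empty R.has_transfer_empty by simp
qed

text \<open>Of two passages on a strand, one has local index 0 and the other 1.\<close>

lemma card_below_two:
  fixes p q r :: real
  assumes "r \<noteq> 0" "p \<noteq> q"
  shows "card {y \<in> {p, q}. r * y < r * p} + card {y \<in> {p, q}. r * y < r * q} = 1"
proof -
  have "r * p < r * q \<or> r * q < r * p" using assms by (metis linorder_neqE_linordered_idom mult_left_cancel)
  then show ?thesis
  proof
    assume "r * p < r * q"
    then have "{y \<in> {p, q}. r * y < r * p} = {}" "{y \<in> {p, q}. r * y < r * q} = {p}" by auto
    then show ?thesis by simp
  next
    assume "r * q < r * p"
    then have "{y \<in> {p, q}. r * y < r * p} = {q}" "{y \<in> {p, q}. r * y < r * q} = {}" by auto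
    then show ?thesis by simp
  qed
qed

text \<open>Negation reverses the order, so the passages before \<open>- x\<close> are the mirror
  images of those after \<open>x\<close>. This compares local indices on the two sides of a triangle
  move.\<close>

lemma card_below_reflect:
  fixes r x :: real
  assumes "r \<noteq> 0" "finite Q" "x \<in> Q"
  shows "card {y \<in> uminus ` Q. r * y < r * (- x)} + card {y \<in> Q. r * y < r * x} + 1 = card Q"
proof -
  have "{y \<in> uminus ` Q. r * y < r * (- x)} = uminus ` {y \<in> Q. r * x < r * y}" by auto
  then have 1: "card {y \<in> uminus ` Q. r * y < r * (- x)} = card {y \<in> Q. r * x < r * y}"
    by (simp add: card_image)
  have "Q = {y \<in> Q. r * x < r * y} \<union> {y \<in> Q. r * y < r * x} \<union> {x}"
    using assms(1,3) by (auto simp: mult_less_cancel_left)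
  then have "card Q = card ({y \<in> Q. r * x < r * y} \<union> {y \<in> Q. r * y < r * x} \<union> {x})" by simp
  also have "\<dots> = card ({y \<in> Q. r * x < r * y} \<union> {y \<in> Q. r * y < r * x}) + card {x}"
    using assms(2) by (intro card_Un_disjoint) auto
  also have "card ({y \<in> Q. r * x < r * y} \<union> {y \<in> Q. r * y < r * x}) =
      card {y \<in> Q. r * x < r * y} + card {y \<in> Q. r * y < r * x}"
    using assms(2) by (intro card_Un_disjoint) auto
  finally show ?thesis using 1 by simp
qed

lemma replacement_R1:
  assumes LR: "tangle_diagram k D straight {} c m r dv" "tangle_diagram k D' [kink] ov c m r dv'"
    and agree: "\<forall>p \<in> passage_points k - (\<Union>j < length straight. strand_points c m r j).
           loc D p = loc D' p \<and> (p \<in> over D \<longleftrightarrow> p \<in> over D')"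
    and ov: "ov = {(0, s)}" and s: "s = 1 / 2 \<or> s = - 1 / 2"
  shows "same_polynomial k D D'"
proof -
  interpret L: tangle_diagram k D straight "{}" c m r dv by fact
  interpret R: tangle_diagram k D' "[kink]" ov c m r dv' by fact
  have cr: "tangle_crossing [kink] ov a x b y \<longleftrightarrow> a = 0 \<and> b = 0 \<and> x = s \<and> y = - s" for a b x y
    unfolding kink_crossing ov using s by auto
  have ss: "s \<noteq> - s" using s by auto
  have c2: "card {s, - s} = 2" using ss by (simp only: card_2_iff) blast
  have spR: "R.self_params 0 = {s, - s}" unfolding R.self_params_def cr by auto
  have spL: "L.self_params j = {}" for j using straight_crossing by (simp add: L.self_params_def)
  interpret tangle_pair k D straight "{}" c m r dv D' "[kink]" ov dv'
    by (rule tangle_pairI[OF LR _ agree]) (simp_all add: spL spR c2)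
  have r0: "r 0 \<noteq> 0" by (rule R.r_nonzero) simp
  have inL: "L.inner_crossings = {}" unfolding L.inner_crossings_eq using straight_crossing by auto
  have inR: "R.inner_crossings = {(R.pt 0 s, R.pt 0 (- s))}" unfolding R.inner_crossings_eq cr by auto
  \<comment> \<open>The base number occurs twice and the local indices add up to 1: a kink is always
    even.\<close>
  have li: "R.local_index 0 s + R.local_index 0 (- s) = 1"
    unfolding R.local_index_def spR by (rule card_below_two[OF r0 ss])
  then have "odd (R.base 0 + R.base 0 + R.local_index 0 s + R.local_index 0 (- s))"
    by (simp add: add.assoc)
  then have w: "crossing_weight k D' (R.pt 0 s, R.pt 0 (- s)) = weight True (Z (c 0))
      (if wedge (dv' 0 s) (dv' 0 (- s)) * (r 0 * r 0) > 0 then 1 else - 1)"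
    using R.weight_pt[of 0 s 0 "- s"] cr by simp
  have sg: "sgn (r 0) = 1 \<or> sgn (r 0) = - 1" using r0 by (auto simp: sgn_if)
  have "R.has_transfer R.inner_crossings (crossing_weight k D') entry"
    unfolding inR
  proof (rule R.has_transfer_R1[where f = "- sgn (r 0) / 2" and g = "sgn (r 0) / 2"])
    show "crossing_weight k D' (R.pt 0 s, R.pt 0 (- s)) = weight True (Z (c 0))
      (if wedge (dv' 0 s) (dv' 0 (- s)) * (r 0 * r 0) > 0 then 1 else - 1)" by (rule w)
    show "length [kink] = 1" by simp
    show "- sgn (r 0) / 2 \<in> {-1<..<1}" "sgn (r 0) / 2 \<in> {-1<..<1}" using sg by auto
    show "r 0 * (- sgn (r 0) / 2) < r 0 * (sgn (r 0) / 2)" using R.r_sgn_pos[of 0] by simp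
    show "(s, - s) = (- sgn (r 0) / 2, sgn (r 0) / 2) \<or> (s, - s) = (sgn (r 0) / 2, - sgn (r 0) / 2)"
      using sg s by auto
  qed
  then show ?thesis using same_transfer[of entry] L.has_transfer_empty inL by simp
qed

lemma replacement_R2:
  assumes LR: "tangle_diagram k D R2_separate ov0 c m r dv"
      "tangle_diagram k D' R2_bigon (snd (tangle_of R2_bigon ov)) c m r R2_dv"
    and agree: "\<forall>p \<in> passage_points k - (\<Union>j < length R2_separate. strand_points c m r j).
           loc D p = loc D' p \<and> (p \<in> over D \<longleftrightarrow> p \<in> over D')"
    and ov: "stacked 2 ov"
  shows "same_polynomial k D D'"
proof -
  interpret L: tangle_diagram k D R2_separate ov0 c m r dv by fact
  interpret R: tangle_diagram k D' R2_bigon "snd (tangle_of R2_bigon ov)" c m r R2_dv by fact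
  obtain h :: "nat \<Rightarrow> nat" where h: "inj_on h {..<2}" "\<And>j l. j < 2 \<Longrightarrow> l < 2 \<Longrightarrow> ov j l \<longleftrightarrow> h l < h j"
    using ov unfolding stacked_def by blast
  have "h 0 \<noteq> h 1" using inj_onD[OF h(1), of 0 1] by auto
  then obtain p q :: nat where pq: "(p, q) = (0, 1) \<or> (p, q) = (1, 0)" and hpq: "h q < h p"
    by (metis linorder_neqE_nat)
  have lt: "p < 2" "q < 2" "p \<noteq> q" using pq by auto
  have "a < 2 \<and> b < 2 \<and> a \<noteq> b \<and> ov a b \<longleftrightarrow> a = p \<and> b = q" for a b
  proof
    assume ab: "a < 2 \<and> b < 2 \<and> a \<noteq> b \<and> ov a b"
    then have "a = p \<and> b = q \<or> a = q \<and> b = p" using pq unfolding less_2 by auto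
    then show "a = p \<and> b = q" using ab h(2)[of a b] hpq by auto
  qed (use lt h(2)[of p q] hpq in auto)
  then have cr: "tangle_crossing R2_bigon (snd (tangle_of R2_bigon ov)) a x b y \<longleftrightarrow>
     a = p \<and> b = q \<and> y = x \<and> (x = 1 / 2 \<or> x = - (1 / 2))" for a b x y
    unfolding R2_bigon_crossing by blast
  have spL: "L.self_params j = {}" for j using R2_separate_crossing by (simp add: L.self_params_def)
  have spR: "R.self_params j = (if c p = c q then {1 / 2, - (1 / 2)} else {})" if "j < 2" for j
  proof -
    have "j = p \<or> j = q" using that pq unfolding less_2 by auto
    then have "x \<in> R.self_params j \<longleftrightarrow> c p = c q \<and> (x = 1 / 2 \<or> x = - (1 / 2))" for x
    proof
      assume j: "j = p"
      show ?thesis unfolding R.self_params_def cr mem_Collect_eq j using lt(3) by metis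
    next
      assume j: "j = q"
      show ?thesis unfolding R.self_params_def cr mem_Collect_eq j using lt(3) by metis
    qed
    then show ?thesis by (simp add: set_eq_iff)
  qed
  have len: "length R2_bigon = length R2_separate" by (simp add: R2_bigon_def R2_separate_def)
  have len2: "length R2_separate = 2" by (simp add: R2_separate_def)
  interpret tangle_pair k D R2_separate ov0 c m r dv D' R2_bigon "snd (tangle_of R2_bigon ov)" R2_dv
    by (rule tangle_pairI[OF LR len agree]) (simp add: spL spR len2)
  have r0: "r p \<noteq> 0" "r q \<noteq> 0" using R.r_nonzero lt by (simp_all add: R2_bigon_nth)
  define s where "s = - sgn (r p) / 2"
  have sI: "s = 1 / 2 \<or> s = - (1 / 2)" using r0 by (auto simp: s_def sgn_if)
  then have ss: "s \<noteq> - s" "{s, - s} = {1 / 2, - (1 / 2)}" by auto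
  have inL: "L.inner_crossings = {}" unfolding L.inner_crossings_eq using R2_separate_crossing by auto
  have inR: "R.inner_crossings = {(R.pt p s, R.pt q s), (R.pt p (- s), R.pt q (- s))}"
  proof -
    have "(x = 1 / 2 \<or> x = - (1 / 2)) = (x = s \<or> x = - s)" for x using sI by auto
    then have "tangle_crossing R2_bigon (snd (tangle_of R2_bigon ov)) a x b y \<longleftrightarrow>
        a = p \<and> b = q \<and> y = x \<and> (x = s \<or> x = - s)" for a b x y
      unfolding cr by simp
    then show ?thesis unfolding R.inner_crossings_eq by auto
  qed
  \<comment> \<open>Going from \<open>s\<close> to \<open>- s\<close> switches the local index on
    both strands between 0 and 1, so the two crossings of the bigon have the same parity.\<close>
  have parity: "(c p = c q \<and> odd (R.base p + R.base q + R.local_index p s + R.local_index q s)) =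
      (c p = c q \<and> odd (R.base p + R.base q + R.local_index p (- s) + R.local_index q (- s)))"
  proof (cases "c p = c q")
    case True
    then have "R.self_params p = {s, - s}" "R.self_params q = {s, - s}" using spR lt ss(2) by simp_all
    then have "R.local_index p s + R.local_index p (- s) = 1" "R.local_index q s + R.local_index q (- s) = 1"
      unfolding R.local_index_def using card_below_two[OF r0(1) ss(1)] card_below_two[OF r0(2) ss(1)] by simp_all
    then have e: "(R.base p + R.base q + R.local_index p s + R.local_index q s) +
      (R.base p + R.base q + R.local_index p (- s) + R.local_index q (- s)) = 2 * (R.base p + R.base q + 1)" by simp
    have "even ((R.base p + R.base q + R.local_index p s + R.local_index q s) +
      (R.base p + R.base q + R.local_index p (- s) + R.local_index q (- s)))" unfolding e by simp
    then show ?thesis by (simp only: even_add)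
  qed simp
  define ev where "ev = (c p = c q \<and> odd (R.base p + R.base q + R.local_index p s + R.local_index q s))"
  define v where "v = (if c p = c q then Z (c p) else W {c p, c q})"
  define X where "X t = wedge (R2_dv p t) (R2_dv q t) * (r p * r q)" for t
  define e :: int where "e = (if X s > 0 then 1 else - 1)"
  \<comment> \<open>The wedge is, up to sign, \<open>4 * x * (1 - x^2)\<close>, an odd function: the
    two crossings have opposite signs.\<close>
  have X: "X (- s) = - X s" "X s \<noteq> 0"
  proof -
    have "s * s = 1 / 4"
    proof (rule disjE[OF sI])
      assume a: "s = 1 / 2"
      show ?thesis unfolding a by simp
    next
      assume a: "s = - (1 / 2)"
      show ?thesis unfolding a by simp
    qed
    moreover have "s \<noteq> 0" using sI by auto
    ultimately show "X (- s) = - X s" "X s \<noteq> 0"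
      using pq r0 by (auto simp: X_def wedge_def power2_eq_square)
  qed
  have w1: "crossing_weight k D' (R.pt p s, R.pt q s) = weight ev v e"
    using R.weight_pt[of p s q s] cr sI unfolding ev_def v_def e_def X_def by blast
  have "crossing_weight k D' (R.pt p (- s), R.pt q (- s)) = weight ev v (if X (- s) > 0 then 1 else - 1)"
    using R.weight_pt[of p "- s" q "- s"] cr sI unfolding ev_def parity v_def X_def by auto
  also have "(if X (- s) > 0 then 1 else - 1) = - e" using X by (simp add: e_def)
  finally have w2: "crossing_weight k D' (R.pt p (- s), R.pt q (- s)) = weight ev v (- e)" .
  have "R.has_transfer R.inner_crossings (crossing_weight k D') entry"
    unfolding inR
    by (rule R.has_transfer_R2[OF _ pq _ _ w1 w2]) (use sI in \<open>auto simp: R2_bigon_nth s_def\<close>)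
  then show ?thesis using same_transfer[of entry] L.has_transfer_empty inL by simp
qed

section \<open>The triangle moves, classical and mixed\<close>

locale triangle_pair =
  L: tangle_diagram k D "R3_triangle 1" "snd (tangle_of (R3_triangle 1) ov)" c m r "R3_dv 1" +
  R: tangle_diagram k D' "R3_triangle (- 1)" "snd (tangle_of (R3_triangle (- 1)) ov)" c m r "R3_dv (- 1)"
  for k D ov c m r D' +
  assumes agree': "\<forall>p \<in> passage_points k - (\<Union>j < length (R3_triangle 1). strand_points c m r j).
           loc D p = loc D' p \<and> (p \<in> over D \<longleftrightarrow> p \<in> over D')"
begin

lemmas crL = R3_crossing[of 1, simplified]
lemmas crR = R3_crossing[of "- 1", simplified]

text \<open>The strands producing a self-passage on \<open>j\<close>; their number is the number of
  self-passages on this strand.\<close>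

definition partners :: "nat \<Rightarrow> nat set" where
  "partners j = {l. l < 3 \<and> l \<noteq> j \<and> c l = c j \<and> (ov j l \<or> ov l j)}"

lemma self_params_L:
  assumes "j < 3"
  shows "L.self_params j = R3_pos 1 j ` partners j"
  unfolding L.self_params_def crL partners_def using assms R3_pos_sym[of 1 j] by auto

lemma self_params_R:
  assumes "j < 3"
  shows "R.self_params j = uminus ` L.self_params j"
  unfolding R.self_params_def crR self_params_L[OF assms] partners_def
  using assms R3_pos_sym[of "- 1" j] R3_pos_minus[of 1 j] by (auto simp: image_image)

lemma card_self_params: "j < 3 \<Longrightarrow> card (L.self_params j) = card (partners j)"
  unfolding self_params_L
  by (rule card_image) (use R3_pos_inj[of 1 j] in \<open>auto simp: inj_on_def partners_def\<close>)

sublocale tangle_pair k D "R3_triangle 1" "snd (tangle_of (R3_triangle 1) ov)" c m r "R3_dv 1"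
  D' "R3_triangle (- 1)" "snd (tangle_of (R3_triangle (- 1)) ov)" "R3_dv (- 1)"
proof (rule tangle_pairI[OF L.tangle_diagram_axioms R.tangle_diagram_axioms _ agree'])
  show "length (R3_triangle (- 1)) = length (R3_triangle 1)" by (simp add: R3_nth)
  fix j assume "j < length (R3_triangle 1)"
  then show "even (card (L.self_params j)) = even (card (R.self_params j))"
    by (simp add: self_params_R R3_nth card_image)
qed

lemma inner_L: "L.inner_crossings = {(L.pt a (R3_pos 1 a b), L.pt b (R3_pos 1 a b)) | a b. a < 3 \<and> b < 3 \<and> a \<noteq> b \<and> ov a b}"
  unfolding L.inner_crossings_eq crL by blast

lemma inner_R: "R.inner_crossings = {(L.pt a (- R3_pos 1 a b), L.pt b (- R3_pos 1 a b)) | a b. a < 3 \<and> b < 3 \<and> a \<noteq> b \<and> ov a b}"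
  unfolding R.inner_crossings_eq crR R3_pos_minus[symmetric] by blast

definition ev :: "nat \<Rightarrow> nat \<Rightarrow> bool" where
  "ev a b \<longleftrightarrow> c a = c b \<and>
     odd (L.base a + L.base b + L.local_index a (R3_pos 1 a b) + L.local_index b (R3_pos 1 a b))"

definition var :: "nat \<Rightarrow> nat \<Rightarrow> lvar" where
  "var a b = (if c a = c b then Z (c a) else W {c a, c b})"

definition sg :: "nat \<Rightarrow> nat \<Rightarrow> int" where
  "sg a b = (if R3_sign a b * (r a * r b) > 0 then 1 else - 1)"

lemma weight_L:
  assumes "a < 3" "b < 3" "a \<noteq> b" "ov a b"
  shows "crossing_weight k D (L.pt a (R3_pos 1 a b), L.pt b (R3_pos 1 a b)) = weight (ev a b) (var a b) (sg a b)"
  using L.weight_pt[of a "R3_pos 1 a b" b "R3_pos 1 a b"] assms R3_sign[OF assms(1-3), of 1]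
  unfolding crL ev_def var_def sg_def by simp

text \<open>By reflection the local indices on the two sides add up to one less than the number of
  partners. The parity of the crossing therefore persists when its two strands have equally many
  partners modulo 2.\<close>

lemma weight_R:
  assumes "a < 3" "b < 3" "a \<noteq> b" "ov a b"
    and par: "c a = c b \<Longrightarrow> even (card (partners a)) = even (card (partners b))"
  shows "crossing_weight k D' (L.pt a (- R3_pos 1 a b), L.pt b (- R3_pos 1 a b)) = weight (ev a b) (var a b) (sg a b)"
proof -
  let ?x = "R3_pos 1 a b"
  have n3: "length (R3_triangle 1) = 3" "length (R3_triangle (- 1)) = 3" by (simp_all add: R3_nth)
  have "(c a = c b \<and> odd (R.base a + R.base b + R.local_index a (- ?x) + R.local_index b (- ?x))) = ev a b"
  proof (cases "c a = c b")
    case True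
    have x: "?x \<in> L.self_params a" "?x \<in> L.self_params b"
    proof -
      have "b \<in> partners a" "a \<in> partners b" using assms(1-4) True by (simp_all add: partners_def)
      then show "?x \<in> L.self_params a" "?x \<in> L.self_params b"
        unfolding self_params_L[OF assms(1)] self_params_L[OF assms(2)]
        using imageI[of b "partners a" "R3_pos 1 a"] imageI[of a "partners b" "R3_pos 1 b"] R3_pos_sym[of 1 a b]
        by simp_all
    qed
    have "R.local_index j (- ?x) + L.local_index j ?x + 1 = card (partners j)" if "j < 3" "?x \<in> L.self_params j" for j
      unfolding R.local_index_def L.local_index_def self_params_R[OF that(1)] card_self_params[OF that(1), symmetric]
      by (rule card_below_reflect) (use that L.r_nonzero L.finite_self_params n3 in auto)
    from this[OF assms(1) x(1)] this[OF assms(2) x(2)]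
    have "even (R.local_index a (- ?x) + L.local_index a ?x) = even (R.local_index b (- ?x) + L.local_index b ?x)"
      using par[OF True] by (metis even_add)
    moreover have "even (L.base a) = even (R.base a)" "even (L.base b) = even (R.base b)"
      using base_parity assms n3 by auto
    ultimately show ?thesis using True by (simp add: ev_def) blast
  qed (simp add: ev_def)
  note evR = this
  have tc: "tangle_crossing (R3_triangle (- 1)) (snd (tangle_of (R3_triangle (- 1)) ov)) a (- ?x) b (- ?x)"
    unfolding crR R3_pos_minus using assms by simp
  have wd: "wedge (R3_dv (- 1) a (- ?x)) (R3_dv (- 1) b (- ?x)) = R3_sign a b"
    using R3_sign[OF assms(1-3), of "- 1"] unfolding R3_pos_minus by simp
  show ?thesis unfolding R.weight_pt[OF tc] evR wd var_def sg_def ..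
qed

lemma replacement_mixed:
  assumes ov: "one_classical 3 ov"
  shows "same_polynomial k D D'"
proof -
  obtain a b where ab: "a < 3" "b < 3" "a \<noteq> b" and ovd: "ov = (\<lambda>j l. j = a \<and> l = b)"
    using ov unfolding one_classical_def by blast
  let ?x = "R3_pos 1 a b"
  have n3: "length (R3_triangle 1) = 3" "length (R3_triangle (- 1)) = 3" by (simp_all add: R3_nth)
  \<comment> \<open>Each of the two strands has just the other one as a partner, so the condition of
    \<open>weight_R\<close> holds.\<close>
  have "partners a = {b}" "partners b = {a}" if "c a = c b"
    unfolding partners_def using ab that by (auto simp: ovd)
  then have w: "crossing_weight k D' (L.pt a (- ?x), L.pt b (- ?x)) = crossing_weight k D (L.pt a ?x, L.pt b ?x)"
    using weight_L[OF ab] weight_R[OF ab] by (simp add: ovd)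
  have inn: "L.inner_crossings = {(L.pt a ?x, L.pt b ?x)}" "R.inner_crossings = {(L.pt a (- ?x), L.pt b (- ?x))}"
    unfolding inner_L inner_R ovd using ab by auto
  have x: "?x \<in> {-1<..<1}" "- ?x \<in> {-1<..<1}" using R3_pos_interior[of 1 a b] by auto
  have l: "a < length (R3_triangle 1)" "b < length (R3_triangle 1)" "a < length (R3_triangle (- 1))" "b < length (R3_triangle (- 1))"
    using ab n3 by simp_all
  note trL = L.has_transfer_single[OF l(1,2) ab(3) x(1) x(1), of "crossing_weight k D"]
    and trR = R.has_transfer_single[OF l(3,4) ab(3) x(2) x(2), of "crossing_weight k D'", unfolded w]
  show ?thesis by (rule same_transfer[unfolded inn, OF trL trR])
qed

lemma replacement_R3:
  assumes ov: "stacked 3 ov"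
  shows "same_polynomial k D D'"
proof -
  obtain h :: "nat \<Rightarrow> nat" where h: "inj_on h {..<3}" "\<And>j l. j < 3 \<Longrightarrow> l < 3 \<Longrightarrow> ov j l \<longleftrightarrow> h l < h j"
    using ov unfolding stacked_def by blast
  have hne: "h 0 \<noteq> h 1" "h 0 \<noteq> h 2" "h 1 \<noteq> h 2"
    using inj_onD[OF h(1), of 0 1] inj_onD[OF h(1), of 0 2] inj_onD[OF h(1), of 1 2] by auto
  \<comment> \<open>The strands are named top, middle and bottom by height.\<close>
  obtain t m' b where tmb: "(t, m', b) \<in> {(0, 1, 2), (0, 2, 1), (1, 0, 2), (1, 2, 0), (2, 0, 1), (2, 1, 0::nat)}"
    and ht: "h b < h m'" "h m' < h t"
  proof -
    from hne consider "h 0 < h 1" "h 1 < h 2" | "h 0 < h 2" "h 2 < h 1" | "h 1 < h 0" "h 0 < h 2" | "h 1 < h 2" "h 2 < h 0"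
      | "h 2 < h 0" "h 0 < h 1" | "h 2 < h 1" "h 1 < h 0" by linarith
    then show ?thesis by cases (rule that; simp)+
  qed
  have set3: "{t, m', b} = {0, 1, 2}" using tmb by auto
  have lt: "t < 3" "m' < 3" "b < 3" and ne: "t \<noteq> m'" "t \<noteq> b" "m' \<noteq> b" using tmb by auto
  have in3: "x = t \<or> x = m' \<or> x = b" if "x < 3" for x
    using that set3 unfolding less_3 by auto
  have ovs: "a < 3 \<and> b' < 3 \<and> a \<noteq> b' \<and> ov a b' \<longleftrightarrow> (a, b') \<in> {(t, m'), (t, b), (m', b)}" for a b'
  proof
    assume H: "a < 3 \<and> b' < 3 \<and> a \<noteq> b' \<and> ov a b'"
    then have "h b' < h a" using h(2) by blast
    then show "(a, b') \<in> {(t, m'), (t, b), (m', b)}"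
      using in3[of a] in3[of b'] H ht by (elim disjE conjE) auto
  next
    assume "(a, b') \<in> {(t, m'), (t, b), (m', b)}"
    then show "a < 3 \<and> b' < 3 \<and> a \<noteq> b' \<and> ov a b'"
      using lt ne ht h(2)[OF lt(1,2)] h(2)[OF lt(1,3)] h(2)[OF lt(2,3)] by auto
  qed
  define x1 x2 x3 where "x1 = R3_pos 1 t m'" and "x2 = R3_pos 1 t b" and "x3 = R3_pos 1 m' b"
  have xI: "x1 \<in> {-1<..<1}" "x2 \<in> {-1<..<1}" "x3 \<in> {-1<..<1}" "- x1 \<in> {-1<..<1}" "- x2 \<in> {-1<..<1}" "- x3 \<in> {-1<..<1}"
    using R3_pos_interior[of 1] by (auto simp: x1_def x2_def x3_def)
  have xne: "x1 \<noteq> x2" "x1 \<noteq> x3" "x2 \<noteq> x3"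
    using tmb by (auto simp: x1_def x2_def x3_def R3_pos_def)
  have n3: "length (R3_triangle 1) = 3" "length (R3_triangle (- 1)) = 3" by (simp_all add: R3_nth)
  have r0: "r t \<noteq> 0" "r m' \<noteq> 0" "r b \<noteq> 0" using L.r_nonzero lt n3 by auto
  have innL: "L.inner_crossings = {(L.pt t x1, L.pt m' x1), (L.pt t x2, L.pt b x2), (L.pt m' x3, L.pt b x3)}"
    unfolding inner_L ovs x1_def x2_def x3_def by auto
  have innR: "R.inner_crossings = {(L.pt t (- x1), L.pt m' (- x1)), (L.pt t (- x2), L.pt b (- x2)), (L.pt m' (- x3), L.pt b (- x3))}"
    unfolding inner_R ovs x1_def x2_def x3_def by auto
  have part: "partners j = {l. l < 3 \<and> l \<noteq> j \<and> c l = c j}" if "j < 3" for j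
  proof -
    have "ov j l \<or> ov l j" if "l < 3" "l \<noteq> j" for l
      using inj_onD[OF h(1), of j l] h(2)[of j l] h(2)[of l j] that \<open>j < 3\<close> by auto
    then show ?thesis unfolding partners_def by auto
  qed
  \<comment> \<open>All strands cross classically, so the partners of a strand are the other strands
    of its component; strands of one component have equally many.\<close>
  have par: "card (partners a) = card (partners b')" if "a < 3" "b' < 3" "c a = c b'" for a b'
  proof -
    have "partners a = {l. l < 3 \<and> c l = c a} - {a}" "partners b' = {l. l < 3 \<and> c l = c a} - {b'}"
      using part[OF that(1)] part[OF that(2)] that(3) by auto
    then show ?thesis using that by (simp add: card_Diff_singleton)
  qed
  have pe: "even (card (partners a)) = even (card (partners b'))" if "a < 3" "b' < 3" "c a = c b'" for a b'
    using par[OF that] by (simp only:)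
  let ?w1 = "weight (ev t m') (var t m') (sg t m')" and ?w2 = "weight (ev t b) (var t b) (sg t b)"
    and ?w3 = "weight (ev m' b) (var m' b) (sg m' b)"
  have o3: "ov t m'" "ov t b" "ov m' b" using ovs by blast+
  have wL: "crossing_weight k D (L.pt t x1, L.pt m' x1) = ?w1" "crossing_weight k D (L.pt t x2, L.pt b x2) = ?w2"
    "crossing_weight k D (L.pt m' x3, L.pt b x3) = ?w3"
    unfolding x1_def x2_def x3_def using weight_L lt ne o3 by blast+
  have wR1: "crossing_weight k D' (L.pt t (- x1), L.pt m' (- x1)) = ?w1"
    unfolding x1_def by (rule weight_R[OF lt(1,2) ne(1) o3(1) pe[OF lt(1,2)]])
  have wR2: "crossing_weight k D' (L.pt t (- x2), L.pt b (- x2)) = ?w2"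
    unfolding x2_def by (rule weight_R[OF lt(1,3) ne(2) o3(2) pe[OF lt(1,3)]])
  have wR3: "crossing_weight k D' (L.pt m' (- x3), L.pt b (- x3)) = ?w3"
    unfolding x3_def by (rule weight_R[OF lt(2,3) ne(3) o3(3) pe[OF lt(2,3)]])
  define p q s where "p = (r t * x1 < r t * x2)" and "q = (r m' * x1 < r m' * x3)" and "s = (r b * x2 < r b * x3)"
  have flip: "(r j * (- x) < r j * (- y)) = (\<not> r j * x < r j * y)" if "r j \<noteq> 0" "x \<noteq> y" for j x y
    using that by (auto simp: mult_less_cancel_left)
  have trL: "L.has_transfer L.inner_crossings (crossing_weight k D) (L.triangle_transfer t m' b p q s ?w1 ?w2 ?w3)"
    unfolding innL p_def q_def s_def
    by (rule L.has_transfer_R3[OF n3(1) set3 xI(1-3) xne wL])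
  have trR: "R.has_transfer R.inner_crossings (crossing_weight k D') (L.triangle_transfer t m' b (\<not> p) (\<not> q) (\<not> s) ?w1 ?w2 ?w3)"
    unfolding innR p_def q_def s_def flip[OF r0(1) xne(1), symmetric] flip[OF r0(2) xne(2), symmetric] flip[OF r0(3) xne(3), symmetric]
    by (rule R.has_transfer_R3[OF n3(2) set3 xI(4-6) _ _ _ wR1 wR2 wR3]) (use xne in auto)
  \<comment> \<open>If all strands belong to one component, adding the three index sums counts each
    base number twice and the local indices to 3. The total is odd, so one or three crossings are
    even.\<close>
  have types: "ev t m' \<and> ev t b \<and> ev m' b \<or> \<not> ev t m' \<and> \<not> ev t b \<and> \<not> ev m' b \<or>
      ev t m' \<and> \<not> ev t b \<and> \<not> ev m' b \<and> var t b = var m' b \<or>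
      \<not> ev t m' \<and> ev t b \<and> \<not> ev m' b \<and> var t m' = var m' b \<or>
      \<not> ev t m' \<and> \<not> ev t b \<and> ev m' b \<and> var t m' = var t b"
  proof (cases "c t = c m' \<and> c m' = c b")
    case True
    have "L.self_params t = {x1, x2}" "L.self_params m' = {x1, x3}" "L.self_params b = {x2, x3}"
    proof -
      have "partners t = {m', b}" "partners m' = {t, b}" "partners b = {t, m'}"
        using part lt ne True in3 by auto
      then show "L.self_params t = {x1, x2}" "L.self_params m' = {x1, x3}" "L.self_params b = {x2, x3}"
        using self_params_L[OF lt(1)] self_params_L[OF lt(2)] self_params_L[OF lt(3)]
          R3_pos_sym[of 1 m' t] R3_pos_sym[of 1 b t] R3_pos_sym[of 1 b m'] by (simp_all add: x1_def x2_def x3_def)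
    qed
    then have "L.local_index t x1 + L.local_index t x2 = 1" "L.local_index m' x1 + L.local_index m' x3 = 1"
      "L.local_index b x2 + L.local_index b x3 = 1"
      unfolding L.local_index_def using card_below_two r0 xne by simp_all
    then have e: "(L.base t + L.base m' + L.local_index t x1 + L.local_index m' x1) +
      (L.base t + L.base b + L.local_index t x2 + L.local_index b x2) +
      (L.base m' + L.base b + L.local_index m' x3 + L.local_index b x3) = 2 * (L.base t + L.base m' + L.base b + 1) + 1"
      by simp
    have "odd ((L.base t + L.base m' + L.local_index t x1 + L.local_index m' x1) +
      (L.base t + L.base b + L.local_index t x2 + L.local_index b x2) +
      (L.base m' + L.base b + L.local_index m' x3 + L.local_index b x3))" unfolding e by simp
    moreover have "ev t m' = odd (L.base t + L.base m' + L.local_index t x1 + L.local_index m' x1)"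
      "ev t b = odd (L.base t + L.base b + L.local_index t x2 + L.local_index b x2)"
      "ev m' b = odd (L.base m' + L.base b + L.local_index m' x3 + L.local_index b x3)"
      using True by (simp_all add: ev_def x1_def x2_def x3_def)
    ultimately have "(ev t m' = ev t b) = ev m' b" by (metis even_add)
    moreover have "var t m' = Z (c t)" "var t b = Z (c t)" "var m' b = Z (c t)" using True by (simp_all add: var_def)
    ultimately show ?thesis by auto
  next
    \<comment> \<open>At most two of the strands share a component. If two do, the third crosses
      both in link crossings with the same variable; otherwise no crossing is even.\<close>
    case False
    then show ?thesis by (auto simp: ev_def var_def insert_commute)
  qed
  have lt_iff: "(u * x < u * y) = ((u > 0) = (x < y))" if "u \<noteq> 0" "x \<noteq> y" for u x y :: real
    using that by (auto simp: mult_less_cancel_left)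
  have pos_iff: "(z * (u * v) > 0) = ((z > 0) = ((u > 0) = (v > 0)))" if "z \<noteq> 0" "u \<noteq> 0" "v \<noteq> 0" for z u v :: real
    using that by (auto simp: zero_less_mult_iff mult_less_0_iff linorder_neq_iff)
  have sn: "R3_sign t m' \<noteq> 0" "R3_sign t b \<noteq> 0" "R3_sign m' b \<noteq> 0"
    using tmb R3_sign_values by auto
  \<comment> \<open>Checked for the six height orders: the bit computed from any of the three
    crossings is the same.\<close>
  have "((R3_sign t m' > 0) = ((x1 < x2) = (x1 < x3))) = ((R3_sign t b > 0) = ((x1 < x2) = (x2 < x3))) \<and>
    ((R3_sign t m' > 0) = ((x1 < x2) = (x1 < x3))) = ((R3_sign m' b > 0) = ((x1 < x3) = (x2 < x3)))"
  proof -
    have "R3_sign 0 (Suc 0) > 0" "\<not> R3_sign (Suc 0) 0 > 0" "\<not> R3_sign 0 2 > 0" "R3_sign 2 0 > 0"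
      "\<not> R3_sign (Suc 0) 2 > 0" "R3_sign 2 (Suc 0) > 0"
      using R3_sign_values by auto
    note sv = this
    from tmb show ?thesis
      unfolding x1_def x2_def x3_def R3_pos_def by (elim insertE emptyE) (simp_all add: sv)
  qed
  then have K: "(R3_sign t b > 0) = ((R3_sign t m' > 0) = ((x1 < x2) = (x1 < x3))) = ((x1 < x2) = (x2 < x3))"
    "(R3_sign m' b > 0) = ((R3_sign t m' > 0) = ((x1 < x2) = (x1 < x3))) = ((x1 < x3) = (x2 < x3))"
    by blast+
  \<comment> \<open>The bit \<open>k\<close> of \<open>triangle_out_flip\<close>, for strands
    traversed forwards. Reversing strands changes signs and orders together and leaves it
    unchanged.\<close>
  define kk where "kk = ((R3_sign t m' > 0) = ((x1 < x2) = (x1 < x3)))"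
  have signs: "sg t m' = (if kk = (p = q) then 1 else - 1)" "sg t b = (if kk = (p = s) then 1 else - 1)"
    "sg m' b = (if kk = (q = s) then 1 else - 1)"
  proof -
    have "(R3_sign t m' * (r t * r m') > 0) = (kk = (p = q))" "(R3_sign t b * (r t * r b) > 0) = (kk = (p = s))"
      "(R3_sign m' b * (r m' * r b) > 0) = (kk = (q = s))"
      unfolding pos_iff[OF sn(1) r0(1,2)] pos_iff[OF sn(2) r0(1,3)] pos_iff[OF sn(3) r0(2,3)]
        p_def q_def s_def lt_iff[OF r0(1) xne(1)] lt_iff[OF r0(2) xne(2)] lt_iff[OF r0(3) xne(3)] kk_def
      using K by blast+
    then show "sg t m' = (if kk = (p = q) then 1 else - 1)" "sg t b = (if kk = (p = s) then 1 else - 1)"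
      "sg m' b = (if kk = (q = s) then 1 else - 1)"
      unfolding sg_def by simp_all
  qed
  have "L.triangle_transfer t m' b p q s ?w1 ?w2 ?w3 = L.triangle_transfer t m' b (\<not> p) (\<not> q) (\<not> s) ?w1 ?w2 ?w3"
    unfolding L.triangle_transfer_def by (subst triangle_out_flip[OF types signs]) simp
  then show ?thesis using same_transfer[OF trL] trR by simp
qed

end

lemma move_same_polynomial:
  assumes mv: "move A B" and D: "is_diagram k D" and D': "is_diagram k D'"
    and rep: "tangle_replacement k A B D D'"
  shows "same_polynomial k D D'"
proof -
  from rep obtain c m r where len: "length (fst B) = length (fst A)"
    and tin: "tangle_in k D A c m r" "tangle_in k D' B c m r"
    and agree: "\<forall>p \<in> passage_points k - (\<Union>j < length (fst A). strand_points c m r j).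
           loc D p = loc D' p \<and> (p \<in> over D \<longleftrightarrow> p \<in> over D')"
    unfolding tangle_replacement_def by metis
  note LI = tangle_diagramI[OF D] and RI = tangle_diagramI[OF D']
  have eta: "tangle_of as ov = (as, snd (tangle_of as ov))" for as ov
    by (simp add: tangle_of_def)
  from mv show ?thesis
  proof cases
    case (R1 ov)
    obtain dv where ok: "tangle_ok [kink] ov dv" using kink_ok by blast
    obtain s where s: "ov = {(0, s)}" "s = 1 / 2 \<or> s = - 1 / 2" using R1(3) by blast
    show ?thesis
      using tin agree unfolding R1(1,2) fst_conv
      by (intro replacement_R1[OF LI[OF _ straight_ok] RI[OF _ ok] _ s])
  next
    case (R2 ov)
    have t: "tangle_in k D (R2_separate, snd (tangle_of R2_separate ov)) c m r"
      "tangle_in k D' (R2_bigon, snd (tangle_of R2_bigon ov)) c m r"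
      using tin unfolding R2(1,2) by (simp_all only: eta[symmetric])
    show ?thesis
      by (rule replacement_R2[OF LI[OF t(1) R2_separate_ok] RI[OF t(2) R2_bigon_ok] _ R2(3)])
        (use agree in \<open>simp only: R2(1) fst_tangle_of\<close>)
  next
    case (R3 ov)
    have t: "tangle_in k D (R3_triangle 1, snd (tangle_of (R3_triangle 1) ov)) c m r"
      "tangle_in k D' (R3_triangle (- 1), snd (tangle_of (R3_triangle (- 1)) ov)) c m r"
      using tin unfolding R3(1,2) by (simp_all only: eta[symmetric])
    interpret triangle_pair k D ov c m r D'
      by (intro triangle_pair.intro triangle_pair_axioms.intro LI[OF t(1) R3_ok] RI[OF t(2) R3_ok])
        (use agree in \<open>simp_all add: R3(1)\<close>)
    show ?thesis by (rule replacement_R3[OF R3(3)])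
  next
    case VR1
    obtain dv where ok: "tangle_ok [kink] {} dv" using kink_ok by blast
    note t = tin[unfolded VR1]
    show ?thesis
      by (rule replacement_without_crossings[OF LI[OF t(1) straight_ok] RI[OF t(2) ok]])
        (use agree in \<open>simp_all only: VR1 fst_conv straight_crossing kink_crossing, simp_all\<close>)
  next
    case VR2
    have t: "tangle_in k D (R2_separate, snd (tangle_of R2_separate all_virtual)) c m r"
      "tangle_in k D' (R2_bigon, snd (tangle_of R2_bigon all_virtual)) c m r"
      using tin unfolding VR2 by (simp_all only: eta[symmetric])
    show ?thesis
      by (rule replacement_without_crossings[OF LI[OF t(1) R2_separate_ok] RI[OF t(2) R2_bigon_ok]])
        (use agree in \<open>simp_all only: VR2 fst_tangle_of R2_separate_crossing R2_bigon_crossing all_virtual_def R2_bigon_nth(3)\<close>,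
          simp_all add: R2_separate_def)
  next
    case VR3
    have t: "tangle_in k D (R3_triangle 1, snd (tangle_of (R3_triangle 1) all_virtual)) c m r"
      "tangle_in k D' (R3_triangle (- 1), snd (tangle_of (R3_triangle (- 1)) all_virtual)) c m r"
      using tin unfolding VR3 by (simp_all only: eta[symmetric])
    have e: "(1::real) = 1 \<or> (1::real) = - 1" "(- 1::real) = 1 \<or> (- 1::real) = - 1" by auto
    show ?thesis
      by (rule replacement_without_crossings[OF LI[OF t(1) R3_ok[OF e(1)]] RI[OF t(2) R3_ok[OF e(2)]]])
        (use agree in \<open>simp_all add: VR3(1) R3_crossing[OF e(1)] R3_crossing[OF e(2)] all_virtual_def R3_nth\<close>)
  next
    case (mixed ov)
    have t: "tangle_in k D (R3_triangle 1, snd (tangle_of (R3_triangle 1) ov)) c m r"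
      "tangle_in k D' (R3_triangle (- 1), snd (tangle_of (R3_triangle (- 1)) ov)) c m r"
      using tin unfolding mixed(1,2) by (simp_all only: eta[symmetric])
    interpret triangle_pair k D ov c m r D'
      by (intro triangle_pair.intro triangle_pair_axioms.intro LI[OF t(1) R3_ok] RI[OF t(2) R3_ok])
        (use agree in \<open>simp_all add: mixed(1)\<close>)
    show ?thesis by (rule replacement_mixed[OF mixed(3)])
  qed
qed

section \<open>Planar isotopy\<close>

lemma reparametrization:
  assumes "circle_reparametrization \<tau>"
  shows "strict_mono \<tau>" "\<tau> (t + 1) = \<tau> t + 1" "\<tau> (t + of_int z) = \<tau> t + of_int z"
    "\<exists>x. \<tau> x = y" "(\<tau> has_real_derivative vector_derivative \<tau> (at t)) (at t)" "vector_derivative \<tau> (at t) > 0"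
proof -
  have C1: "\<tau> C1_differentiable_on UNIV" and pos: "\<And>t. vector_derivative \<tau> (at t) > 0"
    and per: "\<And>t. \<tau> (t + 1) = \<tau> t + 1"
    using assms by (auto simp: circle_reparametrization_def)
  have d: "(\<tau> has_real_derivative vector_derivative \<tau> (at t)) (at t)" for t
    using C1 by (auto simp: C1_differentiable_on_eq vector_derivative_works has_real_derivative_iff_has_vector_derivative)
  show "(\<tau> has_real_derivative vector_derivative \<tau> (at t)) (at t)" "vector_derivative \<tau> (at t) > 0"
    using d pos by auto
  show "strict_mono \<tau>"
  proof (rule strict_monoI)
    fix x y :: real assume "x < y"
    then show "\<tau> x < \<tau> y" by (rule DERIV_pos_imp_increasing) (use d pos in blast)
  qed
  show "\<tau> (t + 1) = \<tau> t + 1" by (rule per)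
  have nat: "\<tau> (t + of_nat n) = \<tau> t + of_nat n" for t n
    by (induction n) (simp_all add: per add.assoc[symmetric] add.commute[of 1])
  show int: "\<tau> (t + of_int z) = \<tau> t + of_int z" for t z
  proof (cases "0 \<le> z")
    case True
    then show ?thesis using nat[of t "nat z"] by simp
  next
    case False
    then show ?thesis using nat[of "t + of_int z" "nat (- z)"] by simp
  qed
  show "\<exists>x. \<tau> x = y"
  proof -
    \<comment> \<open>Since \<open>\<tau>\<close> advances by \<open>z\<close> over \<open>z\<close>
      full turns, \<open>y\<close> lies between its values at \<open>z\<close> and
      \<open>z + 1\<close>.\<close>
    define z where "z = \<lfloor>y - \<tau> 0\<rfloor>"
    have "\<tau> (of_int z) \<le> y" "y \<le> \<tau> (of_int (z + 1))"
      using int[of 0 z] int[of 0 "z + 1"] unfolding z_def by simp_all linarith+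
    moreover have "continuous_on {of_int z..of_int (z + 1)} \<tau>"
      using d by (meson DERIV_isCont continuous_at_imp_continuous_on)
    ultimately show ?thesis using IVT'[of \<tau> "of_int z" y "of_int (z + 1)"] by auto
  qed
qed

text \<open>On one period \<open>frac\<close> is a translation broken at most once, at the first
  integer beyond \<open>a\<close>; there the image passes the base point.\<close>

lemma frac_cases:
  fixes a t :: real
  assumes "a \<le> t" "t < a + 1"
  shows "frac t = (if t < of_int (\<lfloor>a\<rfloor> + 1) then t - of_int \<lfloor>a\<rfloor> else t - of_int \<lfloor>a\<rfloor> - 1)"
proof (cases "t < of_int (\<lfloor>a\<rfloor> + 1)")
  case True
  then have "\<lfloor>t\<rfloor> = \<lfloor>a\<rfloor>" using assms by (intro floor_unique) linarith+
  then show ?thesis using True by (simp add: frac_def)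
next
  case False
  then have "\<lfloor>t\<rfloor> = \<lfloor>a\<rfloor> + 1" using assms by (intro floor_unique) (simp_all, linarith+)
  then show ?thesis using False by (simp add: frac_def)
qed

text \<open>\<open>wedge (L 1) (L \<i>)\<close> is the determinant of \<open>L\<close>.\<close>

lemma wedge_linear:
  assumes "bounded_linear L"
  shows "wedge (L u) (L v) = wedge (L 1) (L \<i>) * wedge u v"
proof -
  interpret bounded_linear L by fact
  have "L z = Re z *\<^sub>R L 1 + Im z *\<^sub>R L \<i>" for z
  proof -
    have "z = Re z *\<^sub>R 1 + Im z *\<^sub>R \<i>" by (simp add: complex_eq_iff)
    then have "L z = L (Re z *\<^sub>R 1 + Im z *\<^sub>R \<i>)" by simp
    then show ?thesis by (simp only: add scaleR)
  qed
  from this[of u] this[of v] show ?thesis by (simp add: wedge_def algebra_simps)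
qed

text \<open>Along the isotopy the Jacobian determinant at \<open>z\<close> is continuous, never 0,
  and equal to 1 at time 0; so the final map preserves orientation.\<close>

lemma ambient_isotopy_end_derivative:
  assumes "ambient_isotopy_end \<phi>"
  shows "bij \<phi>" "\<exists>L. (\<phi> has_derivative L) (at z) \<and> wedge (L 1) (L \<i>) > 0"
proof -
  obtain H :: "real \<Rightarrow> complex \<Rightarrow> complex" and H' :: "real \<Rightarrow> complex \<Rightarrow> complex \<Rightarrow>\<^sub>L complex"
    where cont: "continuous_on ({0..1} \<times> UNIV) (\<lambda>(u, z). H' u z)"
      and H: "\<And>u. u \<in> {0..1} \<Longrightarrow> bij (H u)"
      and H': "\<And>u z. u \<in> {0..1} \<Longrightarrow> (H u has_derivative blinfun_apply (H' u z)) (at z)"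
      and b: "\<And>u z. u \<in> {0..1} \<Longrightarrow> bij (blinfun_apply (H' u z))"
      and H01: "H 0 = id" "H 1 = \<phi>"
    using assms unfolding ambient_isotopy_end_def by metis
  show "bij \<phi>" using H[of 1] H01 by simp
  define d where "d u = wedge (blinfun_apply (H' u z) 1) (blinfun_apply (H' u z) \<i>)" for u
  have c: "continuous_on {0..1} (\<lambda>u. H' u z)"
  proof -
    have "continuous_on {0..1} (\<lambda>u::real. (u, z))" by (intro continuous_intros)
    moreover have "(\<lambda>u::real. (u, z)) ` {0..1} \<subseteq> {0..1} \<times> UNIV" by auto
    ultimately show ?thesis using continuous_on_compose2[OF cont, of "{0..1}" "\<lambda>u. (u, z)"] by simp
  qed
  have cd: "continuous_on {0..1} d"
    unfolding d_def wedge_def by (intro continuous_intros c)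
  have nz: "d u \<noteq> 0" if u: "u \<in> {0..1}" for u
  proof
    assume d0: "d u = 0"
    \<comment> \<open>Preimages of \<open>1\<close> and \<open>\<i>\<close>: a vanishing determinant
      would make the wedge of their images 0, but it is 1.\<close>
    obtain v1 v2 where v: "blinfun_apply (H' u z) v1 = 1" "blinfun_apply (H' u z) v2 = \<i>"
      using b[OF u, of z] by (metis bij_pointE)
    have "wedge (blinfun_apply (H' u z) v1) (blinfun_apply (H' u z) v2) = d u * wedge v1 v2"
      unfolding d_def by (rule wedge_linear) (rule blinfun.bounded_linear_right)
    then show False using d0 v by (simp add: wedge_def)
  qed
  have "(id has_derivative blinfun_apply (H' 0 z)) (at z)" using H'[of 0 z] H01 by simp
  moreover have "(id has_derivative id) (at z)" by (simp add: id_def)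
  ultimately have "blinfun_apply (H' 0 z) = id" by (rule has_derivative_unique)
  then have d0: "d 0 = 1" by (simp add: d_def wedge_def)
  have "d 1 > 0"
  proof (rule ccontr)
    assume "\<not> d 1 > 0"
    then have "\<exists>u\<ge>0. u \<le> 1 \<and> d u = 0"
      using d0 cd by (intro IVT2') auto
    then show False using nz by auto
  qed
  then show "\<exists>L. (\<phi> has_derivative L) (at z) \<and> wedge (L 1) (L \<i>) > 0"
    using H'[of 1 z] H01 by (intro exI[of _ "blinfun_apply (H' 1 z)"]) (simp add: d_def)
qed

lemma isotopic_same_polynomial:
  assumes D: "is_diagram k D" and D': "is_diagram k D'" and iso: "planar_isotopic k D D'"
  shows "same_polynomial k D D'"
proof -
  obtain \<phi> \<tau> where \<phi>: "ambient_isotopy_end \<phi>"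
    and \<tau>: "\<And>i. i \<in> {1..k} \<Longrightarrow> circle_reparametrization (\<tau> i)"
    and curve: "\<And>i t. i \<in> {1..k} \<Longrightarrow> curve D' i t = \<phi> (curve D i (\<tau> i t))"
    and over: "\<And>i t. i \<in> {1..k} \<Longrightarrow> t \<in> {0..<1} \<Longrightarrow> (i, t) \<in> over D' \<longleftrightarrow> (i, frac (\<tau> i t)) \<in> over D"
    using iso unfolding planar_isotopic_def by blast
  note rp = reparametrization[OF \<tau>]
  have per: "curve D i (t + 1) = curve D i t" if "i \<in> {1..k}" for i t
    using D that by (simp add: is_diagram_def closed_immersion_def)
  have per_nat: "curve D i (t + of_nat j) = curve D i t" if "i \<in> {1..k}" for i t j
    by (induction j) (simp_all add: per[OF that] add.assoc[symmetric] add.commute[of 1])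
  have per_int: "curve D i (t + of_int z) = curve D i t" if i: "i \<in> {1..k}" for i t z
  proof (cases "0 \<le> z")
    case True
    then show ?thesis using per_nat[OF i, of t "nat z"] by simp
  next
    case False
    then show ?thesis using per_nat[OF i, of "t + of_int z" "nat (- z)"] by simp
  qed
  have per_frac: "curve D i (frac t) = curve D i t" if i: "i \<in> {1..k}" for i t
    using per_int[OF i, of "frac t" "\<lfloor>t\<rfloor>"] by (simp add: frac_def)
  \<comment> \<open>Carries passages of \<open>D'\<close> to passages of \<open>D\<close>, following
    the direction of \<open>\<tau>\<close>.\<close>
  define f where "f p = (fst p, frac (\<tau> (fst p) (snd p)))" for p
  have f_pp: "f p \<in> passage_points k" if "p \<in> passage_points k" for p
    using that by (auto simp: f_def passage_points_def frac_lt_1)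
  have range: "\<tau> i 0 \<le> \<tau> i t" "\<tau> i t < \<tau> i 0 + 1" if "i \<in> {1..k}" "0 \<le> t" "t < 1" for i t
  proof -
    have "\<tau> i t < \<tau> i (0 + 1)" using strict_monoD[OF rp(1)[OF that(1)], of t 1] that by simp
    then show "\<tau> i t < \<tau> i 0 + 1" using rp(2)[OF that(1), of 0] by simp
    show "\<tau> i 0 \<le> \<tau> i t" using strict_mono_less_eq[OF rp(1)[OF that(1)]] that by simp
  qed
  have snd_f: "snd (f (i, t)) = (if \<tau> i t < of_int (\<lfloor>\<tau> i 0\<rfloor> + 1) then \<tau> i t - of_int \<lfloor>\<tau> i 0\<rfloor> else \<tau> i t - of_int \<lfloor>\<tau> i 0\<rfloor> - 1)"
    if "i \<in> {1..k}" "0 \<le> t" "t < 1" for i t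
    unfolding f_def using frac_cases[OF range[OF that]] by simp
  have less: "\<tau> i t < \<tau> i t' \<longleftrightarrow> t < t'" if "i \<in> {1..k}" for i t t'
    using strict_mono_less[OF rp(1)[OF that]] .
  have inj: "inj_on f (passage_points k)"
  proof (rule inj_onI)
    fix p q assume p: "p \<in> passage_points k" and q: "q \<in> passage_points k" and e: "f p = f q"
    obtain i t t' where pq: "p = (i, t)" "q = (i, t')" using e by (cases p, cases q) (auto simp: f_def)
    then have I: "i \<in> {1..k}" "0 \<le> t" "t < 1" "0 \<le> t'" "t' < 1" using p q by (auto simp: passage_points_def)
    have "\<not> t < t'" "\<not> t' < t"
      using e snd_f[OF I(1,2,3)] snd_f[OF I(1,4,5)] range[OF I(1,2,3)] range[OF I(1,4,5)] less[OF I(1), of t t'] less[OF I(1), of t' t]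
      unfolding pq by (auto split: if_splits)
    then show "p = q" unfolding pq by simp
  qed
  have surj: "\<exists>p\<in>passage_points k. f p = q" if q: "q \<in> passage_points k" for q
  proof -
    obtain i y where iy: "q = (i, y)" "i \<in> {1..k}" "0 \<le> y" "y < 1" using q by (auto simp: passage_points_def)
    obtain x where x: "\<tau> i x = y" using rp(4)[OF iy(2), of y] by blast
    have "\<tau> i (frac x) = y + of_int (- \<lfloor>x\<rfloor>)"
      using rp(3)[OF iy(2), of x "- \<lfloor>x\<rfloor>"] x by (simp add: frac_def)
    then have "frac (\<tau> i (frac x)) = frac (y + of_int (- \<lfloor>x\<rfloor>))" by simp
    also have "\<dots> = y" using iy by (simp add: frac_eq frac_def floor_add_int floor_eq_iff)
    finally have "f (i, frac x) = q" by (simp add: f_def iy)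
    moreover have "(i, frac x) \<in> passage_points k" using iy by (simp add: passage_points_def frac_lt_1)
    ultimately show ?thesis by blast
  qed
  have loc_f: "loc D' p = \<phi> (loc D (f p))" if "p \<in> passage_points k" for p
    using that curve per_frac by (auto simp: loc_def f_def passage_points_def)
  have dp: "(p, q) \<in> double_pairs k D' \<longleftrightarrow> (f p, f q) \<in> double_pairs k D"
    if p: "p \<in> passage_points k" and q: "q \<in> passage_points k" for p q
  proof -
    have "loc D' p = loc D' q \<longleftrightarrow> loc D (f p) = loc D (f q)"
      using loc_f[OF p] loc_f[OF q] ambient_isotopy_end_derivative(1)[OF \<phi>] by (auto simp: bij_def dest: injD)
    moreover have "p = q \<longleftrightarrow> f p = f q" using inj p q by (auto dest: inj_onD)
    ultimately show ?thesis using p q f_pp by (auto simp: double_pairs_def)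
  qed
  have over_f: "p \<in> over D' \<longleftrightarrow> f p \<in> over D" if "p \<in> passage_points k" for p
    using that over[of "fst p" "snd p"] by (auto simp: f_def passage_points_def)
  have cr: "(p, q) \<in> crossings k D' \<longleftrightarrow> (f p, f q) \<in> crossings k D"
    if p: "p \<in> passage_points k" and q: "q \<in> passage_points k" for p q
    using dp[OF p q] over_f[OF p] by (simp add: crossings_def)
  have cr_pp: "p \<in> passage_points k \<and> q \<in> passage_points k" if "(p, q) \<in> crossings k E" for p q E
    using that by (auto simp: crossings_def double_pairs_def)
  have crossings_image: "crossings k D = (\<lambda>(p, q). (f p, f q)) ` crossings k D'"
  proof (rule Set.set_eqI)
    fix z
    show "z \<in> crossings k D \<longleftrightarrow> z \<in> (\<lambda>(p, q). (f p, f q)) ` crossings k D'"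
    proof
      assume z: "z \<in> crossings k D"
      obtain p' q' where pq': "z = (p', q')" by (cases z)
      then obtain p q where "p \<in> passage_points k" "f p = p'" "q \<in> passage_points k" "f q = q'"
        using cr_pp[of p' q' D] z surj by blast
      then have "(p, q) \<in> crossings k D'" "z = (\<lambda>(p, q). (f p, f q)) (p, q)" using cr z pq' by auto
      then show "z \<in> (\<lambda>(p, q). (f p, f q)) ` crossings k D'" by (rule rev_image_eqI)
    next
      assume "z \<in> (\<lambda>(p, q). (f p, f q)) ` crossings k D'"
      then obtain p q where pq: "z = (f p, f q)" "(p, q) \<in> crossings k D'" by auto
      then show "z \<in> crossings k D" using cr cr_pp by blast
    qed
  qed
  \<comment> \<open>Both passages of a double point are moved by the derivative \<open>L\<close> at
    the same point of the plane; the factors \<open>e\<close> are the positive speeds of the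
    reparametrization.\<close>
  have vel: "\<exists>L e. bounded_linear L \<and> wedge (L 1) (L \<i>) > 0 \<and> velocity D' p = e p *\<^sub>R L (velocity D (f p)) \<and> velocity D' q = e q *\<^sub>R L (velocity D (f q)) \<and> e p > 0 \<and> e q > (0::real)"
    if p: "p \<in> passage_points k" and q: "q \<in> passage_points k" and pq: "loc D (f p) = loc D (f q)" for p q
  proof -
    obtain L where L: "(\<phi> has_derivative L) (at (loc D (f p)))" "wedge (L 1) (L \<i>) > 0"
      using ambient_isotopy_end_derivative(2)[OF \<phi>] by blast
    have bl: "bounded_linear L" using L(1) by (rule has_derivative_bounded_linear)
    define e where "e z = vector_derivative (\<tau> (fst z)) (at (snd z))" for z
    have v: "velocity D' z = e z *\<^sub>R L (velocity D (f z)) \<and> e z > 0"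
      if z: "z \<in> passage_points k" and lz: "loc D (f z) = loc D (f p)" for z
    proof -
      obtain i t where it: "z = (i, t)" by (cases z)
      then have i: "i \<in> {1..k}" using z by (auto simp: passage_points_def)
      have d: "(curve D i has_vector_derivative vector_derivative (curve D i) (at x)) (at x)" for x
        using D i by (auto simp: is_diagram_def closed_immersion_def C1_differentiable_on_eq vector_derivative_works)
      have "vector_derivative (curve D i) (at (frac (\<tau> i t))) = vector_derivative (curve D i) (at (\<tau> i t))"
      proof -
        have "((\<lambda>x. x + of_int \<lfloor>\<tau> i t\<rfloor>) has_real_derivative 1) (at (frac (\<tau> i t)))"
          by (auto intro!: derivative_eq_intros)
        then have h: "((\<lambda>x. x + of_int \<lfloor>\<tau> i t\<rfloor>) has_vector_derivative 1) (at (frac (\<tau> i t)))"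
          by (simp add: has_real_derivative_iff_has_vector_derivative)
        have "((\<lambda>x. curve D i (x + of_int \<lfloor>\<tau> i t\<rfloor>)) has_vector_derivative vector_derivative (curve D i) (at (\<tau> i t))) (at (frac (\<tau> i t)))"
          using vector_diff_chain_at[OF h, of "curve D i"] d[of "\<tau> i t"] by (simp add: o_def frac_def)
        then show ?thesis using vector_derivative_at per_int[OF i] by simp
      qed
      then have vf: "velocity D (f z) = vector_derivative (curve D i) (at (\<tau> i t))"
        by (simp add: velocity_def f_def it)
      have "((curve D i \<circ> \<tau> i) has_vector_derivative e z *\<^sub>R velocity D (f z)) (at t)"
        unfolding vf unfolding e_def it fst_conv snd_conv
        by (rule vector_diff_chain_at) (use rp(5)[OF i] d in \<open>auto simp: has_real_derivative_iff_has_vector_derivative\<close>)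
      then have "((curve D i \<circ> \<tau> i) has_derivative (\<lambda>x. x *\<^sub>R (e z *\<^sub>R velocity D (f z)))) (at t)"
        by (simp add: has_vector_derivative_def)
      moreover have "(\<phi> has_derivative L) (at ((curve D i \<circ> \<tau> i) t))"
        using L(1) lz per_frac[OF i, of "\<tau> i t"] by (simp add: loc_def f_def it)
      ultimately have "((\<phi> \<circ> (curve D i \<circ> \<tau> i)) has_derivative (L \<circ> (\<lambda>x. x *\<^sub>R (e z *\<^sub>R velocity D (f z))))) (at t)"
        by (rule diff_chain_at)
      moreover have "\<phi> \<circ> (curve D i \<circ> \<tau> i) = curve D' i" using curve[OF i] by auto
      moreover have "L \<circ> (\<lambda>x. x *\<^sub>R (e z *\<^sub>R velocity D (f z))) = (\<lambda>x. x *\<^sub>R (e z *\<^sub>R L (velocity D (f z))))"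
        using linear_scale[OF bounded_linear.linear[OF bl]] by auto
      ultimately have "(curve D' i has_vector_derivative e z *\<^sub>R L (velocity D (f z))) (at t)"
        by (simp add: has_vector_derivative_def)
      then show ?thesis using rp(6)[OF i] by (simp add: velocity_def it vector_derivative_at e_def)
    qed
    show ?thesis using bl L(2) v[OF p refl] v[OF q pq[symmetric]] by blast
  qed
  have sign: "crossing_sign D (f p, f q) = crossing_sign D' (p, q)" if c: "(p, q) \<in> crossings k D'" for p q
  proof -
    have p: "p \<in> passage_points k" and q: "q \<in> passage_points k" using cr_pp[OF c] by auto
    have l: "loc D (f p) = loc D (f q)" using c cr[OF p q] by (auto simp: crossings_def double_pairs_def)
    obtain L e where L: "bounded_linear L" "wedge (L 1) (L \<i>) > 0" "velocity D' p = e p *\<^sub>R L (velocity D (f p))"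
      "velocity D' q = e q *\<^sub>R L (velocity D (f q))" "e p > 0" "e q > (0::real)" using vel[OF p q l] by blast
    have "wedge (velocity D' p) (velocity D' q) = (e p * e q * wedge (L 1) (L \<i>)) * wedge (velocity D (f p)) (velocity D (f q))"
    proof -
      have "wedge (velocity D' p) (velocity D' q) = e p * e q * wedge (L (velocity D (f p))) (L (velocity D (f q)))"
        unfolding L(3,4) by (simp add: wedge_def algebra_simps)
      then show ?thesis unfolding wedge_linear[OF L(1), of "velocity D (f p)"] by simp
    qed
    moreover have "e p * e q * wedge (L 1) (L \<i>) > 0" using L by simp
    then have "(e p * e q * wedge (L 1) (L \<i>)) * w > 0 \<longleftrightarrow> w > 0" for w
      using mult_less_cancel_left_pos[of "e p * e q * wedge (L 1) (L \<i>)" 0 w] by (simp only: mult_zero_right)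
    ultimately show ?thesis by (simp only: crossing_sign_def fst_conv snd_conv)
  qed
  have spi: "u \<in> self_passages k E i \<longleftrightarrow> (\<exists>p q. (p, q) \<in> crossings k E \<and> fst p = fst q \<and> ((i, u) = p \<or> (i, u) = q))" for u E i
  proof
    assume "u \<in> self_passages k E i"
    then obtain z where "z \<in> crossings k E" "fst (fst z) = fst (snd z)" "(i, u) = fst z \<or> (i, u) = snd z"
      unfolding self_passages_def self_crossing_def by blast
    then show "\<exists>p q. (p, q) \<in> crossings k E \<and> fst p = fst q \<and> ((i, u) = p \<or> (i, u) = q)"
      by (intro exI[of _ "fst z"] exI[of _ "snd z"]) simp
  next
    assume "\<exists>p q. (p, q) \<in> crossings k E \<and> fst p = fst q \<and> ((i, u) = p \<or> (i, u) = q)"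
    then obtain p q where "(p, q) \<in> crossings k E" "fst p = fst q" "(i, u) = p \<or> (i, u) = q" by blast
    then show "u \<in> self_passages k E i"
      unfolding self_passages_def self_crossing_def mem_Collect_eq by (intro bexI[of _ "(p, q)"]) simp_all
  qed
  have sp: "t \<in> self_passages k D' i \<longleftrightarrow> snd (f (i, t)) \<in> self_passages k D i" if "(i, t) \<in> passage_points k" for i t
  proof -
    have "(\<exists>p q. (p, q) \<in> crossings k D' \<and> fst p = fst q \<and> ((i, t) = p \<or> (i, t) = q)) \<longleftrightarrow>
      (\<exists>p q. (p, q) \<in> crossings k D \<and> fst p = fst q \<and> (f (i, t) = p \<or> f (i, t) = q))"
    proof
      assume "\<exists>p q. (p, q) \<in> crossings k D' \<and> fst p = fst q \<and> ((i, t) = p \<or> (i, t) = q)"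
      then obtain p q where pq: "(p, q) \<in> crossings k D'" "fst p = fst q" "(i, t) = p \<or> (i, t) = q" by blast
      have "(f p, f q) \<in> crossings k D" using cr cr_pp[OF pq(1)] pq(1) by blast
      moreover have "fst (f p) = fst (f q)" using pq(2) by (simp add: f_def)
      moreover have "f (i, t) = f p \<or> f (i, t) = f q" using pq(3) by blast
      ultimately show "\<exists>p q. (p, q) \<in> crossings k D \<and> fst p = fst q \<and> (f (i, t) = p \<or> f (i, t) = q)"
        by blast
    next
      assume "\<exists>p q. (p, q) \<in> crossings k D \<and> fst p = fst q \<and> (f (i, t) = p \<or> f (i, t) = q)"
      then obtain p q where c: "(p, q) \<in> crossings k D" "fst p = fst q" "f (i, t) = p \<or> f (i, t) = q" by blast
      then obtain p' q' where c': "(p', q') \<in> crossings k D'" "f p' = p" "f q' = q" unfolding crossings_image by auto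
      then have "(i, t) = p' \<or> (i, t) = q'" using c(3) inj that cr_pp[OF c'(1)] by (auto dest: inj_onD)
      moreover have "fst p' = fst q'" using c(2) c' by (auto simp: f_def)
      ultimately show "\<exists>p q. (p, q) \<in> crossings k D' \<and> fst p = fst q \<and> ((i, t) = p \<or> (i, t) = q)" using c'(1) by blast
    qed
    then show ?thesis unfolding spi by (simp add: f_def)
  qed
  have sp_pp: "(i, t) \<in> passage_points k" if "t \<in> self_passages k E i" for i t E
    using that cr_pp unfolding spi by blast
  \<comment> \<open>The self-passages of \<open>D'\<close> that are carried beyond the base point of
    \<open>D\<close>.\<close>
  define upper where "upper i = card {u \<in> self_passages k D' i. \<not> \<tau> i u < of_int (\<lfloor>\<tau> i 0\<rfloor> + 1)}" for i
  \<comment> \<open>Passages carried beyond the base point come first in \<open>D\<close>: the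
    others gain \<open>upper i\<close> in number, these lose the number of the others. The length of
    the word is even, so both shifts have the parity of \<open>upper i\<close>.\<close>
  have index: "even (self_index k D i (snd (f (i, t))) + self_index k D' i t + upper i)"
    if it: "(i, t) \<in> passage_points k" for i t
  proof -
    define l where "l u = (\<tau> i u < of_int (\<lfloor>\<tau> i 0\<rfloor> + 1))" for u
    let ?S = "self_passages k D' i" and ?g = "\<lambda>u. snd (f (i, u))"
    have i: "i \<in> {1..k}" and t: "0 \<le> t" "t < 1" using it by (auto simp: passage_points_def)
    have fin: "finite ?S" by (rule finite_self_passages[OF D'])
    have S: "self_passages k D i = ?g ` ?S"
    proof (rule Set.set_eqI)
      fix y
      show "y \<in> self_passages k D i \<longleftrightarrow> y \<in> ?g ` ?S"
      proof
        assume y: "y \<in> self_passages k D i"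
        then obtain p where p: "p \<in> passage_points k" "f p = (i, y)" using surj sp_pp by blast
        then have "p = (i, snd p)" by (auto simp: f_def)
        then have "snd p \<in> ?S" using sp[of i "snd p"] p y by auto
        moreover have "?g (snd p) = y" using \<open>p = (i, snd p)\<close> p by simp
        ultimately show "y \<in> ?g ` ?S" by blast
      next
        assume "y \<in> ?g ` ?S"
        then show "y \<in> self_passages k D i" using sp sp_pp by blast
      qed
    qed
    have S01: "0 \<le> u \<and> u < 1" if "u \<in> ?S" for u using sp_pp[OF that] by (auto simp: passage_points_def)
    have ig: "inj_on ?g ?S"
    proof (rule inj_onI)
      fix u v assume u: "u \<in> ?S" and v: "v \<in> ?S" and e: "?g u = ?g v"
      have "f (i, u) = f (i, v)" using e by (simp add: f_def)
      then show "u = v" using inj_onD[OF inj, of "(i, u)" "(i, v)"] sp_pp[OF u] sp_pp[OF v] by simp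
    qed
    have "{y \<in> self_passages k D i. y < ?g t} = ?g ` {u \<in> ?S. ?g u < ?g t}" unfolding S by auto
    then have ci: "self_index k D i (?g t) = card {u \<in> ?S. ?g u < ?g t}"
      unfolding self_index_def using card_image[OF inj_on_subset[OF ig]] by (metis (no_types, lifting) mem_Collect_eq subsetI)
    have gl: "?g u < ?g t \<longleftrightarrow> (if l u = l t then u < t else l t)" if "u \<in> ?S" for u
      using snd_f[OF i, of u] snd_f[OF i t] S01[OF that] range[OF i, of u] range[OF i t] less[OF i, of u t]
      unfolding l_def by auto
    have ll: "l u" if "u < t" "l t" for u using less[OF i, of u t] that unfolding l_def by linarith
    have up: "upper i = card {u \<in> ?S. \<not> l u}" unfolding upper_def l_def ..
    have fin': "finite {u \<in> ?S. P u}" for P using fin by simp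
    show ?thesis
    proof (cases "l t")
      case True
      have "{u \<in> ?S. ?g u < ?g t} = {u \<in> ?S. u < t} \<union> {u \<in> ?S. \<not> l u}"
        using gl True ll by auto
      moreover have "card ({u \<in> ?S. u < t} \<union> {u \<in> ?S. \<not> l u}) = card {u \<in> ?S. u < t} + card {u \<in> ?S. \<not> l u}"
        using ll True fin' by (intro card_Un_disjoint) auto
      ultimately have "self_index k D i (?g t) = self_index k D' i t + upper i"
        unfolding ci unfolding self_index_def up by simp
      then show ?thesis by (simp; blast)
    next
      case False
      have lu: "u < t" if "l u" for u using less[OF i, of t u] False that unfolding l_def by (cases "u = t") force+
      have gl': "?g u < ?g t \<longleftrightarrow> \<not> l u \<and> u < t" if "u \<in> ?S" for u
        using gl[OF that] False by simp
      have "{u \<in> ?S. u < t} = {u \<in> ?S. ?g u < ?g t} \<union> {u \<in> ?S. l u}"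
        using gl' lu by auto
      moreover have "card ({u \<in> ?S. ?g u < ?g t} \<union> {u \<in> ?S. l u}) = card {u \<in> ?S. ?g u < ?g t} + card {u \<in> ?S. l u}"
        using gl' fin' by (intro card_Un_disjoint) auto
      ultimately have 1: "self_index k D' i t = self_index k D i (?g t) + card {u \<in> ?S. l u}"
        unfolding ci unfolding self_index_def by simp
      have "card ?S = card ({u \<in> ?S. l u} \<union> {u \<in> ?S. \<not> l u})" by (rule arg_cong[of _ _ card]) auto
      also have "\<dots> = card {u \<in> ?S. l u} + card {u \<in> ?S. \<not> l u}"
        using fin' by (intro card_Un_disjoint) auto
      finally have "card ?S = card {u \<in> ?S. l u} + upper i" by (simp add: up)
      moreover have "even (card ?S)" by (rule even_card_self_passages[OF D'])
      ultimately have "even (card {u \<in> ?S. l u} + upper i)" by simp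
      then show ?thesis unfolding 1 by (simp; blast)
    qed
  qed
  have w: "crossing_weight k D (f p, f q) = crossing_weight k D' (p, q)" if c: "(p, q) \<in> crossings k D'" for p q
  proof -
    have p: "p \<in> passage_points k" and q: "q \<in> passage_points k" using cr_pp[OF c] by auto
    have c': "(f p, f q) \<in> crossings k D" using c cr[OF p q] by simp
    have ff: "fst (f p) = fst p" "fst (f q) = fst q" by (simp_all add: f_def)
    have "even_crossing k D (f p, f q) = even_crossing k D' (p, q)" if s: "fst p = fst q"
    proof -
      have "even (self_index k D (fst z) (snd (f z)) + self_index k D' (fst z) (snd z) + upper (fst z))"
        if "z \<in> passage_points k" for z
        using index[of "fst z" "snd z"] that by simp
      \<comment> \<open>The term \<open>upper\<close> occurs once for each passage of the crossing
        and cancels modulo 2.\<close>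
      from this[OF p] this[OF q]
      have "even (self_index k D (fst p) (snd (f p)) + self_index k D' (fst p) (snd p) + upper (fst p))"
        "even (self_index k D (fst p) (snd (f q)) + self_index k D' (fst p) (snd q) + upper (fst p))"
        unfolding s by blast+
      then show ?thesis
        using even_crossing_iff[OF D c'] even_crossing_iff[OF D' c s] s ff by simp blast
    qed
    then have "(fst p = fst q \<and> even_crossing k D (f p, f q)) = (fst p = fst q \<and> even_crossing k D' (p, q))" by blast
    then show ?thesis unfolding crossing_weight_eq ff sign[OF c] by simp
  qed
  let ?N = "arcs k D'"
  have as: "arc_set k D' ?N" by (rule arc_set_arcs[OF D'])
  then have Npp: "?N \<subseteq> passage_points k" and finN: "finite ?N" and ptsN: "crossing_points k D' \<subseteq> ?N"
    by (auto simp: arc_set_def)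
  have prevN: "prev ?N p \<in> ?N" "fst (prev ?N p) = fst p" "\<And>s. (fst p, s) \<in> ?N \<Longrightarrow> \<not> between (snd (prev ?N p)) s (snd p)" if "p \<in> ?N" for p
    using prev_props[OF finN, of p "snd p"] that by auto
  \<comment> \<open>Cyclic betweenness survives a rotation of the circle, although the linear order
    does not.\<close>
  have btw: "between (snd (f (i, x))) (snd (f (i, y))) (snd (f (i, z))) \<longleftrightarrow> between x y z"
    if "i \<in> {1..k}" "0 \<le> x" "x < 1" "0 \<le> y" "y < 1" "0 \<le> z" "z < 1" for i x y z
  proof -
    note sf = snd_f[OF that(1,2,3)] snd_f[OF that(1,4,5)] snd_f[OF that(1,6,7)]
    note rg = range[OF that(1,2,3)] range[OF that(1,4,5)] range[OF that(1,6,7)]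
    have b: "between x y z \<longleftrightarrow> between (\<tau> i x) (\<tau> i y) (\<tau> i z)"
      unfolding between_def using less[OF that(1)] by simp
    show ?thesis unfolding b unfolding between_def sf using rg by (auto split: if_splits)
  qed
  have prev_f: "prev (f ` ?N) (f p) = f (prev ?N p)" if p: "p \<in> ?N" for p
  proof (rule prev_eqI)
    show "finite (f ` ?N)" using finN by simp
    show "f (prev ?N p) \<in> f ` ?N" using prevN[OF p] by blast
    show "fst (f (prev ?N p)) = fst (f p)" using prevN(2)[OF p] by (simp add: f_def)
    fix s assume "(fst (f p), s) \<in> f ` ?N"
    then obtain z where z: "z \<in> ?N" "(fst (f p), s) = f z" by auto
    then have fz: "fst z = fst p" "s = snd (f z)" by (auto simp: f_def)
    then have zN: "(fst p, snd z) \<in> ?N" using z(1) by (metis prod.collapse)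
    obtain i x y t where e: "prev ?N p = (i, x)" "z = (i, y)" "p = (i, t)"
      using prevN(2)[OF p] fz(1) by (metis prod.collapse)
    have "(i, x) \<in> passage_points k" "(i, y) \<in> passage_points k" "(i, t) \<in> passage_points k"
      using prevN(1)[OF p] z(1) p Npp e by auto
    then have "i \<in> {1..k}" "0 \<le> x" "x < 1" "0 \<le> y" "y < 1" "0 \<le> t" "t < 1" by (auto simp: passage_points_def)
    note b = btw[OF this]
    have "\<not> between x y t" using prevN(3)[OF p zN] unfolding e(1) by (simp add: e(2,3))
    then have "\<not> between (snd (f (i, x))) (snd (f z)) (snd (f p))" using b by (simp add: e(2,3))
    then show "\<not> between (snd (f (prev ?N p))) s (snd (f p))" unfolding e(1) fz(2) .
  qed
  have "gdet (crossings k D) (crossing_weight k D) (f ` ?N) = gdet (crossings k D') (crossing_weight k D') ?N"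
    by (rule gdet_image[OF matching_crossings(1)[OF D'] finN inj_on_subset[OF inj Npp] _ _ prev_f prevN(1)
          matching_crossings(1)[OF D] crossings_image])
      (use ptsN w in \<open>auto simp: crossing_points_def\<close>)
  then have al: "alexander k D (f ` ?N) = alexander k D' ?N" by (simp add: alexander_def)
  have "arc_set k D (f ` ?N)"
    unfolding arc_set_def
  proof (intro conjI ballI)
    show "finite (f ` ?N)" using finN by simp
    show "crossing_points k D \<subseteq> f ` ?N"
      using ptsN unfolding crossing_points_def crossings_image by force
    show "f ` ?N \<subseteq> passage_points k" using f_pp Npp by auto
    fix i assume "i \<in> {1..k}"
    then obtain t where "(i, t) \<in> ?N" using as unfolding arc_set_def by blast
    then have "f (i, t) \<in> f ` ?N" by blast
    then show "\<exists>t. (i, t) \<in> f ` ?N" unfolding f_def fst_conv by blast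
  qed
  from alexander_arc_set[OF D arc_set_arcs[OF D] this] al
  have "alexander k D' ?N \<in> {alexander k D (arcs k D), - alexander k D (arcs k D)}" by simp
  then have "\<exists>e\<in>{1, - 1}. alexander k D' ?N = e * alexander k D (arcs k D)" by auto
  then show ?thesis unfolding same_polynomial_def using monomial_units_one by blast
qed

section \<open>The bound\<close>

lemma equivalent_same_polynomial:
  assumes "equivclp (diagram_step k) D D'"
  shows "same_polynomial k D D'"
  using assms
proof (induction rule: equivclp_induct)
  case base
  show ?case by (rule same_polynomial_refl)
next
  case (step E E')
  have *: "same_polynomial k A B" if "diagram_step k A B" for A B
    using that isotopic_same_polynomial move_same_polynomial unfolding diagram_step_def by blast
  have "same_polynomial k E E'" using step(2) * same_polynomial_sym by blast
  with step(3) show ?case by (rule same_polynomial_trans)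
qed

theorem theorem2p9:
  fixes k i j :: nat and K :: "vdiagram set" and P :: laurent
  assumes "K \<in> virtual_links k"
    and "i \<in> {1..k}" and "j \<in> {1..k}" and "i \<noteq> j"
    and "P \<in> glpa_polynomials k K"
  shows "max \<bar>e_max P (W {i, j})\<bar> \<bar>e_min P (W {i, j})\<bar> \<le> int (min_link_crossings k K i j)"
proof -
  let ?v = "W {i, j}" and ?n = "min_link_crossings k K i j"
  obtain D0 where D0: "is_diagram k D0"
    and K: "K = {D. is_diagram k D0 \<and> is_diagram k D \<and> equivclp (diagram_step k) D0 D}"
    using assms(1) unfolding virtual_links_def by (auto elim!: quotientE)
  have D0K: "D0 \<in> K" using D0 by (simp add: K)
  then have "\<exists>D\<in>K. card (link_crossings k D i j) = ?n"
    unfolding min_link_crossings_def by (intro LeastI_ex[of "\<lambda>n. \<exists>D\<in>K. card (link_crossings k D i j) = n"]) blast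
  \<comment> \<open>\<open>E\<close> attains the minimum, while \<open>P\<close> comes from an
    unrelated diagram \<open>D\<close>. Invariance transfers the bound, as the unit between the two
    determinants is free of \<open>w\<close>.\<close>
  then obtain E where E: "E \<in> K" "card (link_crossings k E i j) = ?n" by blast
  obtain e a b D xs where P: "P = e * vpow S a * vpow T b * Determinant.det (relation_matrix k D xs)"
    "e \<in> {1, - 1}" "D \<in> K" "distinct xs" "set xs = arcs k D"
    using assms(5) unfolding glpa_polynomials_def by blast
  have dD: "is_diagram k D" "is_diagram k E" using P(3) E(1) by (auto simp: K)
  have "same_polynomial k E D0" "same_polynomial k D0 D"
    using P(3) E(1) by (auto simp: K intro: equivalent_same_polynomial same_polynomial_sym)
  then have "same_polynomial k E D" by (rule same_polynomial_trans)
  then obtain u where u: "u \<in> monomial_units" "alexander k D (arcs k D) = u * alexander k E (arcs k E)"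
    unfolding same_polynomial_def by blast
  have "P = (e * vpow S a * vpow T b) * u * alexander k E (arcs k E)"
    unfolding P(1) det_relation_matrix[OF dD(1) P(4,5)] u(2) by (simp only: mult.assoc)
  moreover have unit: "exponents_in ?v 0 0 x" if xu: "x \<in> monomial_units" for x
  proof -
    obtain e a b where x: "x = e * vpow S a * vpow T b" "e \<in> {1, - 1}"
      using xu unfolding monomial_units_def by blast
    have "exponents_in ?v 0 0 e" using x(2) exponents_in_1 exponents_in_uminus[OF exponents_in_1] by auto
    from exponents_in_mult[OF exponents_in_mult[OF this exponents_in_vpow[of ?v S a]] exponents_in_vpow[of ?v T b]]
    show ?thesis unfolding x by simp
  qed
  ultimately have bd: "exponents_in ?v (- int ?n) (int ?n) P"
    using exponents_in_mult[OF exponents_in_mult[OF unit[OF monomial_unitsI[OF P(2)]] unit[OF u(1)]]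
      alexander_exponents[OF dD(2) arc_set_arcs[OF dD(2)] assms(4)]] E(2) by simp
  show ?thesis
  \<comment> \<open>The zero polynomial has no exponents; its extremes are 0 by convention.\<close>
  proof (cases "P = 0")
    case True
    then show ?thesis by (simp add: e_max_def e_min_def)
  next
    case False
    then have ne: "exponents P ?v \<noteq> {}" and fin: "finite (exponents P ?v)" by (simp_all add: exponents_def)
    have "\<bar>x\<bar> \<le> int ?n" if "x \<in> exponents P ?v" for x
      using that bd by (auto simp: exponents_def exponents_in_def abs_le_iff)
    then show ?thesis using False Max_in[OF fin ne] Min_in[OF fin ne] by (simp add: e_max_def e_min_def)
  qed
qed

end
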